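(* Let $\mu$, $\hat\mu=\sum_{\gamma\in\Gamma}b_\gamma\delta_\gamma$, $A=\{a_n\}_{n\in\mathbb Z}$ and $f$ be as described in the context. If $$\int_0^1 s^{-2}\,|\hat\mu|(0,s)\,ds<\infty,\qquad\text{where } |\hat\mu|(0,s)=\sum_{\gamma\in\Gamma,\,0<\gamma<s}|b_\gamma|,$$ then the function $$f(z)=(1-z/a_0)\prod_{n\ge1}(1-z/a_n)(1-z/a_{-n}),$$ whose zero set is $A$, can be written in the form $$f(z)=\sum_{\omega\in\Omega}q_\omega e^{2\pi i\omega z},\qquad q_\omega\in\mathbb C\setminus\{0\},\quad \omega\in\mathbb R,\quad \sum_{\omega\in\Omega}|q_\omega|<\infty,$$ where $\Omega\subset\mathbb R$ is a countable bounded set satisfying $\sup\Omega\in\Omega$ and $\inf\Omega\in\Omega$.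
   Context: Setting. $\mu=\sum_{\lambda\in\Lambda}c_\lambda\delta_\lambda$ is a nonzero measure on $\mathbb R$ with $\Lambda\subset\mathbb R$ discrete and locally finite and $c_\lambda$ positive integers; $\mu$ is a temperate distribution; its distributional Fourier transform is a pure point measure $\hat\mu=\sum_{\gamma\in\Gamma}b_\gamma\delta_\gamma$ with $\Gamma\subset\mathbb R$ an at most countable set (not necessarily discrete), $b_\gamma\in\mathbb C$; and the measure $|\hat\mu|=\sum_{\gamma\in\Gamma}|b_\gamma|\delta_\gamma$ is also a temperate distribution. The Fourier transform of a temperate distribution $u$ is defined by $\hat u(\varphi)=u(\hat\varphi)$ for Schwartz functions $\varphi$, with $\hat\varphi(t)=\int_{\mathbb R}\varphi(x)e^{-2\pi ixt}\,dx$. $A=\{a_n\}_{n\in\mathbb Z}$ is the multiset in which each $\lambda\in\Lambda$ occurs $c_\lambda$ times, enumerated so that $a_n\le a_{n+1}$ for all $n\in\mathbb Z$; it is assumed that $0\notin A$. Under these assumptions $A$ is known to be an almost periodic set (for every $\varepsilon>0$, the set of $\tau\in\mathbb R$ for which there is a bijection $\sigma:\mathbb Z\to\mathbb Z$ with $\sup_n|a_n+\tau-a_{\sigma(n)}|<\varepsilon$ is relatively dense in $\mathbb R$), and the product defining $f$ converges to an entire function of exponential type with zero set $A$ (with multiplicities). *)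

theory Defs
  imports "HOL-Complex_Analysis.Complex_Analysis"
begin

definition nth_vderiv :: "nat \<Rightarrow> (real \<Rightarrow> complex) \<Rightarrow> real \<Rightarrow> complex" where
  "nth_vderiv n \<phi> = ((\<lambda>g x. vector_derivative g (at x)) ^^ n) \<phi>"

definition smooth :: "(real \<Rightarrow> complex) \<Rightarrow> bool" where
  "smooth \<phi> \<longleftrightarrow> (\<forall>n x. nth_vderiv n \<phi> differentiable (at x))"

definition test_functions :: "(real \<Rightarrow> complex) set" where
  "test_functions = {\<phi>. smooth \<phi> \<and> (\<exists>r. \<forall>x. r < \<bar>x\<bar> \<longrightarrow> \<phi> x = 0)}"

definition schwartz :: "(real \<Rightarrow> complex) set" where
  "schwartz = {\<phi>. smooth \<phi> \<and>
     (\<forall>k n. bounded (range (\<lambda>x. complex_of_real (x ^ k) * nth_vderiv n \<phi> x)))}"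

definition schwartz_seminorm :: "nat \<Rightarrow> nat \<Rightarrow> (real \<Rightarrow> complex) \<Rightarrow> real" where
  "schwartz_seminorm k n \<phi> = (SUP x. \<bar>x\<bar> ^ k * norm (nth_vderiv n \<phi> x))"

text \<open>
  A distribution is a functional on all functions \<open>real \<Rightarrow> complex\<close> of which only the values on
  \<^const>\<open>schwartz\<close> matter. The last conjunct is continuity for the topology generated by
  the seminorms \<^const>\<open>schwartz_seminorm\<close>.
\<close>

definition temperate_distribution :: "((real \<Rightarrow> complex) \<Rightarrow> complex) \<Rightarrow> bool" where
  "temperate_distribution u \<longleftrightarrow>
     (\<forall>\<phi>\<in>schwartz. \<forall>\<psi>\<in>schwartz. u (\<lambda>x. \<phi> x + \<psi> x) = u \<phi> + u \<psi>) \<and>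
     (\<forall>\<phi>\<in>schwartz. \<forall>z. u (\<lambda>x. z * \<phi> x) = z * u \<phi>) \<and>
     (\<exists>C N. \<forall>\<phi>\<in>schwartz. norm (u \<phi>) \<le> C * (\<Sum>k\<le>N. \<Sum>n\<le>N. schwartz_seminorm k n \<phi>))"

definition fourier :: "(real \<Rightarrow> complex) \<Rightarrow> real \<Rightarrow> complex" where
  "fourier \<phi> t = (\<integral>x. \<phi> x * exp (- (2 * of_real pi * \<i> * of_real x * of_real t)) \<partial>lborel)"

definition fourier_distribution ::
    "((real \<Rightarrow> complex) \<Rightarrow> complex) \<Rightarrow> (real \<Rightarrow> complex) \<Rightarrow> complex" where
  "fourier_distribution u = (\<lambda>\<phi>. u (fourier \<phi>))"

text \<open>
  The distribution \<open>u\<close> is the pure point (Radon) measure with mass \<open>w s\<close> at each \<open>s \<in> S\<close>.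
  The identity is required for compactly supported test functions only; since these are dense
  in the Schwartz space, it determines a temperate \<open>u\<close>. The set \<open>S\<close> need not be discrete, so
  finiteness of the total variation on bounded intervals is part of the notion.
\<close>

definition is_point_measure ::
    "((real \<Rightarrow> complex) \<Rightarrow> complex) \<Rightarrow> real set \<Rightarrow> (real \<Rightarrow> complex) \<Rightarrow> bool" where
  "is_point_measure u S w \<longleftrightarrow>
     (\<forall>r. (\<lambda>s. norm (w s)) summable_on (S \<inter> {-r..r})) \<and>
     (\<forall>\<phi>\<in>test_functions. ((\<lambda>s. w s * \<phi> s) has_sum u \<phi>) S)"

definition symmetric_factor :: "(int \<Rightarrow> real) \<Rightarrow> complex \<Rightarrow> nat \<Rightarrow> complex" where
  "symmetric_factor a z n = (1 - z / of_real (a (int n))) * (1 - z / of_real (a (- int n)))"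

text \<open>The infinite product runs over \<open>n \<ge> 1\<close>, hence the shift by \<^const>\<open>Suc\<close>.\<close>

definition zero_product :: "(int \<Rightarrow> real) \<Rightarrow> complex \<Rightarrow> complex" where
  "zero_product a z = (1 - z / of_real (a 0)) * (\<Prod>n. symmetric_factor a z (Suc n))"

end

theory Submission
  imports Defs
begin

text \<open>
  The logarithmic derivative of the symmetric product is \<open>\<Sum> 1 / (z - a\<^sub>n)\<close>, and for \<open>Im z > 0\<close>
  the kernel \<open>1 / (z - t)\<close> is a superposition of the waves \<open>exp (2\<pi>is (z - t))\<close> with \<open>s > 0\<close>. The
  Fourier transform of the measure therefore turns the logarithmic derivative into a constant plus
  the Dirichlet series \<open>-2\<pi>i \<Sum> b\<^sub>g exp (2\<pi>igz)\<close> over the positive \<open>g\<close> in \<open>\<Gamma>\<close>. By Tonelli the integral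
  condition says that \<open>\<Sum> \<bar>b\<^sub>g\<bar> / g\<close> converges near \<open>g = 0\<close>, which is what is needed to
  integrate this series once more. So the product is
  \<open>\<kappa> exp (2\<pi>i\<alpha>z - \<Sum> (b\<^sub>g / g) exp (2\<pi>igz))\<close> in the upper half plane (\<open>zero_product_upper\<close>), and
  expanding the exponential gives an absolutely convergent sum whose frequencies are at least
  \<open>\<alpha>\<close>, the coefficient at \<open>\<alpha>\<close> being \<open>\<kappa> \<noteq> 0\<close> (\<open>upper_expansion\<close>). Since the zeros are real,
  conjugation gives an expansion in the lower half plane with frequencies at most \<open>-\<alpha>\<close>. The
  product is bounded on the strip \<open>\<bar>Im z\<bar> \<le> 1\<close>, hence its Fourier--Bohr coefficients on the two
  boundary lines coincide (\<open>coefficients_symmetric\<close>); both expansions are the same, and the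
  frequencies fill a subset of \<open>[\<alpha>, -\<alpha>]\<close> that contains both end points.

  Two facts about the points \<open>a\<^sub>n\<close> support this. Their density is bounded
  (\<open>cauchy_kernel_sum_bounded\<close>), because averaging the summation formula over modulations
  produces a positive kernel on the side of the points while the spectral side stays bounded. And
  \<open>a\<^sub>n + a\<^sub>-\<^sub>n\<close> is bounded (\<open>pair_sums_bounded\<close>): the convergence of \<open>\<Sum> \<bar>b\<^sub>g\<bar> / g\<close> makes the
  antiderivative of the smoothed counting measure linear up to a bounded error, and
  so the points lie within bounded distance of an arithmetic progression. This makes the symmetric
  product converge absolutely and forces \<open>\<alpha>\<close> to be real.

  To avoid the conditional convergence of \<open>\<Sum> 1 / (z - a\<^sub>n)\<close> and the jump of its transform at
  \<open>0\<close>, the summation formula is applied to the kernel \<open>1 / (z - t)\<^sup>2\<close>, whose transform is the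
  continuous ramp \<open>s\<^sub>+\<close> (\<open>cauchy_kernel_formula\<close>), and integrated afterwards. Only test functions
  built from one explicit bump enter; the formula holds for them because the transform of a
  test function is a Schwartz function, to which the point measure extends.
\<close>

section \<open>Smooth functions and their derivatives\<close>

text \<open>
  Iterated derivatives are handled through a sequence of functions each of which differentiates
  to the next one: its first member determines it, so exhibiting it proves smoothness and
  computes all derivatives at the same time.
\<close>

definition derivative_tower :: "(nat \<Rightarrow> real \<Rightarrow> complex) \<Rightarrow> bool" where
  "derivative_tower F \<longleftrightarrow> (\<forall>n x. (F n has_vector_derivative F (Suc n) x) (at x))"

lemma nth_vderiv_0 [simp]: "nth_vderiv 0 \<phi> = \<phi>"
  by (simp add: nth_vderiv_def)

lemma nth_vderiv_Suc: "nth_vderiv (Suc n) \<phi> = (\<lambda>x. vector_derivative (nth_vderiv n \<phi>) (at x))"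
  by (simp add: nth_vderiv_def)

lemma nth_vderiv_Suc_left: "nth_vderiv (Suc n) \<phi> = nth_vderiv n (nth_vderiv 1 \<phi>)"
  by (simp only: nth_vderiv_def funpow_Suc_right One_nat_def) simp

lemma derivative_tower_nth_vderiv:
  assumes "derivative_tower F"
  shows "nth_vderiv n (F 0) = F n"
proof (induction n)
  case (Suc n)
  show ?case
    using assms by (auto simp: nth_vderiv_Suc Suc.IH derivative_tower_def vector_derivative_at)
qed simp

lemma derivative_tower_smooth: "derivative_tower F \<Longrightarrow> smooth (F 0)"
  by (auto simp: smooth_def derivative_tower_nth_vderiv derivative_tower_def
      intro: differentiableI_vector)

lemma smooth_derivative_tower: "smooth \<phi> \<Longrightarrow> derivative_tower (\<lambda>n. nth_vderiv n \<phi>)"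
  by (auto simp: smooth_def derivative_tower_def nth_vderiv_Suc vector_derivative_works)

lemma smooth_has_vector_derivative:
  "smooth \<phi> \<Longrightarrow> (nth_vderiv n \<phi> has_vector_derivative nth_vderiv (Suc n) \<phi> x) (at x)"
  using smooth_derivative_tower by (auto simp: derivative_tower_def)

lemma smooth_nth_vderiv_continuous: "smooth \<phi> \<Longrightarrow> continuous_on A (nth_vderiv n \<phi>)"
  by (meson continuous_at_imp_continuous_on has_vector_derivative_continuous
      smooth_has_vector_derivative)

lemma smooth_continuous: "smooth \<phi> \<Longrightarrow> continuous_on A \<phi>"
  using smooth_nth_vderiv_continuous[of \<phi> A 0] by simp

lemma smooth_nth_vderiv: "smooth \<phi> \<Longrightarrow> smooth (nth_vderiv 1 \<phi>)"
  unfolding smooth_def nth_vderiv_Suc_left[symmetric] by blast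

lemma derivative_tower_add:
  assumes "derivative_tower F" "derivative_tower G"
  shows "derivative_tower (\<lambda>n x. F n x + G n x)"
  using assms by (auto simp: derivative_tower_def intro!: derivative_intros)

lemma derivative_tower_affine:
  assumes "derivative_tower F"
  shows "derivative_tower (\<lambda>n x. of_real (c ^ n) * F n (c * x + d))"
  unfolding derivative_tower_def
proof (intro allI)
  fix n x
  have "((F n \<circ> (\<lambda>x. c * x + d)) has_vector_derivative c *\<^sub>R F (Suc n) (c * x + d)) (at x)"
    by (rule vector_diff_chain_at)
      (use assms in \<open>auto simp: derivative_tower_def intro!: derivative_eq_intros\<close>)
  then have "((\<lambda>x. F n (c * x + d)) has_vector_derivative c *\<^sub>R F (Suc n) (c * x + d)) (at x)"
    by (simp add: o_def)
  from has_vector_derivative_mult_right[OF this, of "of_real (c ^ n)"]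
  show "((\<lambda>x. of_real (c ^ n) * F n (c * x + d)) has_vector_derivative
      of_real (c ^ Suc n) * F (Suc n) (c * x + d)) (at x)"
    by (simp add: scaleR_conv_of_real mult_ac)
qed

lemma derivative_tower_mult:
  assumes "derivative_tower F" "derivative_tower G"
  shows "derivative_tower (\<lambda>n x. \<Sum>k\<le>n. of_nat (n choose k) * (F k x * G (n - k) x))"
  unfolding derivative_tower_def
proof (intro allI)
  fix n x
  let ?D = "\<Sum>k\<le>n. of_nat (n choose k) * (F k x * G (Suc (n - k)) x + F (Suc k) x * G (n - k) x)"
  have "((\<lambda>x. \<Sum>k\<le>n. of_nat (n choose k) * (F k x * G (n - k) x)) has_vector_derivative ?D) (at x)"
    by (intro has_vector_derivative_sum has_vector_derivative_mult_right has_vector_derivative_mult)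
      (use assms in \<open>auto simp: derivative_tower_def\<close>)
  moreover have "?D = (\<Sum>k\<le>Suc n. of_nat (Suc n choose k) * (F k x * G (Suc n - k) x))"
  proof -
    have "(\<Sum>k\<le>n. of_nat (n choose k) * (F k x * G (Suc (n - k)) x))
        = (\<Sum>k\<le>Suc n. of_nat (n choose k) * (F k x * G (Suc n - k) x))"
      by (simp add: Suc_diff_le)
    also have "\<dots> = F 0 x * G (Suc n) x
        + (\<Sum>k\<le>n. of_nat (n choose Suc k) * (F (Suc k) x * G (n - k) x))"
      by (subst sum.atMost_Suc_shift) simp
    finally have 1: "(\<Sum>k\<le>n. of_nat (n choose k) * (F k x * G (Suc (n - k)) x)) = \<dots>" .
    show ?thesis
      unfolding distrib_left sum.distrib 1
      by (subst sum.atMost_Suc_shift) (simp add: distrib_right sum.distrib)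
  qed
  ultimately show "((\<lambda>x. \<Sum>k\<le>n. of_nat (n choose k) * (F k x * G (n - k) x)) has_vector_derivative
      (\<Sum>k\<le>Suc n. of_nat (Suc n choose k) * (F k x * G (Suc n - k) x))) (at x)"
    by simp
qed

lemma nth_vderiv_mult:
  assumes "smooth \<phi>" "smooth \<psi>"
  shows "nth_vderiv n (\<lambda>x. \<phi> x * \<psi> x) x
    = (\<Sum>k\<le>n. of_nat (n choose k) * (nth_vderiv k \<phi> x * nth_vderiv (n - k) \<psi> x))"
  using derivative_tower_nth_vderiv[OF derivative_tower_mult[OF assms[THEN smooth_derivative_tower]],
      of n] by simp

lemma smooth_mult: "smooth \<phi> \<Longrightarrow> smooth \<psi> \<Longrightarrow> smooth (\<lambda>x. \<phi> x * \<psi> x)"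
  using derivative_tower_smooth[OF derivative_tower_mult[OF smooth_derivative_tower smooth_derivative_tower], of \<phi> \<psi>]
  by simp

lemma smooth_add: "smooth \<phi> \<Longrightarrow> smooth \<psi> \<Longrightarrow> smooth (\<lambda>x. \<phi> x + \<psi> x)"
  using derivative_tower_smooth[OF derivative_tower_add[OF smooth_derivative_tower smooth_derivative_tower], of \<phi> \<psi>]
  by simp

lemma nth_vderiv_add:
  assumes "smooth \<phi>" "smooth \<psi>"
  shows "nth_vderiv n (\<lambda>x. \<phi> x + \<psi> x) x = nth_vderiv n \<phi> x + nth_vderiv n \<psi> x"
  using derivative_tower_nth_vderiv[OF derivative_tower_add[OF assms[THEN smooth_derivative_tower]],
      of n] by simp

lemma smooth_affine: "smooth \<phi> \<Longrightarrow> smooth (\<lambda>x. \<phi> (c * x + d))"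
  using derivative_tower_smooth[OF derivative_tower_affine[OF smooth_derivative_tower], of \<phi> c d]
  by simp

lemma nth_vderiv_affine:
  assumes "smooth \<phi>"
  shows "nth_vderiv n (\<lambda>x. \<phi> (c * x + d)) x = of_real (c ^ n) * nth_vderiv n \<phi> (c * x + d)"
  using derivative_tower_nth_vderiv[OF derivative_tower_affine[OF assms[THEN smooth_derivative_tower]],
      of n c d] by simp

lemma derivative_tower_const: "derivative_tower (\<lambda>n x. if n = 0 then w else 0)"
  by (auto simp: derivative_tower_def intro!: derivative_eq_intros)

lemma smooth_const [simp]: "smooth (\<lambda>x. w)"
  using derivative_tower_smooth[OF derivative_tower_const] by simp

lemma nth_vderiv_const: "nth_vderiv n (\<lambda>x. w) = (\<lambda>x. if n = 0 then w else 0)"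
  using derivative_tower_nth_vderiv[OF derivative_tower_const, of n w] by simp

lemma nth_vderiv_cmult:
  assumes "smooth \<phi>"
  shows "nth_vderiv n (\<lambda>x. w * \<phi> x) x = w * nth_vderiv n \<phi> x"
proof -
  have "derivative_tower (\<lambda>n x. w * nth_vderiv n \<phi> x)"
    using smooth_derivative_tower[OF assms]
    by (auto simp: derivative_tower_def intro!: derivative_intros)
  from derivative_tower_nth_vderiv[OF this, of n] show ?thesis by simp
qed

lemma nth_vderiv_eq_0_on_open:
  assumes "open U" "\<And>x. x \<in> U \<Longrightarrow> \<phi> x = 0" "x \<in> U"
  shows "nth_vderiv n \<phi> x = 0"
  using assms(3)
proof (induction n arbitrary: x)
  case 0
  then show ?case using assms(2) by simp
next
  case (Suc n)
  have "((\<lambda>_. 0) has_vector_derivative 0) (at x)" by simp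
  then have "(nth_vderiv n \<phi> has_vector_derivative 0) (at x)"
    by (rule has_vector_derivative_transform_within_open[OF _ assms(1)]) (use Suc in auto)
  then show ?case by (simp add: nth_vderiv_Suc vector_derivative_at)
qed

lemma smooth_of_real: "smooth of_real"
proof -
  have "derivative_tower (\<lambda>n x. if n = 0 then of_real x else if n = 1 then 1 else 0)"
    by (auto simp: derivative_tower_def intro!: derivative_eq_intros)
  from derivative_tower_smooth[OF this] show ?thesis by simp
qed

lemma smooth_exp: "smooth (\<lambda>x. exp (w * of_real x))"
proof -
  have "derivative_tower (\<lambda>n x. w ^ n * exp (w * of_real x))"
    unfolding derivative_tower_def
  proof (intro allI)
    fix n x
    have "((\<lambda>z. w ^ n * exp (w * z)) has_field_derivative w ^ Suc n * exp (w * of_real x))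
        (at (of_real x))"
      by (auto intro!: derivative_eq_intros)
    from has_vector_derivative_real_field[OF this]
    show "((\<lambda>x. w ^ n * exp (w * of_real x)) has_vector_derivative
        w ^ Suc n * exp (w * of_real x)) (at x)" .
  qed
  from derivative_tower_smooth[OF this] show ?thesis by simp
qed

subsection \<open>A bump function\<close>

definition exp_decay :: "real \<Rightarrow> real" where
  "exp_decay x = (if 0 < x then exp (- 1 / x) else 0)"

definition bump :: "real \<Rightarrow> real" where
  "bump x = exp_decay (1 + x) * exp_decay (1 - x)"

lemma poly_exp_decay_tendsto_0: "((\<lambda>u. poly p u * exp (- u)) \<longlongrightarrow> (0::real)) at_top"
proof -
  have "((\<lambda>u. \<Sum>i\<le>degree p. coeff p i * (u ^ i / exp u)) \<longlongrightarrow> (\<Sum>i\<le>degree p. coeff p i * 0)) at_top"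
    by (intro tendsto_intros tendsto_power_div_exp_0)
  then show ?thesis
    by (simp add: poly_altdef sum_divide_distrib exp_minus field_simps)
qed

lemma smooth_exp_decay: "smooth (\<lambda>x. of_real (exp_decay x))"
proof -
  \<comment> \<open>For \<open>x > 0\<close> the \<open>n\<close>-th derivative is \<open>p\<^sub>n(1/x) exp (-1/x)\<close> for these polynomials.\<close>
  define p :: "nat \<Rightarrow> real poly" where
    "p = rec_nat 1 (\<lambda>_ q. monom 1 2 * (q - pderiv q))"
  have p0: "p 0 = 1" and pSuc: "p (Suc n) = monom 1 2 * (p n - pderiv (p n))" for n
    by (simp_all add: p_def)
  define E where "E n x = (if 0 < x then poly (p n) (1 / x) * exp (- (1 / x)) else 0)" for n x
  have der: "(E n has_real_derivative E (Suc n) x) (at x)" for n x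
  proof -
    consider "x > 0" | "x < 0" | "x = 0" by linarith
    then show ?thesis
    proof cases
      case 1
      have "((\<lambda>x. poly (p n) (1 / x) * exp (- (1 / x))) has_real_derivative E (Suc n) x) (at x)"
        using 1 by (auto intro!: derivative_eq_intros DERIV_chain'[OF _ poly_DERIV, where f="\<lambda>x. 1 / x"]
            simp: E_def pSuc poly_monom power2_eq_square field_simps)
      then show ?thesis
        by (rule has_field_derivative_transform_within_open[OF _ open_greaterThan[of 0]]) (use 1 in \<open>auto simp: E_def\<close>)
    next
      case 2
      have "((\<lambda>x. 0) has_real_derivative E (Suc n) x) (at x)"
        using 2 by (simp add: E_def)
      then show ?thesis
        by (rule has_field_derivative_transform_within_open[OF _ open_lessThan[of 0]]) (use 2 in \<open>auto simp: E_def\<close>)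
    next
      case 3
      have "((\<lambda>h. E n h / h) \<longlongrightarrow> 0) (at_left 0)"
        by (rule tendsto_eventually) (auto simp: E_def eventually_at_filter)
      moreover have "((\<lambda>h. E n h / h) \<longlongrightarrow> 0) (at_right 0)"
      proof -
        have "((\<lambda>h. poly (pCons 0 (p n)) (inverse h) * exp (- inverse h)) \<longlongrightarrow> 0) (at_right 0)"
          by (rule filterlim_compose[OF poly_exp_decay_tendsto_0 filterlim_inverse_at_top_right])
        then show ?thesis
          by (rule Lim_transform_eventually)
            (auto simp: eventually_at_filter E_def field_simps)
      qed
      ultimately have "((\<lambda>h. E n h / h) \<longlongrightarrow> 0) (at 0)"
        by (simp add: filterlim_at_split)
      then show ?thesis
        using 3 by (simp add: has_field_derivative_iff E_def)
    qed
  qed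
  have "derivative_tower (\<lambda>n x. of_real (E n x))"
    unfolding derivative_tower_def
    using has_vector_derivative_of_real[OF der] by blast
  from derivative_tower_smooth[OF this] show ?thesis
    by (simp add: E_def p0 exp_decay_def cong: if_cong)
qed

lemma smooth_bump: "smooth (\<lambda>x. of_real (bump x))"
  using smooth_mult[OF smooth_affine[OF smooth_exp_decay, of 1 1] smooth_affine[OF smooth_exp_decay, of "-1" 1]]
  by (simp add: bump_def add.commute)

lemma bump_nonneg: "0 \<le> bump x"
  by (simp add: bump_def exp_decay_def)

lemma bump_le_1: "bump x \<le> 1"
  by (auto simp: bump_def exp_decay_def intro!: mult_le_one)

lemma bump_pos: "\<bar>x\<bar> < 1 \<Longrightarrow> 0 < bump x"
  by (simp add: bump_def exp_decay_def)

lemma bump_eq_0: "1 \<le> \<bar>x\<bar> \<Longrightarrow> bump x = 0"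
  by (auto simp: bump_def exp_decay_def)

lemma continuous_bump: "continuous_on A bump"
proof -
  have "continuous_on A (\<lambda>x. Re (of_real (bump x)))"
    by (intro continuous_intros smooth_continuous smooth_bump)
  then show ?thesis by simp
qed

section \<open>Test functions and their Fourier transforms\<close>

lemma test_function_smooth: "\<phi> \<in> test_functions \<Longrightarrow> smooth \<phi>"
  by (simp add: test_functions_def)

lemma test_function_vanishes:
  assumes "\<phi> \<in> test_functions"
  obtains r where "r > 0" "\<And>n x. r \<le> \<bar>x\<bar> \<Longrightarrow> nth_vderiv n \<phi> x = 0"
proof -
  from assms obtain r0 where r0: "\<And>x. r0 < \<bar>x\<bar> \<Longrightarrow> \<phi> x = 0" and sm: "smooth \<phi>"
    by (auto simp: test_functions_def)
  define r where "r = max r0 0"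
  have op: "open {x::real. r < \<bar>x\<bar>}"
    by (intro open_Collect_less continuous_intros)
  have *: "nth_vderiv n \<phi> x = 0" if "r < \<bar>x\<bar>" for n x
    by (rule nth_vderiv_eq_0_on_open[OF op]) (use r0 that in \<open>auto simp: r_def\<close>)
  show ?thesis
  proof (rule that[of "r + 1"])
    show "0 < r + 1" by (simp add: r_def)
  qed (auto intro: *)
qed

lemma test_function_mult:
  assumes "\<phi> \<in> test_functions" "smooth \<psi>"
  shows "(\<lambda>x. \<phi> x * \<psi> x) \<in> test_functions" "(\<lambda>x. \<psi> x * \<phi> x) \<in> test_functions"
  using assms smooth_mult[of \<phi> \<psi>] smooth_mult[of \<psi> \<phi>] by (fastforce simp: test_functions_def)+

lemma test_function_nth_vderiv:
  assumes "\<phi> \<in> test_functions"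
  shows "nth_vderiv n \<phi> \<in> test_functions"
proof (induction n)
  case (Suc n)
  obtain r where "r > 0" "\<And>m x. r \<le> \<bar>x\<bar> \<Longrightarrow> nth_vderiv m (nth_vderiv n \<phi>) x = 0"
    using test_function_vanishes[OF Suc] by blast
  then have "r < \<bar>x\<bar> \<Longrightarrow> nth_vderiv 1 (nth_vderiv n \<phi>) x = 0" for x by simp
  moreover have "nth_vderiv 1 (nth_vderiv n \<phi>) = nth_vderiv (Suc n) \<phi>"
    by (simp add: nth_vderiv_def)
  moreover have "smooth (nth_vderiv 1 (nth_vderiv n \<phi>))"
    using Suc by (intro smooth_nth_vderiv) (simp add: test_functions_def)
  ultimately show ?case by (auto simp: test_functions_def)
qed (use assms in simp)

lemma test_function_bump:
  assumes "c \<noteq> 0"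
  shows "(\<lambda>x. of_real (bump (c * x + d))) \<in> test_functions"
proof -
  have "bump (c * x + d) = 0" if "(1 + \<bar>d\<bar>) / \<bar>c\<bar> < \<bar>x\<bar>" for x
  proof -
    have "1 + \<bar>d\<bar> < \<bar>c * x\<bar>"
      using that assms by (simp add: field_simps abs_mult)
    then show ?thesis by (intro bump_eq_0) linarith
  qed
  then show ?thesis
    using smooth_affine[OF smooth_bump, of c d] by (auto simp: test_functions_def)
qed

lemma test_function_bounded:
  assumes "\<phi> \<in> test_functions"
  obtains C where "C \<ge> 0" "\<And>x. norm (\<phi> x) \<le> C"
proof -
  obtain r where r: "r > 0" "\<And>n x. r \<le> \<bar>x\<bar> \<Longrightarrow> nth_vderiv n \<phi> x = 0"
    using test_function_vanishes[OF assms] by blast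
  have "compact (\<phi> ` {-r..r})"
    by (intro compact_continuous_image smooth_continuous test_function_smooth assms) auto
  then obtain C where C: "\<And>x. x \<in> {-r..r} \<Longrightarrow> norm (\<phi> x) \<le> C"
    using compact_imp_bounded by (fastforce simp: bounded_iff)
  have "norm (\<phi> x) \<le> max C 0" for x
    using C[of x] r(2)[of x 0] by (cases "x \<in> {-r..r}") (auto simp: abs_le_iff)
  then show ?thesis by (intro that[of "max C 0"]) auto
qed

lemma test_function_schwartz:
  assumes "\<phi> \<in> test_functions"
  shows "\<phi> \<in> schwartz"
proof -
  have "bounded (range (\<lambda>x. complex_of_real (x ^ k) * nth_vderiv n \<phi> x))" for k n
  proof -
    have "smooth (\<lambda>x. of_real (x ^ k))"
      by (induction k) (auto intro: smooth_mult smooth_of_real)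
    then have "(\<lambda>x. complex_of_real (x ^ k) * nth_vderiv n \<phi> x) \<in> test_functions"
      using test_function_nth_vderiv[OF assms] by (intro test_function_mult)
    then obtain C where "\<And>x. norm (complex_of_real (x ^ k) * nth_vderiv n \<phi> x) \<le> C"
      using test_function_bounded by blast
    then show ?thesis
      unfolding bounded_iff by blast
  qed
  then show ?thesis
    using assms by (simp add: schwartz_def test_function_smooth)
qed

lemma test_function_integral:
  assumes "\<phi> \<in> test_functions" and r: "\<And>x. r \<le> \<bar>x\<bar> \<Longrightarrow> \<phi> x = 0"
  shows "integrable lborel \<phi>" "(\<integral>x. \<phi> x \<partial>lborel) = integral {-r..r} \<phi>"
proof -
  have eq: "indicator {-r..r} x *\<^sub>R \<phi> x = \<phi> x" for x
    using r[of x] by (cases "x \<in> {-r..r}") (auto simp: abs_le_iff)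
  have "integrable lborel (\<lambda>x. indicator {-r..r} x *\<^sub>R \<phi> x)"
    by (intro borel_integrable_compact smooth_continuous test_function_smooth assms) auto
  then show int: "integrable lborel \<phi>"
    unfolding eq by simp
  have "integral UNIV (\<lambda>x. if x \<in> {-r..r} then \<phi> x else 0) = integral {-r..r} \<phi>"
    by (rule integral_restrict_UNIV)
  moreover have "(\<lambda>x. if x \<in> {-r..r} then \<phi> x else 0) = \<phi>"
    using r by (auto simp: fun_eq_iff abs_le_iff)
  ultimately show "(\<integral>x. \<phi> x \<partial>lborel) = integral {-r..r} \<phi>"
    using integral_lborel[OF int] by simp
qed

lemma fourier_alt:
  "fourier \<phi> t = (\<integral>x. \<phi> x * exp (- (2 * of_real pi * \<i> * of_real t) * of_real x) \<partial>lborel)"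
  by (simp add: fourier_def mult_ac)

lemma fourier_test_function:
  assumes "\<phi> \<in> test_functions" and r: "\<And>x. r \<le> \<bar>x\<bar> \<Longrightarrow> \<phi> x = 0"
  shows "fourier \<phi> t = integral {-r..r} (\<lambda>x. \<phi> x * exp (- (2 * of_real pi * \<i> * of_real t) * of_real x))"
  unfolding fourier_alt
  by (rule test_function_integral(2)[OF test_function_mult(1)[OF assms(1) smooth_exp]])
    (use r in auto)

lemma fourier_test_function_bounded:
  assumes "\<phi> \<in> test_functions"
  shows "norm (fourier \<phi> t) \<le> (\<integral>x. norm (\<phi> x) \<partial>lborel)"
proof -
  have "norm (fourier \<phi> t)
      \<le> (\<integral>x. norm (\<phi> x * exp (- (2 * of_real pi * \<i> * of_real x * of_real t))) \<partial>lborel)"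
    unfolding fourier_def by (rule integral_norm_bound)
  then show ?thesis
    by (simp add: norm_mult)
qed

lemma fourier_has_vector_derivative:
  assumes "\<phi> \<in> test_functions"
  shows "(fourier \<phi> has_vector_derivative
    fourier (\<lambda>s. (- (2 * of_real pi * \<i>)) * of_real s * \<phi> s) t) (at t)"
proof -
  obtain r where r: "r > 0" "\<And>n x. r \<le> \<bar>x\<bar> \<Longrightarrow> nth_vderiv n \<phi> x = 0"
    using test_function_vanishes[OF assms] by blast
  let ?w = "- (2 * of_real pi * \<i>) :: complex"
  let ?f = "\<lambda>t x. \<phi> x * exp (?w * of_real t * of_real x)"
  let ?f' = "\<lambda>t x. ?w * of_real x * \<phi> x * exp (?w * of_real t * of_real x)"
  have cont: "continuous_on A \<phi>" for A
    by (intro smooth_continuous test_function_smooth assms)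
  have contx: "continuous_on (UNIV \<times> cbox (-r) r) (\<lambda>x. \<phi> (snd x))"
    by (intro continuous_on_compose2[OF cont[of UNIV]] continuous_intros) auto
  have "((\<lambda>t. integral (cbox (-r) r) (?f t)) has_vector_derivative
      integral (cbox (-r) r) (?f' t)) (at t within UNIV)"
  proof (rule leibniz_rule_vector_derivative)
    fix t x :: real
    have "((\<lambda>z. \<phi> x * exp (?w * z * of_real x)) has_field_derivative ?f' t x) (at (of_real t))"
      by (auto intro!: derivative_eq_intros)
    from has_vector_derivative_real_field[OF this]
    show "((\<lambda>t. ?f t x) has_vector_derivative ?f' t x) (at t within UNIV)" .
  next
    show "?f t integrable_on cbox (-r) r" for t
      by (intro integrable_continuous continuous_intros cont)
    show "continuous_on (UNIV \<times> cbox (-r) r) (\<lambda>(x, t). ?f' x t)"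
      unfolding split_beta by (intro continuous_intros contx)
  qed auto
  moreover have "fourier \<phi> = (\<lambda>t. integral (cbox (-r) r) (?f t))"
    using fourier_test_function[OF assms, of r] r(2)[of _ 0] by (auto simp: fun_eq_iff)
  moreover have "fourier (\<lambda>s. ?w * of_real s * \<phi> s) t = integral (cbox (-r) r) (?f' t)"
    using fourier_test_function[OF test_function_mult(2)[OF assms smooth_mult[OF smooth_const smooth_of_real]],
        of r ?w t] r(2)[of _ 0] by simp
  ultimately show ?thesis by simp
qed

lemma fourier_nth_vderiv_1:
  assumes "\<phi> \<in> test_functions"
  shows "fourier (nth_vderiv 1 \<phi>) t = 2 * of_real pi * \<i> * of_real t * fourier \<phi> t"
proof -
  obtain r where r: "r > 0" "\<And>n x. r \<le> \<bar>x\<bar> \<Longrightarrow> nth_vderiv n \<phi> x = 0"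
    using test_function_vanishes[OF assms] by blast
  note sm = test_function_smooth[OF assms]
  let ?w = "- (2 * of_real pi * \<i> * of_real t) :: complex"
  have ct: "continuous_on A (nth_vderiv n \<phi>)" for A n
    by (intro smooth_nth_vderiv_continuous sm)
  have "((\<lambda>x. \<phi> x * exp (?w * of_real x)) has_vector_derivative
      \<phi> x * (?w * exp (?w * of_real x)) + nth_vderiv 1 \<phi> x * exp (?w * of_real x))
      (at x within {-r..r})" for x
  proof (rule has_vector_derivative_mult)
    show "(\<phi> has_vector_derivative nth_vderiv 1 \<phi> x) (at x within {-r..r})"
      using smooth_has_vector_derivative[OF sm, of 0] by (auto intro: has_vector_derivative_at_within)
    have "((\<lambda>z. exp (?w * z)) has_field_derivative ?w * exp (?w * of_real x)) (at (of_real x))"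
      by (auto intro!: derivative_eq_intros)
    from has_vector_derivative_real_field[OF this]
    show "((\<lambda>x. exp (?w * of_real x)) has_vector_derivative ?w * exp (?w * of_real x))
        (at x within {-r..r})"
      by (rule has_vector_derivative_at_within)
  qed
  from fundamental_theorem_of_calculus[OF _ this] r(1)
  have "((\<lambda>x. \<phi> x * (?w * exp (?w * of_real x)) + nth_vderiv 1 \<phi> x * exp (?w * of_real x))
      has_integral (\<phi> r * exp (?w * of_real r) - \<phi> (-r) * exp (?w * of_real (-r)))) {-r..r}"
    by simp
  then have "integral {-r..r} (\<lambda>x. ?w * (\<phi> x * exp (?w * of_real x)) + nth_vderiv 1 \<phi> x * exp (?w * of_real x)) = 0"
    using r(2)[of r 0] r(2)[of "-r" 0] by (simp add: mult_ac integral_unique)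
  also have "integral {-r..r} (\<lambda>x. ?w * (\<phi> x * exp (?w * of_real x)) + nth_vderiv 1 \<phi> x * exp (?w * of_real x))
      = ?w * integral {-r..r} (\<lambda>x. \<phi> x * exp (?w * of_real x))
        + integral {-r..r} (\<lambda>x. nth_vderiv 1 \<phi> x * exp (?w * of_real x))"
    using ct[of _ 0] ct[of _ 1]
    by (subst integral_add) (auto intro!: integrable_continuous_real continuous_intros)
  also have "\<dots> = ?w * fourier \<phi> t + fourier (nth_vderiv 1 \<phi>) t"
    using r(2)[of _ 0] r(2)[of _ 1]
    by (simp add: fourier_test_function[OF assms, of r]
        fourier_test_function[OF test_function_nth_vderiv[OF assms], of r])
  finally show ?thesis
    by (simp add: add_eq_0_iff)
qed

text \<open>Differentiating the transform multiplies the test function by \<open>-2\<pi>is\<close>, and multiplying the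
  transform by \<open>2\<pi>it\<close> differentiates it. Both stay within the test functions, whose transforms
  are bounded.\<close>

lemma fourier_schwartz:
  assumes "\<phi> \<in> test_functions"
  shows "fourier \<phi> \<in> schwartz"
proof -
  let ?w = "- (2 * of_real pi * \<i>) :: complex"
  define M where "M n = ((\<lambda>\<psi> s. ?w * of_real s * \<psi> s) ^^ n) \<phi>" for n
  have M0: "M 0 = \<phi>" and MS: "M (Suc n) = (\<lambda>s. ?w * of_real s * M n s)" for n
    by (simp_all add: M_def)
  have Mt: "M n \<in> test_functions" for n
  proof (induction n)
    case (Suc n)
    show ?case
      unfolding MS by (intro test_function_mult smooth_mult smooth_of_real smooth_const Suc)
  qed (simp add: M0 assms)
  have tower: "derivative_tower (\<lambda>n. fourier (M n))"
    unfolding derivative_tower_def MS using fourier_has_vector_derivative[OF Mt] by blast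
  have nth: "nth_vderiv n (fourier \<phi>) = fourier (M n)" for n
    using derivative_tower_nth_vderiv[OF tower] by (simp add: M0)
  have "bounded (range (\<lambda>x. complex_of_real (x ^ k) * fourier (M n) x))" for k n
  proof -
    have "fourier (nth_vderiv k (M n)) x = (2 * of_real pi * \<i> * of_real x) ^ k * fourier (M n) x" for x
    proof (induction k)
      case (Suc k)
      have "nth_vderiv (Suc k) (M n) = nth_vderiv 1 (nth_vderiv k (M n))"
        by (simp add: nth_vderiv_def)
      then show ?case
        using fourier_nth_vderiv_1[OF test_function_nth_vderiv[OF Mt], of k n x] Suc
        by simp
    qed simp
    then have "norm (complex_of_real (x ^ k) * fourier (M n) x)
        = norm (fourier (nth_vderiv k (M n)) x) / (2 * pi) ^ k" for x
      by (simp add: norm_mult norm_power power_mult_distrib field_simps)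
    also have "\<dots> x \<le> (\<integral>x. norm (nth_vderiv k (M n) x) \<partial>lborel) / (2 * pi) ^ k" for x
      by (intro divide_right_mono fourier_test_function_bounded test_function_nth_vderiv Mt) auto
    finally show ?thesis
      unfolding bounded_iff by blast
  qed
  then show ?thesis
    using derivative_tower_smooth[OF tower] by (simp add: schwartz_def nth M0)
qed

lemma fourier_continuous:
  assumes "\<phi> \<in> test_functions"
  shows "continuous_on A (fourier \<phi>)"
  using fourier_schwartz[OF assms] by (auto simp: schwartz_def intro: smooth_continuous)

section \<open>Dominated convergence for unordered sums\<close>

lemma has_sum_dominated_convergence:
  fixes f :: "'t \<Rightarrow> 'i \<Rightarrow> 'b::banach"
  assumes sum: "\<And>t. (f t has_sum S t) I"
    and lim: "\<And>i. i \<in> I \<Longrightarrow> ((\<lambda>t. f t i) \<longlongrightarrow> g i) F"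
    and le: "\<And>t i. i \<in> I \<Longrightarrow> norm (f t i) \<le> M i"
    and M: "M summable_on I" and "F \<noteq> bot"
  shows "(S \<longlongrightarrow> infsum g I) F" "g summable_on I"
proof -
  have gle: "norm (g i) \<le> M i" if "i \<in> I" for i
    using le that by (intro tendsto_upperbound[OF tendsto_norm[OF lim[OF that]]] always_eventually allI)
      (auto simp: \<open>F \<noteq> bot\<close>)
  have gn: "(\<lambda>i. norm (g i)) summable_on I"
    by (rule Infinite_Sum.abs_summable_on_comparison_test'[OF M gle])
  then show g: "g summable_on I" by (rule abs_summable_summable)
  show "(S \<longlongrightarrow> infsum g I) F"
  proof (rule tendstoI)
    fix e :: real assume "e > 0"
    then obtain J where J: "finite J" "J \<subseteq> I" "dist (sum M J) (infsum M I) \<le> e / 5"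
      using infsum_finite_approximation[OF M, of "e / 5"] by auto
    have "M summable_on (I - J)" "M summable_on J"
      using M J by (auto intro: summable_on_subset_banach)
    then have "infsum M I = sum M J + infsum M (I - J)"
      using infsum_Un_disjoint[of M J "I - J"] J by (auto simp: Un_absorb1)
    then have tail: "infsum M (I - J) \<le> e / 5"
      using J(3) by (simp add: dist_norm)
    have "((\<lambda>t. \<Sum>i\<in>J. norm (f t i - g i)) \<longlongrightarrow> (\<Sum>i\<in>J. norm (g i - g i))) F"
      using J by (intro tendsto_intros lim) auto
    then have "\<forall>\<^sub>F t in F. (\<Sum>i\<in>J. norm (f t i - g i)) < e / 5"
      using \<open>e > 0\<close> by (intro order_tendstoD) auto
    then show "\<forall>\<^sub>F t in F. dist (S t) (infsum g I) < e"
    proof eventually_elim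
      case (elim t)
      let ?h = "\<lambda>i. f t i - g i"
      have le2: "norm (?h i) \<le> 2 * M i" if "i \<in> I" for i
        using norm_triangle_ineq4[of "f t i" "g i"] le[OF that, of t] gle[OF that] by simp
      have M2: "(\<lambda>i. 2 * M i) summable_on I"
        using M by (rule summable_on_cmult_right)
      have hn: "(\<lambda>i. norm (?h i)) summable_on I"
        by (rule Infinite_Sum.abs_summable_on_comparison_test'[OF M2 le2])
      have hs: "(?h has_sum (S t - infsum g I)) I"
        using has_sum_add[OF sum[of t], of "\<lambda>i. - g i" "- infsum g I"] g
        by (simp add: has_sum_uminus)
      then have "norm (S t - infsum g I) \<le> infsum (\<lambda>i. norm (?h i)) I"
        using norm_infsum_bound[OF hn] by (simp add: infsumI)
      also have "\<dots> = (\<Sum>i\<in>J. norm (?h i)) + infsum (\<lambda>i. norm (?h i)) (I - J)"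
        using infsum_Un_disjoint[of "\<lambda>i. norm (?h i)" J "I - J"] J hn
        by (auto simp: Un_absorb1 intro: summable_on_subset_banach)
      also have "infsum (\<lambda>i. norm (?h i)) (I - J) \<le> infsum (\<lambda>i. 2 * M i) (I - J)"
        using hn M2 le2 by (intro infsum_mono) (auto intro: summable_on_subset_banach)
      also have "\<dots> = 2 * infsum M (I - J)"
        by (rule infsum_cmult_right') 
      finally show ?case
        using tail elim \<open>e > 0\<close> by (simp add: dist_norm)
    qed
  qed
qed

section \<open>Temperate point measures\<close>

lemma is_point_measure_has_sum:
  "is_point_measure u S w \<Longrightarrow> \<phi> \<in> test_functions \<Longrightarrow> ((\<lambda>s. w s * \<phi> s) has_sum u \<phi>) S"
  by (simp add: is_point_measure_def)

lemma schwartz_seminorm_le: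
  assumes "\<And>x. \<bar>x\<bar> ^ k * norm (nth_vderiv n \<phi> x) \<le> C"
  shows "schwartz_seminorm k n \<phi> \<le> C"
  unfolding schwartz_seminorm_def by (rule cSUP_least) (use assms in auto)

lemma schwartz_seminorm_nonneg:
  assumes "\<phi> \<in> schwartz"
  shows "0 \<le> schwartz_seminorm k n \<phi>"
proof -
  have "bdd_above (range (\<lambda>x. \<bar>x\<bar> ^ k * norm (nth_vderiv n \<phi> x)))"
    using assms by (auto simp: schwartz_def bounded_iff norm_mult norm_power bdd_above_def)
  then have "\<bar>0\<bar> ^ k * norm (nth_vderiv n \<phi> 0) \<le> schwartz_seminorm k n \<phi>"
    unfolding schwartz_seminorm_def by (intro cSUP_upper) auto
  moreover have "0 \<le> \<bar>0::real\<bar> ^ k * norm (nth_vderiv n \<phi> 0)" by simp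
  ultimately show ?thesis by linarith
qed

lemma bump_ge: "\<bar>x\<bar> \<le> 1 / 2 \<Longrightarrow> exp (-4) \<le> bump x"
proof -
  assume x: "\<bar>x\<bar> \<le> 1 / 2"
  have "exp (-2) \<le> exp_decay y" if "1 / 2 \<le> y" for y
    using that by (auto simp: exp_decay_def field_simps)
  then have "exp (-2) * exp (-2) \<le> exp_decay (1 + x) * exp_decay (1 - x)"
    using x by (intro mult_mono) (auto simp: exp_decay_def)
  then show ?thesis
    by (simp add: bump_def flip: exp_add)
qed

text \<open>Bounding finite partial sums keeps summability over \<open>S \<inter> {-r..r}\<close> out of the definition.\<close>

definition polynomial_growth :: "real set \<Rightarrow> (real \<Rightarrow> real) \<Rightarrow> real \<Rightarrow> nat \<Rightarrow> bool" where
  "polynomial_growth S w C N \<longleftrightarrow>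
    (\<forall>r\<ge>1. \<forall>F. finite F \<longrightarrow> F \<subseteq> S \<inter> {-r..r} \<longrightarrow> sum w F \<le> C * r ^ N)"

text \<open>
  Testing a positive temperate measure against the dilated bump \<open>bump (x / 2r)\<close>, whose Schwartz
  seminorms grow polynomially in \<open>r\<close>, bounds the mass of \<open>[-r, r]\<close>.
\<close>

lemma temperate_polynomial_growth:
  assumes u: "temperate_distribution u"
    and pm: "is_point_measure u S (\<lambda>s. of_real (w s))"
    and w: "\<And>s. s \<in> S \<Longrightarrow> 0 \<le> w s"
  obtains C N where "C \<ge> 0" "polynomial_growth S w C N"
proof -
  from u obtain C N where CN: "\<And>\<phi>. \<phi> \<in> schwartz \<Longrightarrow>
      norm (u \<phi>) \<le> C * (\<Sum>k\<le>N. \<Sum>n\<le>N. schwartz_seminorm k n \<phi>)"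
    unfolding temperate_distribution_def by blast
  let ?b = "\<lambda>x. complex_of_real (bump x)"
  have bt: "?b \<in> test_functions"
    using test_function_bump[of 1 0] by simp
  have "\<forall>n. \<exists>D\<ge>0. \<forall>x. norm (nth_vderiv n ?b x) \<le> D"
    using test_function_bounded[OF test_function_nth_vderiv[OF bt]] by metis
  then obtain D where D: "\<And>n. D n \<ge> 0" "\<And>n x. norm (nth_vderiv n ?b x) \<le> D n"
    by metis
  define E where "E = \<bar>C\<bar> * (\<Sum>k\<le>N. \<Sum>n\<le>N. 2 ^ N * D n) / exp (-4)"
  have "sum w F \<le> E * r ^ N" if "r \<ge> 1" "finite F" "F \<subseteq> S \<inter> {-r..r}" for r F
  proof -
    let ?c = "\<lambda>x. complex_of_real (bump ((1 / (2 * r)) * x + 0))"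
    have ct: "?c \<in> test_functions"
      using that(1) by (intro test_function_bump) auto
    have sn: "schwartz_seminorm k n ?c \<le> 2 ^ N * D n * r ^ N" if "k \<le> N" for k n
    proof (rule schwartz_seminorm_le)
      fix x
      have nv: "nth_vderiv n ?c x = of_real ((1 / (2 * r)) ^ n) * nth_vderiv n ?b (1 / (2 * r) * x + 0)"
        by (rule nth_vderiv_affine[OF smooth_bump])
      show "\<bar>x\<bar> ^ k * norm (nth_vderiv n ?c x) \<le> 2 ^ N * D n * r ^ N"
      proof (cases "\<bar>x\<bar> \<le> 2 * r")
        case True
        have "\<bar>x\<bar> ^ k * norm (nth_vderiv n ?c x)
            = \<bar>x\<bar> ^ k * ((1 / (2 * r)) ^ n * norm (nth_vderiv n ?b (1 / (2 * r) * x + 0)))"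
          unfolding nv using \<open>r \<ge> 1\<close> by (simp add: norm_mult norm_power norm_divide)
        also have "\<dots> \<le> (2 * r) ^ k * (1 * D n)"
          using True \<open>r \<ge> 1\<close> D by (intro mult_mono power_mono power_le_one) auto
        also have "\<dots> \<le> (2 * r) ^ N * (1 * D n)"
          using that \<open>r \<ge> 1\<close> D by (intro mult_right_mono power_increasing) auto
        finally show ?thesis by (simp add: power_mult_distrib mult_ac)
      next
        case False
        have "open {x::real. 2 * r < \<bar>x\<bar>}"
          by (intro open_Collect_less continuous_intros)
        then have "nth_vderiv n ?c x = 0"
        proof (rule nth_vderiv_eq_0_on_open)
          fix x assume "x \<in> {x. 2 * r < \<bar>x\<bar>}"
          then have "1 \<le> \<bar>1 / (2 * r) * x + 0\<bar>"
            using \<open>r \<ge> 1\<close> by (simp add: abs_mult field_simps)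
          then show "?c x = 0" by (simp add: bump_eq_0)
        qed (use False in simp)
        then show ?thesis using D(1)[of n] \<open>r \<ge> 1\<close> by simp
      qed
    qed
    have hs: "((\<lambda>s. of_real (w s) * ?c s) has_sum u ?c) S"
      by (rule is_point_measure_has_sum[OF pm ct])
    have hs: "((\<lambda>s. w s * bump ((1 / (2 * r)) * s + 0)) has_sum Re (u ?c)) S"
      using has_sum_Re[OF hs] by simp
    have "exp (-4) * sum w F = (\<Sum>s\<in>F. w s * exp (-4))"
      by (simp add: sum_distrib_right mult.commute[of "exp (-4)"])
    also have "\<dots> \<le> (\<Sum>s\<in>F. w s * bump ((1 / (2 * r)) * s + 0))"
    proof (intro sum_mono mult_left_mono bump_ge)
      fix s assume "s \<in> F"
      then have "\<bar>s\<bar> \<le> r" using that(3) by (force simp: abs_le_iff)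
      then show "\<bar>1 / (2 * r) * s + 0\<bar> \<le> 1 / 2"
        using \<open>r \<ge> 1\<close> by (simp add: abs_mult field_simps)
    qed (use that(3) w in auto)
    also have "\<dots> \<le> Re (u ?c)"
      using that w by (intro finite_sum_le_has_sum[OF hs]) (auto simp: bump_nonneg)
    also have "\<dots> \<le> norm (u ?c)" by (rule complex_Re_le_cmod)
    also have "\<dots> \<le> C * (\<Sum>k\<le>N. \<Sum>n\<le>N. schwartz_seminorm k n ?c)"
      by (rule CN[OF test_function_schwartz[OF ct]])
    also have "\<dots> \<le> \<bar>C\<bar> * (\<Sum>k\<le>N. \<Sum>n\<le>N. 2 ^ N * D n * r ^ N)"
      using schwartz_seminorm_nonneg[OF test_function_schwartz[OF ct]]
      by (intro mult_mono sum_mono sn sum_nonneg) auto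
    also have "\<dots> = exp (-4) * (E * r ^ N)"
    proof -
      have "(\<Sum>k\<le>N. \<Sum>n\<le>N. 2 ^ N * D n * r ^ N) = (\<Sum>k\<le>N. \<Sum>n\<le>N. 2 ^ N * D n) * r ^ N"
        by (simp only: sum_distrib_right)
      then show ?thesis by (simp add: E_def del: sum_constant)
    qed
    finally show ?thesis by simp
  qed
  moreover have "E \<ge> 0"
    unfolding E_def using D by (intro divide_nonneg_nonneg mult_nonneg_nonneg sum_nonneg) auto
  ultimately show ?thesis
    by (intro that[of E N]) (auto simp: polynomial_growth_def)
qed

lemma summable_inverse_Suc_square: "summable (\<lambda>k. 1 / real (Suc k) ^ 2)"
  using inverse_power_summable[of 2, where 'a = real] by (subst summable_Suc_iff) (simp add: field_simps)

text \<open>The points are sorted into the unit shells \<open>j \<le> \<bar>s\<bar> < j + 1\<close>.\<close>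

lemma polynomial_growth_summable:
  assumes pg: "polynomial_growth S w C N" and "C \<ge> 0" and w: "\<And>s. s \<in> S \<Longrightarrow> 0 \<le> w s"
  shows "(\<lambda>s. w s / (1 + \<bar>s\<bar>) ^ (N + 2)) summable_on S"
proof (rule nonneg_bdd_above_summable_on)
  show "0 \<le> w s / (1 + \<bar>s\<bar>) ^ (N + 2)" if "s \<in> S" for s
    using w[OF that] by simp
  note sm = summable_inverse_Suc_square
  have "(\<Sum>s\<in>F. w s / (1 + \<bar>s\<bar>) ^ (N + 2)) \<le> C * 2 ^ N * (\<Sum>k. 1 / real (Suc k) ^ 2)"
    if F: "F \<subseteq> S" "finite F" for F
  proof -
    define k where "k s = nat \<lfloor>\<bar>s\<bar>\<rfloor>" for s :: real
    have k: "real (k s) \<le> \<bar>s\<bar>" "\<bar>s\<bar> \<le> real (k s) + 1" for s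
      unfolding k_def by linarith+
    have "(\<Sum>s\<in>F. w s / (1 + \<bar>s\<bar>) ^ (N + 2))
        = (\<Sum>j\<in>k ` F. \<Sum>s\<in>{s \<in> F. k s = j}. w s / (1 + \<bar>s\<bar>) ^ (N + 2))"
      by (rule sum.image_gen[OF F(2)])
    also have "\<dots> \<le> (\<Sum>j\<in>k ` F. C * 2 ^ N * (1 / real (Suc j) ^ 2))"
    proof (rule sum_mono)
      fix j assume "j \<in> k ` F"
      let ?F = "{s \<in> F. k s = j}"
      have "(\<Sum>s\<in>?F. w s / (1 + \<bar>s\<bar>) ^ (N + 2)) \<le> (\<Sum>s\<in>?F. w s / real (Suc j) ^ (N + 2))"
      proof (rule sum_mono)
        fix s assume s: "s \<in> ?F"
        then have "real (Suc j) ^ (N + 2) \<le> (1 + \<bar>s\<bar>) ^ (N + 2)"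
          using k[of s] by (intro power_mono) auto
        then show "w s / (1 + \<bar>s\<bar>) ^ (N + 2) \<le> w s / real (Suc j) ^ (N + 2)"
          using s F w by (intro divide_left_mono) auto
      qed
      also have "\<dots> = sum w ?F / real (Suc j) ^ (N + 2)"
        by (simp add: sum_divide_distrib)
      also have "\<dots> \<le> C * real (Suc j) ^ N / real (Suc j) ^ (N + 2)"
      proof (rule divide_right_mono)
        have "?F \<subseteq> S \<inter> {- real (Suc j)..real (Suc j)}"
        proof
          fix s assume s: "s \<in> ?F"
          then have "\<bar>s\<bar> \<le> real (Suc j)" using k(2)[of s] by simp
          then show "s \<in> S \<inter> {- real (Suc j)..real (Suc j)}"
            using s F by (auto simp: abs_le_iff)
        qed
        then show "sum w ?F \<le> C * real (Suc j) ^ N"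
          using pg F unfolding polynomial_growth_def by auto
      qed auto
      also have "\<dots> = C * 1 * (1 / real (Suc j) ^ 2)"
        by (simp add: power_add power2_eq_square del: of_nat_Suc)
      also have "\<dots> \<le> C * 2 ^ N * (1 / real (Suc j) ^ 2)"
        using \<open>C \<ge> 0\<close> by (intro mult_right_mono mult_left_mono) auto
      finally show "(\<Sum>s\<in>?F. w s / (1 + \<bar>s\<bar>) ^ (N + 2)) \<le> C * 2 ^ N * (1 / real (Suc j) ^ 2)" .
    qed
    also have "\<dots> = C * 2 ^ N * (\<Sum>j\<in>k ` F. 1 / real (Suc j) ^ 2)"
      by (simp add: sum_distrib_left)
    also have "\<dots> \<le> C * 2 ^ N * (\<Sum>k. 1 / real (Suc k) ^ 2)"
      using \<open>C \<ge> 0\<close> F by (intro mult_left_mono sum_le_suminf sm) auto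
    finally show ?thesis .
  qed
  then show "bdd_above (sum (\<lambda>s. w s / (1 + \<bar>s\<bar>) ^ (N + 2)) ` {F. F \<subseteq> S \<and> finite F})"
    unfolding bdd_above_def by blast
qed

lemma schwartz_decay:
  assumes "\<psi> \<in> schwartz"
  obtains C where "C \<ge> 0" "\<And>x. norm (nth_vderiv n \<psi> x) \<le> C / (1 + \<bar>x\<bar>) ^ k"
proof -
  have b: "bounded (range (\<lambda>x. complex_of_real (x ^ j) * nth_vderiv n \<psi> x))" for j
    using assms by (auto simp: schwartz_def)
  obtain A B where A: "\<And>x. norm (nth_vderiv n \<psi> x) \<le> A"
    and B: "\<And>x. \<bar>x\<bar> ^ k * norm (nth_vderiv n \<psi> x) \<le> B"
    using b[of 0] b[of k] by (auto simp: bounded_iff norm_mult norm_power)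
  have AB: "0 \<le> A" "0 \<le> B"
    using A[of 0] B[of 0] norm_ge_zero[of "nth_vderiv n \<psi> 0"]
    by (meson order_trans zero_le_mult_iff zero_le_power abs_ge_zero)+
  have "norm (nth_vderiv n \<psi> x) \<le> (2 ^ k * (A + B)) / (1 + \<bar>x\<bar>) ^ k" for x
  proof -
    have "(1 + \<bar>x\<bar>) ^ k \<le> (2 * max 1 \<bar>x\<bar>) ^ k"
      by (intro power_mono) auto
    also have "\<dots> \<le> 2 ^ k * (1 + \<bar>x\<bar> ^ k)"
      by (cases "\<bar>x\<bar> \<le> 1") (auto simp: power_mult_distrib max_def)
    finally have "(1 + \<bar>x\<bar>) ^ k * norm (nth_vderiv n \<psi> x)
        \<le> 2 ^ k * (1 + \<bar>x\<bar> ^ k) * norm (nth_vderiv n \<psi> x)"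
      by (rule mult_right_mono) auto
    also have "\<dots> = 2 ^ k * (norm (nth_vderiv n \<psi> x) + \<bar>x\<bar> ^ k * norm (nth_vderiv n \<psi> x))"
      by (simp add: algebra_simps)
    also have "\<dots> \<le> 2 ^ k * (A + B)"
      by (intro mult_left_mono add_mono A B) auto
    finally show ?thesis
      by (simp add: field_simps)
  qed
  then show ?thesis using AB by (intro that[of "2 ^ k * (A + B)"]) auto
qed

text \<open>
  The complement of a dilated cut-off is small together with all its derivatives, up to a factor
  \<open>1 + \<bar>x\<bar>\<close>, which the Schwartz decay of another factor absorbs.
\<close>

definition cutoff_compl :: "real \<Rightarrow> real \<Rightarrow> complex" where
  "cutoff_compl R x = 1 + of_real (- 1 / bump 0) * of_real (bump (1 / R * x + 0))"

lemma bump_lipschitz: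
  obtains B where "B \<ge> 0" "\<And>x. norm (complex_of_real (bump x) - of_real (bump 0)) \<le> B * \<bar>x\<bar>"
proof -
  let ?b = "\<lambda>x. complex_of_real (bump x)"
  have bt: "?b \<in> test_functions"
    using test_function_bump[of 1 0] by simp
  obtain B where B: "B \<ge> 0" "\<And>x. norm (nth_vderiv 1 ?b x) \<le> B"
    using test_function_bounded[OF test_function_nth_vderiv[OF bt]] by metis
  have "norm (?b x - ?b 0) \<le> B * norm (x - 0)" for x
  proof (rule differentiable_bound)
    show "(?b has_derivative (\<lambda>h. h *\<^sub>R nth_vderiv 1 ?b y)) (at y within UNIV)" for y
      using smooth_has_vector_derivative[OF smooth_bump, of 0 y] by (simp add: has_vector_derivative_def)
    show "onorm (\<lambda>h. h *\<^sub>R nth_vderiv 1 ?b y) \<le> B" for y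
      using B by (intro onorm_bound) (auto simp: mult.commute[of B] intro: mult_left_mono)
  qed auto
  then show ?thesis using B by (intro that[of B]) auto
qed

lemma smooth_cutoff_compl: "smooth (cutoff_compl R)"
  unfolding cutoff_compl_def
  by (intro smooth_add smooth_const smooth_mult smooth_affine smooth_bump)

lemma cutoff_compl_bound:
  obtains D where "D \<ge> 0"
    "\<And>R x. R \<ge> 1 \<Longrightarrow> norm (nth_vderiv j (cutoff_compl R) x) \<le> D * (1 + \<bar>x\<bar>) / R"
proof -
  let ?b = "\<lambda>x. complex_of_real (bump x)"
  have b0: "bump 0 > 0" by (simp add: bump_pos)
  have bt: "?b \<in> test_functions"
    using test_function_bump[of 1 0] by simp
  show ?thesis
  proof (cases "j = 0")
    case True
    obtain B where B: "B \<ge> 0" "\<And>x. norm (?b x - ?b 0) \<le> B * \<bar>x\<bar>"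
      using bump_lipschitz by blast
    have "norm (nth_vderiv j (cutoff_compl R) x) \<le> B / bump 0 * (1 + \<bar>x\<bar>) / R" if "R \<ge> 1" for R x
    proof -
      have "cutoff_compl R x = of_real (- 1 / bump 0) * (?b (1 / R * x) - ?b 0)"
        using b0 by (simp add: cutoff_compl_def field_simps)
      then have "norm (cutoff_compl R x) = 1 / bump 0 * norm (?b (1 / R * x) - ?b 0)"
        using b0 by (simp add: norm_mult norm_divide)
      also have "\<dots> \<le> 1 / bump 0 * (B * \<bar>1 / R * x\<bar>)"
        using b0 B(2)[of "1 / R * x"] by (intro mult_left_mono) simp_all
      also have "\<dots> = B / bump 0 * \<bar>x\<bar> / R"
        using that by (simp add: abs_mult)
      also have "\<dots> \<le> B / bump 0 * (1 + \<bar>x\<bar>) / R"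
        using that b0 B by (intro divide_right_mono mult_left_mono) auto
      finally show ?thesis using True by simp
    qed
    then show ?thesis using b0 B by (intro that[of "B / bump 0"]) auto
  next
    case False
    obtain B where B: "B \<ge> 0" "\<And>x. norm (nth_vderiv j ?b x) \<le> B"
      using test_function_bounded[OF test_function_nth_vderiv[OF bt]] by metis
    have "norm (nth_vderiv j (cutoff_compl R) x) \<le> B / bump 0 * (1 + \<bar>x\<bar>) / R" if "R \<ge> 1" for R x
    proof -
      have "nth_vderiv j (cutoff_compl R) x
          = of_real (- 1 / bump 0) * (of_real ((1 / R) ^ j) * nth_vderiv j ?b (1 / R * x + 0))"
        unfolding cutoff_compl_def
          nth_vderiv_add[OF smooth_const smooth_mult[OF smooth_const smooth_affine[OF smooth_bump]]]
          nth_vderiv_cmult[OF smooth_affine[OF smooth_bump]] nth_vderiv_affine[OF smooth_bump]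
        using False by (simp add: nth_vderiv_const)
      then have "norm (nth_vderiv j (cutoff_compl R) x)
          = 1 / bump 0 * ((1 / R) ^ j * norm (nth_vderiv j ?b (1 / R * x + 0)))"
        using b0 that by (simp add: norm_mult norm_divide norm_power)
      also have "\<dots> \<le> 1 / bump 0 * ((1 / R) ^ 1 * B)"
        using b0 B that False by (intro mult_left_mono mult_mono power_decreasing) auto
      also have "\<dots> = B / bump 0 * 1 / R"
        by simp
      also have "\<dots> \<le> B / bump 0 * (1 + \<bar>x\<bar>) / R"
        using that b0 B by (intro divide_right_mono mult_left_mono) auto
      finally show ?thesis .
    qed
    then show ?thesis using b0 B by (intro that[of "B / bump 0"]) auto
  qed
qed

lemma schwartz_cutoff_compl:
  assumes "\<psi> \<in> schwartz"
  obtains D where "D \<ge> 0"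
    "\<And>R x. R \<ge> 1 \<Longrightarrow> \<bar>x\<bar> ^ k * norm (nth_vderiv n (\<lambda>x. \<psi> x * cutoff_compl R x) x) \<le> D / R"
proof -
  have sm: "smooth \<psi>" using assms by (simp add: schwartz_def)
  have "\<exists>A\<ge>0. \<forall>x. norm (nth_vderiv i \<psi> x) \<le> A / (1 + \<bar>x\<bar>) ^ (k + 1)" for i
    using schwartz_decay[OF assms, of i "k + 1"] by metis
  then obtain A where A: "\<And>i. A i \<ge> 0" "\<And>i x. norm (nth_vderiv i \<psi> x) \<le> A i / (1 + \<bar>x\<bar>) ^ (k + 1)"
    by metis
  have "\<exists>B\<ge>0. \<forall>R\<ge>1. \<forall>x. norm (nth_vderiv j (cutoff_compl R) x) \<le> B * (1 + \<bar>x\<bar>) / R" for j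
    using cutoff_compl_bound[of j] by metis
  then obtain B where B: "\<And>j. B j \<ge> 0"
    "\<And>j R x. R \<ge> 1 \<Longrightarrow> norm (nth_vderiv j (cutoff_compl R) x) \<le> B j * (1 + \<bar>x\<bar>) / R"
    by metis
  let ?D = "\<Sum>i\<le>n. real (n choose i) * (A i * B (n - i))"
  have "\<bar>x\<bar> ^ k * norm (nth_vderiv n (\<lambda>x. \<psi> x * cutoff_compl R x) x) \<le> ?D / R" if "R \<ge> 1" for R x
  proof -
    have "\<bar>x\<bar> ^ k * norm (nth_vderiv n (\<lambda>x. \<psi> x * cutoff_compl R x) x)
        \<le> (1 + \<bar>x\<bar>) ^ k * (\<Sum>i\<le>n. real (n choose i) *
            (A i / (1 + \<bar>x\<bar>) ^ (k + 1) * (B (n - i) * (1 + \<bar>x\<bar>) / R)))"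
      unfolding nth_vderiv_mult[OF sm smooth_cutoff_compl]
    proof (intro mult_mono power_mono order.trans[OF norm_sum] sum_mono)
      fix i
      show "norm (of_nat (n choose i) * (nth_vderiv i \<psi> x * nth_vderiv (n - i) (cutoff_compl R) x))
          \<le> real (n choose i) * (A i / (1 + \<bar>x\<bar>) ^ (k + 1) * (B (n - i) * (1 + \<bar>x\<bar>) / R))"
        unfolding norm_mult norm_of_nat
        using A B that by (intro mult_left_mono mult_mono) auto
    qed auto
    also have "\<dots> = ?D / R"
      unfolding sum_distrib_left sum_divide_distrib
    proof (intro sum.cong refl)
      fix i
      have *: "p ^ k * (m * (a / p ^ (k + 1) * (b * p / R))) = m * (a * b) / R" if "p > 0" for p m a b :: real
        using that \<open>R \<ge> 1\<close> by (simp add: field_simps)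
      show "(1 + \<bar>x\<bar>) ^ k * (real (n choose i) *
            (A i / (1 + \<bar>x\<bar>) ^ (k + 1) * (B (n - i) * (1 + \<bar>x\<bar>) / R)))
          = real (n choose i) * (A i * B (n - i)) / R"
        by (rule *) simp
    qed
    finally show ?thesis .
  qed
  then show ?thesis
    using A B by (intro that[of ?D]) (auto intro!: sum_nonneg)
qed

text \<open>
  A temperate measure is only prescribed on test functions; cutting off a Schwartz function
  extends its formula, since the mass grows polynomially and the cut-off part tends to zero in
  all seminorms.
\<close>

lemma temperate_point_measure_schwartz:
  assumes u: "temperate_distribution u"
    and pm: "is_point_measure u S (\<lambda>s. of_real (w s))"
    and w: "\<And>s. s \<in> S \<Longrightarrow> 0 \<le> w s"
    and psi: "\<psi> \<in> schwartz"
  shows "((\<lambda>s. of_real (w s) * \<psi> s) has_sum u \<psi>) S"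
proof -
  have sm: "smooth \<psi>" using psi by (simp add: schwartz_def)
  obtain C N where C: "C \<ge> 0" "polynomial_growth S w C N"
    using temperate_polynomial_growth[OF u pm w] by blast
  note summ = polynomial_growth_summable[OF C(2,1) w]
  obtain A where A: "A \<ge> 0" "\<And>x. norm (nth_vderiv 0 \<psi> x) \<le> A / (1 + \<bar>x\<bar>) ^ (N + 2)"
    using schwartz_decay[OF psi] by metis
  define M where "M s = A / bump 0 * (w s / (1 + \<bar>s\<bar>) ^ (N + 2))" for s
  have b0: "bump 0 > 0" "bump 0 \<le> 1" by (simp_all add: bump_pos bump_le_1)
  have M: "M summable_on S"
    unfolding M_def by (intro summable_on_cmult_right summ)
  define R where "R j = real (Suc j)" for j
  have R1: "R j \<ge> 1" "R j \<noteq> 0" for j by (auto simp: R_def)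
  have Rlim: "filterlim R at_top sequentially"
    unfolding R_def by (rule filterlim_compose[OF filterlim_real_sequentially filterlim_Suc])
  let ?chi = "\<lambda>j x. of_real (1 / bump 0) * complex_of_real (bump (1 / R j * x + 0))"
  have chi_t: "?chi j \<in> test_functions" for j
    using R1 by (intro test_function_mult test_function_bump) auto
  have psichi_t: "(\<lambda>x. \<psi> x * ?chi j x) \<in> test_functions" for j
    by (intro test_function_mult chi_t sm)
  have sum: "((\<lambda>s. of_real (w s) * (\<psi> s * ?chi j s)) has_sum u (\<lambda>x. \<psi> x * ?chi j x)) S" for j
    by (rule is_point_measure_has_sum[OF pm psichi_t])
  have chi1: "norm (?chi j s) \<le> 1 / bump 0" for j s
    using b0 bump_le_1[of "1 / R j * s + 0"] bump_nonneg[of "1 / R j * s + 0"]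
    by (simp add: norm_mult norm_divide divide_right_mono)
  have invR: "(\<lambda>j. 1 / R j) \<longlonglongrightarrow> 0"
    using tendsto_inverse_0_at_top[OF Rlim] by (simp add: field_simps)
  have lim: "(\<lambda>j. of_real (w s) * (\<psi> s * ?chi j s)) \<longlonglongrightarrow> of_real (w s) * \<psi> s" for s
  proof -
    have "(\<lambda>j. 1 / R j * s + 0) \<longlonglongrightarrow> 0 * s + 0"
      by (intro tendsto_intros invR)
    then have "(\<lambda>j. bump (1 / R j * s + 0)) \<longlonglongrightarrow> bump 0"
      using isCont_tendsto_compose[OF continuous_on_interior[OF continuous_bump[of UNIV]], of "0"]
      by simp
    then have "(\<lambda>j. of_real (w s) * (\<psi> s * ?chi j s)) \<longlonglongrightarrow>
        of_real (w s) * (\<psi> s * (of_real (1 / bump 0) * of_real (bump 0)))"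
      by (intro tendsto_intros)
    then show ?thesis using b0 by simp
  qed
  have le: "norm (of_real (w s) * (\<psi> s * ?chi j s)) \<le> M s" if "s \<in> S" for j s
  proof -
    have "norm (of_real (w s) * (\<psi> s * ?chi j s)) = w s * (norm (\<psi> s) * norm (?chi j s))"
      using w[OF that] by (simp only: norm_mult norm_of_real abs_of_nonneg)
    also have "\<dots> \<le> w s * (A / (1 + \<bar>s\<bar>) ^ (N + 2) * (1 / bump 0))"
      using A chi1 w[OF that] by (intro mult_left_mono mult_mono) auto
    finally show ?thesis by (simp add: M_def mult_ac)
  qed
  note dom = has_sum_dominated_convergence[where f = "\<lambda>j s. of_real (w s) * (\<psi> s * ?chi j s)"
      and g = "\<lambda>s. of_real (w s) * \<psi> s", OF sum lim le M sequentially_bot]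
  have h_schwartz: "(\<lambda>x. \<psi> x * cutoff_compl (R j) x) \<in> schwartz" for j
  proof -
    have "bounded (range (\<lambda>x. complex_of_real (x ^ k) * nth_vderiv n (\<lambda>x. \<psi> x * cutoff_compl (R j) x) x))" for k n
    proof -
      obtain D where D: "\<And>R x. R \<ge> 1 \<Longrightarrow>
          \<bar>x\<bar> ^ k * norm (nth_vderiv n (\<lambda>x. \<psi> x * cutoff_compl R x) x) \<le> D / R"
        using schwartz_cutoff_compl[OF psi] by metis
      have "norm (complex_of_real (x ^ k) * nth_vderiv n (\<lambda>x. \<psi> x * cutoff_compl (R j) x) x) \<le> D / R j" for x
        using D[OF R1(1)[of j], of x] by (simp add: norm_mult norm_power)
      then show ?thesis unfolding bounded_iff by blast
    qed
    then show ?thesis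
      using smooth_mult[OF sm smooth_cutoff_compl] by (simp add: schwartz_def)
  qed
  have split: "u \<psi> = u (\<lambda>x. \<psi> x * ?chi j x) + u (\<lambda>x. \<psi> x * cutoff_compl (R j) x)" for j
  proof -
    have "\<forall>\<phi>\<in>schwartz. \<forall>\<psi>\<in>schwartz. u (\<lambda>x. \<phi> x + \<psi> x) = u \<phi> + u \<psi>"
      using u unfolding temperate_distribution_def by blast
    from bspec[OF bspec[OF this test_function_schwartz[OF psichi_t[of j]]] h_schwartz[of j]]
    have "u (\<lambda>x. \<psi> x * ?chi j x + \<psi> x * cutoff_compl (R j) x)
        = u (\<lambda>x. \<psi> x * ?chi j x) + u (\<lambda>x. \<psi> x * cutoff_compl (R j) x)" .
    moreover have "(\<lambda>x. \<psi> x * ?chi j x + \<psi> x * cutoff_compl (R j) x) = \<psi>"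
      by (simp add: fun_eq_iff cutoff_compl_def algebra_simps)
    ultimately show ?thesis by simp
  qed
  from u obtain C' N' where CN: "\<And>\<phi>. \<phi> \<in> schwartz \<Longrightarrow>
      norm (u \<phi>) \<le> C' * (\<Sum>k\<le>N'. \<Sum>n\<le>N'. schwartz_seminorm k n \<phi>)"
    unfolding temperate_distribution_def by blast
  have "\<exists>D\<ge>0. \<forall>R\<ge>1. schwartz_seminorm k n (\<lambda>x. \<psi> x * cutoff_compl R x) \<le> D / R" for k n
    using schwartz_cutoff_compl[OF psi, of k n] schwartz_seminorm_le by metis
  then obtain D where D: "\<And>k n. D k n \<ge> 0"
    "\<And>k n R. R \<ge> 1 \<Longrightarrow> schwartz_seminorm k n (\<lambda>x. \<psi> x * cutoff_compl R x) \<le> D k n / R"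
    by metis
  have "(\<lambda>j. u (\<lambda>x. \<psi> x * cutoff_compl (R j) x)) \<longlonglongrightarrow> 0"
  proof (rule Lim_null_comparison)
    show "\<forall>\<^sub>F j in sequentially. norm (u (\<lambda>x. \<psi> x * cutoff_compl (R j) x))
        \<le> \<bar>C'\<bar> * (\<Sum>k\<le>N'. \<Sum>n\<le>N'. D k n) * (1 / R j)"
    proof (intro always_eventually allI)
      fix j
      let ?h = "\<lambda>x. \<psi> x * cutoff_compl (R j) x"
      have "C' * (\<Sum>k\<le>N'. \<Sum>n\<le>N'. schwartz_seminorm k n ?h)
          \<le> \<bar>C'\<bar> * (\<Sum>k\<le>N'. \<Sum>n\<le>N'. D k n / R j)"
        using schwartz_seminorm_nonneg[OF h_schwartz[of j]]
        D R1 by (intro mult_mono sum_mono sum_nonneg) auto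
      then show "norm (u ?h) \<le> \<bar>C'\<bar> * (\<Sum>k\<le>N'. \<Sum>n\<le>N'. D k n) * (1 / R j)"
        using CN[OF h_schwartz[of j]] by (simp flip: sum_divide_distrib)
    qed
    show "(\<lambda>j. \<bar>C'\<bar> * (\<Sum>k\<le>N'. \<Sum>n\<le>N'. D k n) * (1 / R j)) \<longlonglongrightarrow> 0"
      using tendsto_mult[OF tendsto_const invR] by simp
  qed
  then have "(\<lambda>j. u \<psi> - u (\<lambda>x. \<psi> x * cutoff_compl (R j) x)) \<longlonglongrightarrow> u \<psi> - 0"
    by (intro tendsto_intros)
  moreover have "u \<psi> - u (\<lambda>x. \<psi> x * cutoff_compl (R j) x) = u (\<lambda>x. \<psi> x * ?chi j x)" for j
    using split[of j] by (simp only: diff_eq_eq)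
  ultimately have "(\<lambda>j. u (\<lambda>x. \<psi> x * ?chi j x)) \<longlonglongrightarrow> u \<psi>"
    by (simp only: diff_zero)
  with dom have "u \<psi> = infsum (\<lambda>s. of_real (w s) * \<psi> s) S"
    using LIMSEQ_unique by blast
  then show ?thesis
    using dom(2) by (simp add: has_sum_infsum)
qed

section \<open>Sums and integrals\<close>

lemma has_sum_integral:
  fixes f :: "'i \<Rightarrow> 'a \<Rightarrow> complex"
  assumes I: "countable I"
    and int: "\<And>i. i \<in> I \<Longrightarrow> integrable M (f i)"
    and summ: "(\<lambda>i. \<integral>x. norm (f i x) \<partial>M) summable_on I"
    and hs: "\<And>x. x \<in> space M \<Longrightarrow> ((\<lambda>i. f i x) has_sum S x) I"
  shows "((\<lambda>i. \<integral>x. f i x \<partial>M) has_sum (\<integral>x. S x \<partial>M)) I" "integrable M S"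
proof -
  have "((\<lambda>i. \<integral>x. f i x \<partial>M) has_sum (\<integral>x. S x \<partial>M)) I \<and> integrable M S"
  proof (cases "finite I")
    case True
    have S: "S x = (\<Sum>i\<in>I. f i x)" if "x \<in> space M" for x
      using hs[OF that] True by (metis has_sum_finite has_sum_unique)
    have "integrable M S \<longleftrightarrow> integrable M (\<lambda>x. \<Sum>i\<in>I. f i x)"
      by (intro Bochner_Integration.integrable_cong) (auto simp: S)
    moreover have "(\<integral>x. S x \<partial>M) = (\<integral>x. (\<Sum>i\<in>I. f i x) \<partial>M)"
      by (intro Bochner_Integration.integral_cong) (auto simp: S)
    ultimately show ?thesis
      using True int by (auto simp: Bochner_Integration.integral_sum intro!: has_sum_finiteI)
  next
    case False
    define e where "e = from_nat_into I"
    have e: "bij_betw e UNIV I"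
      unfolding e_def using I False by (rule bij_betw_from_nat_into)
    then have eI: "e n \<in> I" for n
      by (auto simp: bij_betw_def)
    have sm: "(\<lambda>n. f (e n) x) sums S x" and absm: "summable (\<lambda>n. norm (f (e n) x))"
      if "x \<in> space M" for x
    proof -
      have 1: "((\<lambda>n. f (e n) x) has_sum S x) UNIV"
        using hs[OF that] has_sum_reindex_bij_betw[OF e, of "\<lambda>i. f i x"] by simp
      then show "(\<lambda>n. f (e n) x) sums S x" by (rule has_sum_imp_sums)
      show "summable (\<lambda>n. norm (f (e n) x))"
        using has_sum_imp_summable[OF 1] summable_on_iff_abs_summable_on_complex
        by (metis summable_on_imp_summable)
    qed
    have isum: "(\<lambda>n. \<integral>x. norm (f (e n) x) \<partial>M) summable_on UNIV"
      using summ summable_on_reindex_bij_betw[OF e, of "\<lambda>i. \<integral>x. norm (f i x) \<partial>M"] by simp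
    then have isum': "summable (\<lambda>n. \<integral>x. norm (f (e n) x) \<partial>M)"
      by (rule summable_on_imp_summable)
    have inte: "integrable M (f (e n))" for n using int eI by blast
    note R = integrable_suminf[OF inte _ isum'] sums_integral[OF inte _ isum']
    have AEs: "AE x in M. summable (\<lambda>n. norm (f (e n) x))"
      using absm by auto
    have Seq: "S x = (\<Sum>n. f (e n) x)" if "x \<in> space M" for x
      using sm[OF that] by (rule sums_unique)
    have iS: "integrable M S"
      using R(1)[OF AEs] Bochner_Integration.integrable_cong[OF refl Seq, of M] by simp
    have sS: "(\<lambda>n. \<integral>x. f (e n) x \<partial>M) sums (\<integral>x. S x \<partial>M)"
      using R(2)[OF AEs] Bochner_Integration.integral_cong[OF refl Seq, of M] by simp
    have "(\<lambda>n. norm (\<integral>x. f (e n) x \<partial>M)) summable_on UNIV"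
      by (rule summable_on_comparison_test[OF isum]) auto
    then have "summable (\<lambda>n. norm (\<integral>x. f (e n) x \<partial>M))"
      by (rule summable_on_imp_summable)
    then have "((\<lambda>n. \<integral>x. f (e n) x \<partial>M) has_sum (\<integral>x. S x \<partial>M)) UNIV"
      using sS by (rule norm_summable_imp_has_sum)
    then show ?thesis
      using iS has_sum_reindex_bij_betw[OF e, of "\<lambda>i. \<integral>x. f i x \<partial>M"] by simp
  qed
  then show "((\<lambda>i. \<integral>x. f i x \<partial>M) has_sum (\<integral>x. S x \<partial>M)) I" "integrable M S" by auto
qed

text \<open>This passes from a measure with multiplicities to an enumeration of its support.\<close>

lemma has_sum_fibres:
  fixes \<psi> :: "'b \<Rightarrow> complex" and a :: "'a \<Rightarrow> 'b"
  assumes hs: "((\<lambda>l. of_nat (c l) * \<psi> l) has_sum S) \<Lambda>"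
    and ran: "range a = \<Lambda>"
    and card: "\<And>l. l \<in> \<Lambda> \<Longrightarrow> card {n. a n = l} = c l"
    and pos: "\<And>l. l \<in> \<Lambda> \<Longrightarrow> c l > 0"
  shows "((\<lambda>n. \<psi> (a n)) has_sum S) UNIV"
proof -
  let ?B = "\<lambda>l. {n. a n = l}"
  have fin: "finite (?B l)" if "l \<in> \<Lambda>" for l
    using card[OF that] pos[OF that] by (metis card.infinite less_irrefl)
  have fs: "((\<lambda>n. g (fst (l, n))) has_sum of_nat (c l) * g l) (?B l)" if "l \<in> \<Lambda>" for l and g :: "'b \<Rightarrow> 'c::real_normed_field"
    using fin[OF that] card[OF that] by (intro has_sum_finiteI) auto
  have "(\<lambda>l. norm (of_nat (c l) * \<psi> l)) summable_on \<Lambda>"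
    using has_sum_imp_summable[OF hs] by (simp only: summable_on_iff_abs_summable_on_complex)
  then have "(\<lambda>l. norm (infsum (\<lambda>n. norm (\<psi> (fst (l, n)))) (?B l))) summable_on \<Lambda>"
    by (rule summable_on_cong[THEN iffD1, rotated])
      (use fin card in \<open>auto simp: norm_mult\<close>)
  then have "(\<lambda>p. norm (\<psi> (fst p))) summable_on Sigma \<Lambda> ?B"
    using fin by (subst Infinite_Sum.abs_summable_on_Sigma_iff) auto
  then have "(\<lambda>p. \<psi> (fst p)) summable_on Sigma \<Lambda> ?B"
    by (rule abs_summable_summable)
  from has_sum_SigmaI[OF fs hs this]
  have "((\<lambda>p. \<psi> (fst p)) has_sum S) (Sigma \<Lambda> ?B)" by simp
  moreover have "bij_betw (\<lambda>n. (a n, n)) UNIV (Sigma \<Lambda> ?B)"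
    by (rule bij_betw_byWitness[where f' = snd]) (use ran in auto)
  ultimately show ?thesis
    using has_sum_reindex_bij_betw[of "\<lambda>n. (a n, n)" UNIV "Sigma \<Lambda> ?B" "\<lambda>p. \<psi> (fst p)" S] by simp
qed

lemma power_exp_bound:
  fixes y :: real
  assumes "y > 0"
  obtains C where "C \<ge> 0" "\<And>t. t \<ge> 0 \<Longrightarrow> t ^ k * exp (- y * t) \<le> C"
proof (cases "k = 0")
  case True
  then show ?thesis using assms by (intro that[of 1]) auto
next
  case False
  have "t ^ k * exp (- y * t) \<le> (k / y) ^ k" if "t \<ge> 0" for t
  proof -
    have "y * t / k \<le> exp (y * t / k)"
      using exp_ge_add_one_self[of "y * t / k"] by linarith
    then have "(y * t / k) ^ k \<le> exp (y * t / k) ^ k"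
      using assms that by (intro power_mono) auto
    also have "\<dots> = exp (y * t)"
      using False by (simp flip: exp_of_nat_mult)
    finally have "(y / k) ^ k * t ^ k \<le> exp (y * t)"
      by (simp flip: power_mult_distrib)
    then show ?thesis
      using assms False by (simp add: exp_minus field_simps power_divide)
  qed
  then show ?thesis using assms by (intro that[of "(k / y) ^ k"]) auto
qed

abbreviation (input) wave :: "real \<Rightarrow> complex \<Rightarrow> complex" where
  "wave g z \<equiv> exp (2 * of_real pi * \<i> * of_real g * z)"

text \<open>The Fourier transform of \<open>s\<^sub>+\<close>, continued to the upper half plane.\<close>

lemma integral_ramp_exp:
  assumes w: "Im w > 0"
  shows "integrable lborel (\<lambda>\<eta>. of_real (max 0 \<eta>) * wave \<eta> w)"
    "(\<integral>\<eta>. of_real (max 0 \<eta>) * wave \<eta> w \<partial>lborel)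
      = - 1 / (4 * of_real pi ^ 2 * w\<^sup>2)"
proof -
  define p where "p = 2 * of_real pi * \<i> * w"
  define q where "q = 2 * pi * Im w"
  have q: "q > 0" and Rep: "Re p = - q" and p0: "p \<noteq> 0"
    using w by (auto simp: p_def q_def)
  define f where "f \<eta> = of_real \<eta> * exp (p * of_real \<eta>)" for \<eta> :: real
  have nf: "norm (f \<eta>) = \<bar>\<eta>\<bar> * exp (- q * \<eta>)" for \<eta>
    by (simp add: f_def norm_mult Rep)
  have lim1: "((\<lambda>x. (x + d) * exp (- q * x)) \<longlongrightarrow> 0) at_top" for d :: real
  proof -
    have top: "filterlim (\<lambda>x. q * x) at_top at_top"
      by (rule filterlim_tendsto_pos_mult_at_top[OF tendsto_const q filterlim_ident])
    have "((\<lambda>x. 1 / q * ((q * x) ^ 1 / exp (q * x)) + d * ((q * x) ^ 0 / exp (q * x))) \<longlongrightarrow>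
        1 / q * 0 + d * 0) at_top"
      by (intro tendsto_intros filterlim_compose[OF tendsto_power_div_exp_0 top])
    then show ?thesis
      using q by (simp add: exp_minus divide_simps distrib_right)
  qed
  have real_int: "set_integrable lborel (einterval 0 \<infinity>) (\<lambda>x. x * exp (- q * x))"
  proof (rule interval_integral_FTC_nonneg(1))
    show "((\<lambda>x. - ((x + 1 / q) * exp (- q * x)) / q) has_real_derivative x * exp (- q * x)) (at x)" for x
      using q by (auto intro!: derivative_eq_intros simp: field_simps)
    show "(((\<lambda>x. - ((x + 1 / q) * exp (- q * x)) / q) \<circ> real_of_ereal) \<longlongrightarrow> - ((0 + 1 / q) * exp (- q * 0)) / q) (at_right 0)"
      unfolding zero_ereal_def ereal_tendsto_simps
      by (intro tendsto_intros) (use q in auto)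
    show "(((\<lambda>x. - ((x + 1 / q) * exp (- q * x)) / q) \<circ> real_of_ereal) \<longlongrightarrow> - 0 / q) (at_left \<infinity>)"
      unfolding ereal_tendsto_simps
      using tendsto_divide[OF tendsto_minus[OF lim1[of "1 / q"]] tendsto_const, of q] q by simp
  qed (auto intro!: always_eventually continuous_intros)
  have set_int: "set_integrable lborel (einterval 0 \<infinity>) f"
  proof (rule set_integrable_bound[OF real_int])
    show "set_borel_measurable lborel (einterval 0 \<infinity>) f"
      unfolding set_borel_measurable_def f_def by measurable
    show "AE x in lborel. x \<in> einterval 0 \<infinity> \<longrightarrow> norm (f x) \<le> norm (x * exp (- q * x))"
      by (auto simp: nf einterval_def abs_mult)
  qed
  have FTC: "(LBINT x=0..\<infinity>. f x) = 0 - (of_real 0 / p - 1 / p ^ 2) * exp (p * of_real 0)"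
  proof (rule interval_integral_FTC_integrable)
    let ?F = "\<lambda>z. (z / p - 1 / p ^ 2) * exp (p * z)"
    show "((\<lambda>x. (of_real x / p - 1 / p ^ 2) * exp (p * of_real x)) has_vector_derivative f x) (at x)" for x
    proof -
      have "(?F has_field_derivative f x) (at (of_real x))"
        using p0 by (auto intro!: derivative_eq_intros simp: f_def field_simps power2_eq_square)
      from has_vector_derivative_real_field[OF this] show ?thesis .
    qed
    show "isCont f x" for x
      unfolding f_def by (intro continuous_intros)
    show "(((\<lambda>x. (of_real x / p - 1 / p ^ 2) * exp (p * of_real x)) \<circ> real_of_ereal) \<longlongrightarrow>
        (of_real 0 / p - 1 / p ^ 2) * exp (p * of_real 0)) (at_right 0)"
      unfolding zero_ereal_def ereal_tendsto_simps
      by (intro tendsto_intros) (use p0 in auto)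
    have "((\<lambda>x. (of_real x / p - 1 / p ^ 2) * exp (p * of_real x)) \<longlongrightarrow> 0) at_top"
    proof (rule Lim_null_comparison)
      show "\<forall>\<^sub>F x in at_top. norm ((of_real x / p - 1 / p ^ 2) * exp (p * of_real x))
          \<le> (x + 1 / norm p) * exp (- q * x) / norm p"
        using eventually_ge_at_top[of 0]
      proof eventually_elim
        case (elim x)
        have "norm (of_real x / p - 1 / p ^ 2) \<le> norm (of_real x / p) + norm (1 / p ^ 2)"
          by (rule norm_triangle_ineq4)
        also have "\<dots> = (x + 1 / norm p) / norm p"
          using elim p0 by (simp add: norm_divide norm_mult power2_eq_square field_simps)
        finally have "norm (of_real x / p - 1 / p ^ 2) * exp (- q * x) \<le> (x + 1 / norm p) / norm p * exp (- q * x)"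
          by (rule mult_right_mono) auto
        then show ?case by (simp add: norm_mult Rep)
      qed
      show "((\<lambda>x. (x + 1 / norm p) * exp (- q * x) / norm p) \<longlongrightarrow> 0) at_top"
        using tendsto_divide[OF lim1[of "1 / norm p"] tendsto_const, of "norm p"] p0 by simp
    qed
    then show "(((\<lambda>x. (of_real x / p - 1 / p ^ 2) * exp (p * of_real x)) \<circ> real_of_ereal) \<longlongrightarrow> 0) (at_left \<infinity>)"
      unfolding ereal_tendsto_simps .
    show "set_integrable lborel (einterval 0 \<infinity>) f" by (rule set_int)
  qed auto
  have eq: "(\<lambda>\<eta>. of_real (max 0 \<eta>) * wave \<eta> w)
      = (\<lambda>\<eta>. indicator (einterval 0 \<infinity>) \<eta> *\<^sub>R f \<eta>)"
    by (auto simp: fun_eq_iff indicator_def einterval_def f_def p_def max_def mult_ac)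
  show "integrable lborel (\<lambda>\<eta>. of_real (max 0 \<eta>) * wave \<eta> w)"
    using set_int unfolding eq set_integrable_def .
  have "(LBINT x=0..\<infinity>. f x) = (\<integral>x. indicator (einterval 0 \<infinity>) x *\<^sub>R f x \<partial>lborel)"
    unfolding interval_lebesgue_integral_def set_lebesgue_integral_def by simp
  then show "(\<integral>\<eta>. of_real (max 0 \<eta>) * wave \<eta> w \<partial>lborel)
      = - 1 / (4 * of_real pi ^ 2 * w\<^sup>2)"
    unfolding eq using FTC by (simp add: p_def power_mult_distrib)
qed

section \<open>The transform of the bump\<close>

definition bump_hat :: "real \<Rightarrow> complex" where
  "bump_hat = fourier (\<lambda>s. of_real (bump s))"

lemma bump_test: "(\<lambda>s. complex_of_real (bump s)) \<in> test_functions"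
  using test_function_bump[of 1 0] by simp

lemma integrable_bump: "integrable lborel bump"
proof -
  have "integrable lborel (\<lambda>s. complex_of_real (bump s))"
    by (rule test_function_integral(1)[OF bump_test, of 1]) (simp add: bump_eq_0)
  from integrable_Re[OF this] show ?thesis by simp
qed

lemma bump_borel [measurable]: "bump \<in> borel_measurable borel"
  by (intro borel_measurable_continuous_onI continuous_bump)

lemma integral_bump_pos: "(\<integral>s. bump s \<partial>lborel) > 0"
proof -
  have "(\<integral>s. indicator {-1/2..1/2::real} s *\<^sub>R exp (-4) \<partial>lborel) \<le> (\<integral>s. bump s \<partial>lborel)"
  proof (intro integral_mono integrable_bump)
    show "integrable lborel (\<lambda>s. indicator {-1/2..1/2::real} s *\<^sub>R exp (-4 :: real))"
      by (rule borel_integrable_compact) auto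
  qed (auto simp: indicator_def bump_nonneg intro!: bump_ge)
  moreover have "(\<integral>s. indicator {-1/2..1/2::real} s *\<^sub>R exp (-4) \<partial>lborel) = exp (-4 :: real)"
    by simp
  ultimately show ?thesis by (smt (verit) exp_gt_zero)
qed

lemma bump_hat_0: "bump_hat 0 = of_real (\<integral>s. bump s \<partial>lborel)"
  by (simp add: bump_hat_def fourier_def)

lemma norm_bump_hat_le: "norm (bump_hat t) \<le> (\<integral>s. bump s \<partial>lborel)"
  using fourier_test_function_bounded[OF bump_test, of t] by (simp add: bump_hat_def bump_nonneg)

lemma bump_hat_continuous: "continuous_on A bump_hat"
  unfolding bump_hat_def by (rule fourier_continuous[OF bump_test])

text \<open>The bump is real valued.\<close>

lemma bump_hat_uminus: "bump_hat (- t) = cnj (bump_hat t)"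
proof -
  have "bump_hat (- t) = (\<integral>x. cnj (of_real (bump x) *
      exp (- (2 * of_real pi * \<i> * of_real x * of_real t))) \<partial>lborel)"
    unfolding bump_hat_def fourier_def by (simp add: exp_cnj)
  then show ?thesis
    by (simp only: Bochner_Integration.integral_cnj bump_hat_def fourier_def)
qed

text \<open>
  These translates, dilates and modulations of the bump are the only test functions to which
  the summation formula will be applied.
\<close>

definition bump_atom :: "real \<Rightarrow> real \<Rightarrow> real \<Rightarrow> real \<Rightarrow> complex" where
  "bump_atom R \<eta> x s = of_real (bump (R * (s - \<eta>))) * exp (2 * of_real pi * \<i> * of_real (x * (s - \<eta>)))"

lemma bump_atom_test:
  assumes "R > 0"
  shows "bump_atom R \<eta> x \<in> test_functions"
proof -
  have "smooth (\<lambda>s. exp (2 * of_real pi * \<i> * of_real x * of_real s))"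
    by (rule smooth_exp)
  from smooth_affine[OF this, of 1 "- \<eta>"]
  have "(\<lambda>s. of_real (bump (R * s + (- R * \<eta>))) * exp (2 * of_real pi * \<i> * of_real x * of_real (1 * s + (- \<eta>)))) \<in> test_functions"
    using assms by (intro test_function_mult(1) test_function_bump) auto
  also have "(\<lambda>s. of_real (bump (R * s + (- R * \<eta>))) * exp (2 * of_real pi * \<i> * of_real x * of_real (1 * s + (- \<eta>)))) = bump_atom R \<eta> x"
    by (simp add: bump_atom_def fun_eq_iff algebra_simps)
  finally show ?thesis .
qed

lemma fourier_bump_atom:
  assumes R: "R > 0"
  shows "fourier (bump_atom R \<eta> x) t
    = exp (- (2 * of_real pi * \<i> * of_real \<eta> * of_real t)) * bump_hat ((t - x) / R) / of_real R"
proof -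
  have "fourier (bump_atom R \<eta> x) t = \<bar>1 / R\<bar> *\<^sub>R (\<integral>u. bump_atom R \<eta> x (\<eta> + 1 / R * u) *
      exp (- (2 * of_real pi * \<i> * of_real (\<eta> + 1 / R * u) * of_real t)) \<partial>lborel)"
    unfolding fourier_def by (rule lborel_integral_real_affine) (use R in auto)
  also have "(\<lambda>u. bump_atom R \<eta> x (\<eta> + 1 / R * u) *
        exp (- (2 * of_real pi * \<i> * of_real (\<eta> + 1 / R * u) * of_real t)))
      = (\<lambda>u. exp (- (2 * of_real pi * \<i> * of_real \<eta> * of_real t)) *
          (of_real (bump u) * exp (- (2 * of_real pi * \<i> * of_real u * of_real ((t - x) / R)))))"
    using R by (simp add: fun_eq_iff bump_atom_def field_simps flip: exp_add exp_diff)
  finally show ?thesis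
    using R by (simp add: bump_hat_def fourier_def scaleR_conv_of_real)
qed

section \<open>The summation formula\<close>

text \<open>
  The enumeration \<open>a\<close> lists every point of the support of \<open>\<mu>\<close> as often as its mass, so that sums
  against \<open>\<mu>\<close> become sums over the integers. The temperate \<open>\<nu>\<close> makes
  \<open>\<Sum> \<bar>b\<^sub>g\<bar>\<close> over \<open>[-r, r]\<close> grow polynomially in \<open>r\<close>.
\<close>

locale pure_point_transform =
  fixes \<Lambda> \<Gamma> :: "real set" and c :: "real \<Rightarrow> nat" and b :: "real \<Rightarrow> complex"
    and \<mu> \<nu> :: "(real \<Rightarrow> complex) \<Rightarrow> complex" and a :: "int \<Rightarrow> real"
  assumes c_pos: "\<And>l. l \<in> \<Lambda> \<Longrightarrow> c l > 0"
    and mu_temperate: "temperate_distribution \<mu>"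
    and mu_points: "is_point_measure \<mu> \<Lambda> (\<lambda>l. of_nat (c l))"
    and countable_spectrum: "countable \<Gamma>"
    and mu_hat_points: "is_point_measure (fourier_distribution \<mu>) \<Gamma> b"
    and nu_temperate: "temperate_distribution \<nu>"
    and nu_points: "is_point_measure \<nu> \<Gamma> (\<lambda>g. of_real (norm (b g)))"
    and range_a: "range a = \<Lambda>"
    and card_a: "\<And>l. l \<in> \<Lambda> \<Longrightarrow> card {n. a n = l} = c l"
begin

text \<open>The side of the spectrum is the hypothesis on the transform; on the side of the points the
  transform of a test function is only a Schwartz function, so the extension of the point measure
  beyond test functions is needed.\<close>

lemma summation_formula:
  assumes "\<phi> \<in> test_functions"
  obtains S where "((\<lambda>n. fourier \<phi> (a n)) has_sum S) UNIV" "((\<lambda>g. b g * \<phi> g) has_sum S) \<Gamma>"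
proof
  show "((\<lambda>g. b g * \<phi> g) has_sum \<mu> (fourier \<phi>)) \<Gamma>"
    using is_point_measure_has_sum[OF mu_hat_points assms] by (simp add: fourier_distribution_def)
  have "((\<lambda>l. of_real (real (c l)) * fourier \<phi> l) has_sum \<mu> (fourier \<phi>)) \<Lambda>"
    using mu_points
    by (intro temperate_point_measure_schwartz mu_temperate fourier_schwartz assms) auto
  then have "((\<lambda>l. of_nat (c l) * fourier \<phi> l) has_sum \<mu> (fourier \<phi>)) \<Lambda>" by simp
  then show "((\<lambda>n. fourier \<phi> (a n)) has_sum \<mu> (fourier \<phi>)) UNIV"
    by (rule has_sum_fibres[OF _ range_a card_a c_pos])
qed

lemma summation_formula_bump:
  assumes R: "R > 0"
  obtains S where
    "\<forall>\<eta>. ((\<lambda>n. exp (- (2 * of_real pi * \<i> * of_real \<eta> * of_real (a n))) * bump_hat ((a n - x) / R)) has_sum S \<eta>) UNIV"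
    "\<forall>\<eta>. ((\<lambda>g. b g * (of_real R * bump_atom R \<eta> x g)) has_sum S \<eta>) \<Gamma>"
proof -
  have ex: "\<exists>S. ((\<lambda>n. exp (- (2 * of_real pi * \<i> * of_real \<eta> * of_real (a n))) * bump_hat ((a n - x) / R)) has_sum S) UNIV
      \<and> ((\<lambda>g. b g * (of_real R * bump_atom R \<eta> x g)) has_sum S) \<Gamma>" for \<eta>
  proof -
    obtain S where S: "((\<lambda>n. fourier (bump_atom R \<eta> x) (a n)) has_sum S) UNIV"
      "((\<lambda>g. b g * bump_atom R \<eta> x g) has_sum S) \<Gamma>"
      using summation_formula[OF bump_atom_test[OF R]] by blast
    show ?thesis
      using has_sum_cmult_right[OF S(1), of "of_real R"] has_sum_cmult_right[OF S(2), of "of_real R"] R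
      by (intro exI[of _ "of_real R * S"]) (simp add: fourier_bump_atom mult_ac)
  qed
  from choice[OF allI[OF ex]] obtain S where
    "\<forall>\<eta>. ((\<lambda>n. exp (- (2 * of_real pi * \<i> * of_real \<eta> * of_real (a n))) * bump_hat ((a n - x) / R)) has_sum S \<eta>) UNIV
      \<and> ((\<lambda>g. b g * (of_real R * bump_atom R \<eta> x g)) has_sum S \<eta>) \<Gamma>" ..
  then show ?thesis by (intro that[of S]) simp_all
qed

subsection \<open>Bounded density\<close>

text \<open>
  Averaging the formula over \<open>\<eta>\<close> against the bump turns the transform of the bump into its squared modulus,
  while the spectral side only sees \<open>b\<close> on \<open>[-2, 2]\<close>. A positive kernel bounds the
  number of points near any \<open>x\<close>.
\<close>

lemma kernel_square_sum_bounded: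
  obtains B where "\<forall>x F. finite F \<longrightarrow> (\<Sum>n\<in>F. norm (bump_hat (a n - x)) ^ 2) \<le> B"
proof -
  define \<Gamma>2 where "\<Gamma>2 = \<Gamma> \<inter> {-2..2}"
  define B where "B = (\<Sum>\<^sub>\<infinity>g\<in>\<Gamma>2. norm (b g))"
  have bs: "(\<lambda>g. norm (b g)) summable_on \<Gamma>2"
    using mu_hat_points by (simp add: is_point_measure_def \<Gamma>2_def)
  have "(\<Sum>n\<in>F. norm (bump_hat (a n - x)) ^ 2) \<le> (\<integral>s. bump s \<partial>lborel) * B"
    if "finite F" for x and F :: "int set"
  proof -
    obtain S where
      S1: "\<forall>\<eta>. ((\<lambda>n. exp (- (2 * of_real pi * \<i> * of_real \<eta> * of_real (a n))) * bump_hat ((a n - x) / 1)) has_sum S \<eta>) UNIV"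
      and S2: "\<forall>\<eta>. ((\<lambda>g. b g * (of_real 1 * bump_atom 1 \<eta> x g)) has_sum S \<eta>) \<Gamma>"
      by (rule summation_formula_bump[OF zero_less_one, of x])
    let ?w = "\<lambda>\<eta>. of_real (bump \<eta>) * exp (- (2 * of_real pi * \<i> * of_real x * of_real \<eta>))"
    let ?f = "\<lambda>n \<eta>. ?w \<eta> * (exp (- (2 * of_real pi * \<i> * of_real (- \<eta>) * of_real (a n))) * bump_hat ((a n - x) / 1))"
    have f_alt: "?f n \<eta> = bump_hat (a n - x) * (of_real (bump \<eta>) * exp (- (2 * of_real pi * \<i> * of_real \<eta> * of_real (x - a n))))"
      for n \<eta>
      by (simp add: algebra_simps flip: exp_add)
    have ib: "integrable lborel (\<lambda>\<eta>. of_real (bump \<eta>) * exp (- (2 * of_real pi * \<i> * of_real \<eta> * of_real t)))" for t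
    proof (rule Bochner_Integration.integrable_bound[OF integrable_bump])
      show "AE \<eta> in lborel. norm (of_real (bump \<eta>) * exp (- (2 * of_real pi * \<i> * of_real \<eta> * of_real t))) \<le> norm (bump \<eta>)"
        by (simp add: norm_mult)
    qed measurable
    have "(\<lambda>n. exp (- (2 * of_real pi * \<i> * of_real 0 * of_real (a n))) * bump_hat ((a n - x) / 1)) summable_on UNIV"
      using S1[rule_format, of 0] by (rule has_sum_imp_summable)
    then have ks: "(\<lambda>n. norm (bump_hat (a n - x))) summable_on UNIV"
      by (simp add: summable_on_iff_abs_summable_on_complex)
    have int_f: "integrable lborel (?f n)" for n
      unfolding f_alt by (intro integrable_mult_right ib)
    have "(\<integral>\<eta>. norm (?f n \<eta>) \<partial>lborel) = (\<integral>s. bump s \<partial>lborel) * norm (bump_hat (a n - x))" for n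
      unfolding f_alt by (simp add: norm_mult bump_nonneg mult.commute)
    then have sum_f: "(\<lambda>n. \<integral>\<eta>. norm (?f n \<eta>) \<partial>lborel) summable_on UNIV"
      using ks by (simp add: summable_on_cmult_right)
    have hs_f: "((\<lambda>n. ?f n \<eta>) has_sum ?w \<eta> * S (- \<eta>)) UNIV" for \<eta>
      by (rule has_sum_cmult_right[OF S1[rule_format]])
    note * = has_sum_integral[of "UNIV :: int set", OF _ int_f sum_f hs_f]
    have f_eq: "(\<integral>\<eta>. ?f n \<eta> \<partial>lborel) = of_real (norm (bump_hat (a n - x)) ^ 2)" for n
    proof -
      have "(\<integral>\<eta>. ?f n \<eta> \<partial>lborel) = bump_hat (a n - x) * bump_hat (- (a n - x))"
        unfolding f_alt by (simp add: bump_hat_def fourier_def)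
      then show ?thesis
        unfolding bump_hat_uminus complex_norm_square by simp
    qed
    have hs: "((\<lambda>n. norm (bump_hat (a n - x)) ^ 2) has_sum Re (\<integral>\<eta>. ?w \<eta> * S (- \<eta>) \<partial>lborel)) UNIV"
      using has_sum_Re[OF *(1)[OF countableI_type]] unfolding f_eq Re_complex_of_real .
    have S_le: "norm (?w \<eta> * S (- \<eta>)) \<le> bump \<eta> * B" for \<eta>
    proof (cases "\<bar>\<eta>\<bar> < 1")
      case True
      have n0: "bump_atom 1 (- \<eta>) x g = 0" if "g \<in> \<Gamma> - \<Gamma>2" for g
        using that True by (auto simp: bump_atom_def \<Gamma>2_def intro!: bump_eq_0)
      have "((\<lambda>g. b g * (of_real 1 * bump_atom 1 (- \<eta>) x g)) has_sum S (- \<eta>)) \<Gamma>2"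
        by (rule has_sum_cong_neutral[THEN iffD1, OF _ _ _ S2[rule_format, of "- \<eta>"]])
          (auto simp: n0 \<Gamma>2_def)
      then have "norm (S (- \<eta>)) \<le> B"
      proof (rule norm_infsum_le)
        show "((\<lambda>g. norm (b g)) has_sum B) \<Gamma>2"
          using bs by (simp add: B_def)
        show "norm (b g * (of_real 1 * bump_atom 1 (- \<eta>) x g)) \<le> norm (b g)" for g
        proof -
          have "norm (bump_atom 1 (- \<eta>) x g) \<le> 1"
            using bump_le_1 by (simp add: bump_atom_def norm_mult bump_nonneg)
          then show ?thesis by (simp add: norm_mult mult_left_le)
        qed
      qed
      then show ?thesis
        by (simp add: norm_mult bump_nonneg mult_left_mono)
    qed (simp add: bump_eq_0)
    have "(\<Sum>n\<in>F. norm (bump_hat (a n - x)) ^ 2) \<le> Re (\<integral>\<eta>. ?w \<eta> * S (- \<eta>) \<partial>lborel)"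
      by (rule finite_sum_le_has_sum[OF hs]) (use that in auto)
    also have "\<dots> \<le> norm (\<integral>\<eta>. ?w \<eta> * S (- \<eta>) \<partial>lborel)"
      by (rule complex_Re_le_cmod)
    also have "\<dots> \<le> (\<integral>\<eta>. norm (?w \<eta> * S (- \<eta>)) \<partial>lborel)"
      by (rule integral_norm_bound)
    also have "\<dots> \<le> (\<integral>\<eta>. bump \<eta> * B \<partial>lborel)"
      by (rule integral_mono[OF integrable_norm[OF *(2)[OF countableI_type]]
            integrable_mult_left[OF integrable_bump] S_le])
    finally show ?thesis by simp
  qed
  then show ?thesis by (intro that allI impI)
qed

text \<open>The transform of the bump stays away from \<open>0\<close> on some \<open>[-d, d]\<close>, so the preceding
  bound limits the number of points in every interval of length \<open>2d\<close>. Sorting the points by their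
  distance to \<open>x\<close> in units of \<open>d\<close> compares the sum with \<open>\<Sum> 1 / (j + 1)\<^sup>2\<close>.\<close>

lemma cauchy_kernel_sum_bounded:
  obtains B where "B \<ge> 0" "\<forall>x F. finite F \<longrightarrow> (\<Sum>n\<in>F. 1 / (1 + (x - a n)\<^sup>2)) \<le> B"
proof -
  obtain B where B: "\<forall>x F. finite F \<longrightarrow> (\<Sum>n\<in>F. norm (bump_hat (a n - x)) ^ 2) \<le> B"
    by (rule kernel_square_sum_bounded)
  have "isCont (\<lambda>t. norm (bump_hat t)) 0"
    using bump_hat_continuous[of UNIV] by (intro continuous_intros) (simp add: continuous_on_eq_continuous_at)
  moreover define \<kappa> where "\<kappa> = norm (bump_hat 0) / 2"
  have k0: "\<kappa> > 0" "\<kappa> < norm (bump_hat 0)"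
    using integral_bump_pos by (simp_all add: \<kappa>_def bump_hat_0)
  ultimately have "\<forall>\<^sub>F t in at 0. \<kappa> < norm (bump_hat t)"
    by (auto simp: isCont_def intro: order_tendstoD)
  then obtain d0 where d0: "d0 > 0" "\<And>t. t \<noteq> 0 \<Longrightarrow> \<bar>t\<bar> < d0 \<Longrightarrow> \<kappa> < norm (bump_hat t)"
    by (auto simp: eventually_at dist_norm)
  define d where "d = min 1 (d0 / 2)"
  have d: "d > 0" "d \<le> 1" and kd: "\<kappa> \<le> norm (bump_hat t)" if "\<bar>t\<bar> \<le> d" for t
    using d0(1) d0(2)[of t] k0(2) that by (cases "t = 0"; force simp: d_def)+
  have d: "d > 0" "d \<le> 1" using d0(1) by (auto simp: d_def)
  have cnt: "real (card G) \<le> B / \<kappa>\<^sup>2" if "finite G" "\<And>n. n \<in> G \<Longrightarrow> \<bar>a n - x\<bar> \<le> d" for G x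
  proof -
    have "real (card G) * \<kappa>\<^sup>2 = (\<Sum>n\<in>G. \<kappa>\<^sup>2)" by simp
    also have "\<dots> \<le> (\<Sum>n\<in>G. norm (bump_hat (a n - x)) ^ 2)"
      using k0(1) kd that(2) by (intro sum_mono power_mono) auto
    also have "\<dots> \<le> B" using B that(1) by blast
    finally show ?thesis using k0 by (simp add: field_simps)
  qed
  have B0: "B / \<kappa>\<^sup>2 \<ge> 0" using cnt[of "{}"] by simp
  note sm = summable_inverse_Suc_square
  define C where "C = 2 * (B / \<kappa>\<^sup>2) * (2 / d\<^sup>2)"
  have "(\<Sum>n\<in>F. 1 / (1 + (x - a n)\<^sup>2)) \<le> C * (\<Sum>k. 1 / real (Suc k) ^ 2)"
    if F: "finite F" for x F
  proof -
    define k where "k n = nat \<lfloor>\<bar>a n - x\<bar> / d\<rfloor>" for n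
    have k: "real (k n) * d \<le> \<bar>a n - x\<bar>" "\<bar>a n - x\<bar> \<le> (real (k n) + 1) * d" for n
    proof -
      have "real (k n) \<le> \<bar>a n - x\<bar> / d" "\<bar>a n - x\<bar> / d \<le> real (k n) + 1"
        using d unfolding k_def by (auto simp: of_nat_nat)
      then show "real (k n) * d \<le> \<bar>a n - x\<bar>" "\<bar>a n - x\<bar> \<le> (real (k n) + 1) * d"
        using d by (simp_all add: field_simps)
    qed
    have "(\<Sum>n\<in>F. 1 / (1 + (x - a n)\<^sup>2)) = (\<Sum>j\<in>k ` F. \<Sum>n\<in>{n \<in> F. k n = j}. 1 / (1 + (x - a n)\<^sup>2))"
      by (rule sum.image_gen[OF F])
    also have "\<dots> \<le> (\<Sum>j\<in>k ` F. C * (1 / real (Suc j) ^ 2))"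
    proof (rule sum_mono)
      fix j assume "j \<in> k ` F"
      let ?F = "{n \<in> F. k n = j}"
      have "1 / (1 + (x - a n)\<^sup>2) \<le> 2 / d\<^sup>2 * (1 / real (Suc j) ^ 2)" if "n \<in> ?F" for n
      proof -
        have "real (Suc j) * d \<le> \<bar>a n - x\<bar> + 1"
          using k(1)[of n] that d by (simp add: algebra_simps)
        then have "(real (Suc j) * d)\<^sup>2 \<le> (\<bar>a n - x\<bar> + 1)\<^sup>2"
          using d by (intro power_mono) auto
        also have "\<dots> \<le> 2 * (1 + (x - a n)\<^sup>2)"
          using zero_le_power2[of "\<bar>a n - x\<bar> - 1"] by (simp add: power2_eq_square algebra_simps abs_mult_self_eq)
        finally have *: "real (Suc j) ^ 2 * d\<^sup>2 \<le> 2 * (1 + (x - a n)\<^sup>2)"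
          by (simp only: power_mult_distrib)
        have "0 < 1 + (x - a n)\<^sup>2" by (simp add: add_pos_nonneg)
        then show ?thesis
          using * d by (simp add: field_simps del: of_nat_Suc)
      qed
      then have "(\<Sum>n\<in>?F. 1 / (1 + (x - a n)\<^sup>2)) \<le> real (card ?F) * (2 / d\<^sup>2 * (1 / real (Suc j) ^ 2))"
        by (rule sum_bounded_above)
      also have "\<dots> \<le> 2 * (B / \<kappa>\<^sup>2) * (2 / d\<^sup>2 * (1 / real (Suc j) ^ 2))"
      proof (rule mult_right_mono)
        \<comment> \<open>One interval of length \<open>2d\<close> on either side of \<open>x\<close> covers the points at these distances.\<close>
        let ?P = "{n \<in> ?F. x \<le> a n}" and ?N = "{n \<in> ?F. a n < x}"
        have "card ?F = card ?P + card ?N"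
          using F by (subst card_Un_disjoint[symmetric]) (auto intro!: arg_cong[of _ _ card])
        moreover have "real (card ?P) \<le> B / \<kappa>\<^sup>2"
        proof (rule cnt)
          show "\<bar>a n - (x + real j * d)\<bar> \<le> d" if "n \<in> ?P" for n
            using k[of n] that by (auto simp: algebra_simps)
        qed (use F in auto)
        moreover have "real (card ?N) \<le> B / \<kappa>\<^sup>2"
        proof (rule cnt)
          show "\<bar>a n - (x - real j * d)\<bar> \<le> d" if "n \<in> ?N" for n
            using k[of n] that by (auto simp: algebra_simps)
        qed (use F in auto)
        ultimately show "real (card ?F) \<le> 2 * (B / \<kappa>\<^sup>2)" by simp
      qed simp
      finally show "(\<Sum>n\<in>?F. 1 / (1 + (x - a n)\<^sup>2)) \<le> C * (1 / real (Suc j) ^ 2)"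
        by (simp only: C_def mult.assoc)
    qed
    also have "\<dots> = C * (\<Sum>j\<in>k ` F. 1 / real (Suc j) ^ 2)"
      by (simp add: sum_distrib_left)
    also have "\<dots> \<le> C * (\<Sum>k. 1 / real (Suc k) ^ 2)"
      using B0 F unfolding C_def
      by (intro mult_left_mono sum_le_suminf sm mult_nonneg_nonneg divide_nonneg_nonneg[of 2]) auto
    finally show ?thesis .
  qed
  moreover have "C * (\<Sum>k. 1 / real (Suc k) ^ 2) \<ge> 0"
    using B0 unfolding C_def by (intro mult_nonneg_nonneg suminf_nonneg sm) (auto intro: divide_nonneg_nonneg)
  ultimately show ?thesis by (intro that allI impI)
qed

end

text \<open>By Tonelli, a point \<open>g\<close> contributes \<open>w g\<close> times \<open>\<integral> s\<^sup>-\<^sup>2 ds\<close> over \<open>[g, 1]\<close>, that is \<open>w g / g - w g\<close>,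
  to the integral. Finitely many points are compared at a time.\<close>

lemma summable_small_frequencies:
  fixes w :: "real \<Rightarrow> real"
  assumes w: "\<And>g. g \<in> \<Gamma> \<Longrightarrow> 0 \<le> w g"
    and sm: "w summable_on (\<Gamma> \<inter> {0<..<1})"
    and fin: "(\<integral>\<^sup>+s\<in>{0<..<1}. ennreal ((\<Sum>\<^sub>\<infinity>g\<in>\<Gamma> \<inter> {0<..<s}. w g) / s\<^sup>2) \<partial>lborel) < \<infinity>"
  shows "(\<lambda>g. w g / g) summable_on (\<Gamma> \<inter> {0<..<1})"
proof (rule nonneg_bdd_above_summable_on)
  define I where "I = (\<integral>\<^sup>+s\<in>{0<..<1}. ennreal ((\<Sum>\<^sub>\<infinity>g\<in>\<Gamma> \<inter> {0<..<s}. w g) / s\<^sup>2) \<partial>lborel)"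
  have "(\<Sum>g\<in>F. w g / g) \<le> enn2real I + infsum w (\<Gamma> \<inter> {0<..<1})"
    if F: "F \<subseteq> \<Gamma> \<inter> {0<..<1}" "finite F" for F
  proof -
    have FTC: "(\<integral>\<^sup>+s. ennreal (w g / s\<^sup>2) * indicator {g..1} s \<partial>lborel) = ennreal (w g / g - w g)"
      if "g \<in> F" for g
    proof -
      have g: "0 < g" "g < 1" "0 \<le> w g" using that F w by auto
      have "(\<integral>\<^sup>+s. ennreal (w g / s\<^sup>2) * indicator {g..1} s \<partial>lborel) = (- w g / 1) - (- w g / g)"
        using g by (intro nn_integral_FTC_Icc)
          (auto intro!: derivative_eq_intros simp: power2_eq_square)
      then show ?thesis by simp
    qed
    have "ennreal (\<Sum>g\<in>F. w g / g - w g) = (\<Sum>g\<in>F. ennreal (w g / g - w g))"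
    proof (rule sum_ennreal[symmetric])
      fix g assume "g \<in> F"
      then have "0 < g" "g < 1" "0 \<le> w g" using F w by auto
      then show "0 \<le> w g / g - w g" by (simp add: field_simps mult_left_le_one_le)
    qed
    also have "\<dots> = (\<integral>\<^sup>+s. (\<Sum>g\<in>F. ennreal (w g / s\<^sup>2) * indicator {g..1} s) \<partial>lborel)"
      by (subst nn_integral_sum) (auto simp: FTC)
    also have "\<dots> \<le> I"
      unfolding I_def
    proof (rule nn_integral_mono_AE)
      have "AE s in lborel. s \<notin> insert 1 F"
        using F(2) by (intro AE_not_in finite_imp_null_set_lborel) auto
      then show "AE s in lborel. (\<Sum>g\<in>F. ennreal (w g / s\<^sup>2) * indicator {g..1} s)
          \<le> ennreal ((\<Sum>\<^sub>\<infinity>g\<in>\<Gamma> \<inter> {0<..<s}. w g) / s\<^sup>2) * indicator {0<..<1} s"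
      proof eventually_elim
        case (elim s)
        show ?case
        proof (cases "0 < s \<and> s < 1")
          case True
          have "(\<Sum>g\<in>F. ennreal (w g / s\<^sup>2) * indicator {g..1} s) = (\<Sum>g\<in>F \<inter> {..<s}. ennreal (w g / s\<^sup>2))"
            using True elim F(2) by (intro sum.mono_neutral_cong_right) (auto simp: indicator_def less_le)
          also have "\<dots> = ennreal ((\<Sum>g\<in>F \<inter> {..<s}. w g) / s\<^sup>2)"
            using F w by (subst sum_ennreal) (auto simp: sum_divide_distrib)
          also have "(\<Sum>g\<in>F \<inter> {..<s}. w g) \<le> (\<Sum>\<^sub>\<infinity>g\<in>\<Gamma> \<inter> {0<..<s}. w g)"
            using F w True by (intro finite_sum_le_infsum summable_on_subset_banach[OF sm]) auto
          finally show ?thesis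
            using True by (simp add: divide_right_mono ennreal_leI)
        next
          case False
          have "indicator {g..1} s = (0 :: ennreal)" if "g \<in> F" for g
            using that False elim F(1) by (auto simp: indicator_def)
          then show ?thesis by simp
        qed
      qed
    qed
    finally have "(\<Sum>g\<in>F. w g / g - w g) \<le> enn2real I"
      using fin unfolding I_def[symmetric] by (cases I) (auto simp: ennreal_le_iff)
    moreover have "sum w F \<le> infsum w (\<Gamma> \<inter> {0<..<1})"
      using F w by (intro finite_sum_le_infsum sm) auto
    ultimately show ?thesis by (simp add: sum_subtractf)
  qed
  then show "bdd_above (sum (\<lambda>g. w g / g) ` {F. F \<subseteq> \<Gamma> \<inter> {0<..<1} \<and> finite F})"
    unfolding bdd_above_def by blast
qed (use w in auto)

context pure_point_transform
begin

lemma cauchy_kernel_summable: "(\<lambda>n. 1 / (1 + (x - a n)\<^sup>2)) summable_on UNIV"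
proof -
  obtain B where B: "B \<ge> 0" "\<forall>x F. finite F \<longrightarrow> (\<Sum>n\<in>F. 1 / (1 + (x - a n)\<^sup>2)) \<le> B"
    by (rule cauchy_kernel_sum_bounded)
  show ?thesis
    by (rule nonneg_bdd_above_summable_on) (use B(2) in \<open>auto simp: bdd_above_def add_nonneg_nonneg\<close>)
qed

lemma spectral_weight_summable:
  assumes y: "y > 0"
  shows "(\<lambda>g. norm (b g) * ((1 + \<bar>g\<bar>) * exp (- y * \<bar>g\<bar>))) summable_on \<Gamma>"
proof -
  obtain C N where C: "C \<ge> 0" "polynomial_growth \<Gamma> (\<lambda>g. norm (b g)) C N"
    using temperate_polynomial_growth[OF nu_temperate nu_points] norm_ge_zero by metis
  note s = polynomial_growth_summable[OF C(2,1) norm_ge_zero]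
  obtain D where D: "D \<ge> 0" "\<And>t. t \<ge> 0 \<Longrightarrow> t ^ (N + 3) * exp (- y * t) \<le> D"
    using power_exp_bound[OF y, of "N + 3"] by metis
  show ?thesis
  proof (rule summable_on_comparison_test[OF summable_on_cmult_right[OF s, of "D * exp y"]])
    fix g :: real
    let ?t = "1 + \<bar>g\<bar>"
    have "exp (- y * ?t) * exp y = exp (- y * \<bar>g\<bar>)"
      by (simp add: algebra_simps flip: exp_add)
    then have "?t ^ (N + 2) * (?t * exp (- y * \<bar>g\<bar>)) = ?t ^ (N + 3) * exp (- y * ?t) * exp y"
      by (simp add: eval_nat_numeral mult.assoc)
    also have "\<dots> \<le> D * exp y"
      by (intro mult_right_mono D(2)) auto
    finally have "?t * exp (- y * \<bar>g\<bar>) \<le> D * exp y / ?t ^ (N + 2)"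
      by (subst pos_le_divide_eq) (auto simp only: mult.commute zero_less_power add_pos_nonneg zero_less_one abs_ge_zero)
    from mult_left_mono[OF this norm_ge_zero[of "b g"]]
    show "norm (b g) * (?t * exp (- y * \<bar>g\<bar>)) \<le> D * exp y * (norm (b g) / ?t ^ (N + 2))"
      by (simp add: mult_ac)
  qed auto
qed

lemma spectral_positive_summable:
  assumes small: "(\<lambda>g. norm (b g) / g) summable_on (\<Gamma> \<inter> {0<..<1})" and y: "y > 0"
  shows "(\<lambda>g. norm (b g) / g * exp (- y * g)) summable_on (\<Gamma> \<inter> {0<..})"
proof -
  have "(\<lambda>g. norm (b g) / g * exp (- y * g)) summable_on (\<Gamma> \<inter> {0<..<1})"
  proof (rule summable_on_comparison_test[OF small])
    fix g assume "g \<in> \<Gamma> \<inter> {0<..<1}"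
    then show "norm (b g) / g * exp (- y * g) \<le> norm (b g) / g"
      using y by (intro mult_left_le) auto
  qed auto
  moreover have "(\<lambda>g. norm (b g) / g * exp (- y * g)) summable_on (\<Gamma> \<inter> {1..})"
  proof (rule summable_on_comparison_test)
    show "(\<lambda>g. norm (b g) * ((1 + \<bar>g\<bar>) * exp (- y * \<bar>g\<bar>))) summable_on (\<Gamma> \<inter> {1..})"
      by (rule summable_on_subset_banach[OF spectral_weight_summable[OF y]]) auto
    fix g assume g: "g \<in> \<Gamma> \<inter> {1..}"
    have "norm (b g) / g * exp (- y * g) \<le> norm (b g) / 1 * exp (- y * g)"
      using g by (intro mult_right_mono divide_left_mono) auto
    also have "\<dots> \<le> norm (b g) * ((1 + \<bar>g\<bar>) * exp (- y * \<bar>g\<bar>))"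
      using g by (auto simp: mult_left_mono)
    finally show "norm (b g) / g * exp (- y * g) \<le> norm (b g) * ((1 + \<bar>g\<bar>) * exp (- y * \<bar>g\<bar>))" .
  qed auto
  ultimately have "(\<lambda>g. norm (b g) / g * exp (- y * g)) summable_on ((\<Gamma> \<inter> {0<..<1}) \<union> (\<Gamma> \<inter> {1..}))"
    by (rule summable_on_Un_disjoint) auto
  also have "(\<Gamma> \<inter> {0<..<1}) \<union> (\<Gamma> \<inter> {1..}) = \<Gamma> \<inter> {0<..}" by auto
  finally show ?thesis .
qed

subsection \<open>The formula for the Cauchy kernel\<close>

text \<open>
  Integrating the formula for the narrow bumps against \<open>\<eta>\<^sub>+ exp (2\<pi>i\<eta>z)\<close> mollifies that ramp on
  the spectral side and cuts off its transform \<open>-1/(4\<pi>\<^sup>2(z - t)\<^sup>2)\<close> on the other side; both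
  effects disappear as the bumps shrink. The ramp is used rather than the step because its
  transform decays quadratically and its continuity at \<open>0\<close> makes the mollification harmless.
\<close>

lemma cauchy_kernel_formula:
  assumes z: "Im z > 0"
  shows "((\<lambda>g. b g * (of_real (max 0 g) * wave g z)) has_sum
      (- 1 / (4 * of_real pi ^ 2)) * (\<Sum>\<^sub>\<infinity>n. 1 / (z - of_real (a n))\<^sup>2)) \<Gamma>"
proof -
  define y where "y = Im z"
  define K where "K = (\<integral>s. bump s \<partial>lborel)"
  have y: "y > 0" using z by (simp add: y_def)
  have K: "K > 0" unfolding K_def by (rule integral_bump_pos)
  define h where "h \<eta> = of_real (max 0 \<eta>) * wave \<eta> z" for \<eta> :: real
  have norm_h: "norm (h \<eta>) = max 0 \<eta> * exp (- (2 * pi * y) * \<eta>)" for \<eta>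
    by (simp add: h_def norm_mult y_def mult_ac)
  have h_cont: "continuous_on UNIV h"
    unfolding h_def by (intro continuous_intros)
  then have h_meas [measurable]: "h \<in> borel_measurable borel"
    by (rule borel_measurable_continuous_onI)
  define E where "E g = exp (2 * pi * y) * ((1 + \<bar>g\<bar>) * exp (- (2 * pi * y) * \<bar>g\<bar>))" for g
  \<comment> \<open>A bound for \<open>h\<close> near \<open>g\<close> that is even in \<open>g\<close>, so the weights summed below apply to all of \<open>\<Gamma>\<close>.\<close>
  have E: "norm (h \<eta>) \<le> E g" if "\<bar>g - \<eta>\<bar> \<le> 1" for g \<eta>
  proof (cases "\<eta> \<le> 0")
    case True
    then show ?thesis by (simp add: norm_h E_def)
  next
    case False
    have "2 * pi * y * (\<bar>g\<bar> - 1) \<le> 2 * pi * y * \<eta>"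
      using that False y by (intro mult_left_mono) auto
    then have "\<eta> * exp (- (2 * pi * y) * \<eta>) \<le> (1 + \<bar>g\<bar>) * exp (2 * pi * y - 2 * pi * y * \<bar>g\<bar>)"
      using that False by (intro mult_mono) (auto simp: algebra_simps)
    then show ?thesis using False
      by (simp add: norm_h E_def exp_diff exp_minus field_simps)
  qed
  define R where "R j = real (Suc j)" for j
  have R1: "R j \<ge> 1" "R j > 0" for j by (auto simp: R_def)
  have Rlim: "filterlim R at_top sequentially"
    unfolding R_def by (rule filterlim_compose[OF filterlim_real_sequentially filterlim_Suc])
  have invR: "(\<lambda>j. 1 / R j) \<longlonglongrightarrow> 0"
    using tendsto_inverse_0_at_top[OF Rlim] by (simp add: field_simps)
  define H where "H j g = (\<integral>u. h (g - u / R j) * of_real (bump u) \<partial>lborel)" for j g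
  have hb: "norm (h (g - u / R j) * of_real (bump u)) \<le> E g * bump u" for j g u
  proof (cases "\<bar>u\<bar> < 1")
    case True
    then have "\<bar>u / R j\<bar> \<le> 1"
      using R1(1)[of j] by (simp add: field_simps)
    then show ?thesis
      using E[of g "g - u / R j"] by (simp add: norm_mult bump_nonneg mult_right_mono)
  qed (simp add: bump_eq_0)
  have int_h: "integrable lborel (\<lambda>u. h (g - u / R j) * of_real (bump u))" for j g
  proof (rule Bochner_Integration.integrable_bound)
    show "integrable lborel (\<lambda>u. E g * bump u)"
      by (intro integrable_mult_right integrable_bump)
    show "AE u in lborel. norm (h (g - u / R j) * of_real (bump u)) \<le> norm (E g * bump u)"
      by (intro always_eventually allI order.trans[OF hb]) simp
  qed measurable
  have norm_int: "(\<integral>u. norm (h (g - u / R j) * of_real (bump u)) \<partial>lborel) \<le> E g * K" for j g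
  proof -
    have "(\<integral>u. norm (h (g - u / R j) * of_real (bump u)) \<partial>lborel) \<le> (\<integral>u. E g * bump u \<partial>lborel)"
      by (rule integral_mono[OF integrable_norm[OF int_h] integrable_mult_right[OF integrable_bump] hb])
    then show ?thesis by (simp add: K_def)
  qed
  have H_lim: "(\<lambda>j. H j g) \<longlonglongrightarrow> h g * of_real K" for g
  proof -
    have "(\<lambda>j. H j g) \<longlonglongrightarrow> (\<integral>u. h g * of_real (bump u) \<partial>lborel)"
      unfolding H_def
    proof (rule integral_dominated_convergence[where w = "\<lambda>u. E g * bump u"])
      show "integrable lborel (\<lambda>u. E g * bump u)"
        by (intro integrable_mult_right integrable_bump)
      show "AE u in lborel. (\<lambda>j. h (g - u / R j) * of_real (bump u)) \<longlonglongrightarrow> h g * of_real (bump u)"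
      proof (intro always_eventually allI)
        fix u
        have "(\<lambda>j. g - u * (1 / R j)) \<longlonglongrightarrow> g - u * 0"
          by (intro tendsto_intros invR)
        then have "(\<lambda>j. g - u / R j) \<longlonglongrightarrow> g" by simp
        then have "(\<lambda>j. h (g - u / R j)) \<longlonglongrightarrow> h g"
          using h_cont by (auto simp: continuous_on_eq_continuous_at intro: isCont_tendsto_compose)
        then show "(\<lambda>j. h (g - u / R j) * of_real (bump u)) \<longlonglongrightarrow> h g * of_real (bump u)"
          by (intro tendsto_intros)
      qed
    qed (use hb in auto)
    then show ?thesis by (simp add: K_def)
  qed
  have sum_E: "(\<lambda>g. norm (b g) * (E g * K)) summable_on \<Gamma>"
  proof -
    have "2 * pi * y > 0" using y by simp
    from summable_on_cmult_left[OF spectral_weight_summable[OF this], of "exp (2 * pi * y) * K"]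
    show ?thesis by (simp add: E_def mult_ac)
  qed
  \<comment> \<open>Both sums are the integral of \<open>h \<eta> * S \<eta>\<close>, where \<open>S \<eta>\<close> is the common value of the two sides of the formula.\<close>
  have ex: "\<exists>I. ((\<lambda>n. bump_hat (a n / R j) * (- 1 / (4 * of_real pi ^ 2 * (z - of_real (a n))\<^sup>2))) has_sum I) UNIV
      \<and> ((\<lambda>g. b g * H j g) has_sum I) \<Gamma>" for j
  proof -
    obtain S where
      S1: "\<forall>\<eta>. ((\<lambda>n. exp (- (2 * of_real pi * \<i> * of_real \<eta> * of_real (a n))) * bump_hat ((a n - 0) / R j)) has_sum S \<eta>) UNIV"
      and S2: "\<forall>\<eta>. ((\<lambda>g. b g * (of_real (R j) * bump_atom (R j) \<eta> 0 g)) has_sum S \<eta>) \<Gamma>"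
      by (rule summation_formula_bump[OF R1(2), of 0 j])
    let ?f = "\<lambda>n \<eta>. h \<eta> * (exp (- (2 * of_real pi * \<i> * of_real \<eta> * of_real (a n))) * bump_hat ((a n - 0) / R j))"
    let ?r = "\<lambda>n \<eta>. of_real (max 0 \<eta>) * wave \<eta> (z - of_real (a n))"
    have f_alt: "?f n \<eta> = bump_hat (a n / R j) * ?r n \<eta>" for n \<eta>
      by (simp add: h_def algebra_simps flip: exp_add)
    have Imz: "Im (z - of_real (a n)) > 0" for n using z by simp
    have int_f: "integrable lborel (?f n)" for n
      unfolding f_alt by (rule integrable_mult_right[OF integral_ramp_exp(1)[OF Imz]])
    have val_f: "(\<integral>\<eta>. ?f n \<eta> \<partial>lborel) = bump_hat (a n / R j) * (- 1 / (4 * of_real pi ^ 2 * (z - of_real (a n))\<^sup>2))" for n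
      unfolding f_alt integral_mult_right_zero integral_ramp_exp(2)[OF Imz] ..
    have norm_f: "(\<integral>\<eta>. norm (?f n \<eta>) \<partial>lborel) = norm (bump_hat (a n / R j)) * (\<integral>\<eta>. norm (h \<eta>) \<partial>lborel)" for n
    proof -
      have "norm (?f n \<eta>) = norm (bump_hat (a n / R j)) * norm (h \<eta>)" for \<eta>
        by (simp add: norm_mult)
      then show ?thesis by (simp only: integral_mult_right_zero)
    qed
    have "(\<lambda>n. exp (- (2 * of_real pi * \<i> * of_real 0 * of_real (a n))) * bump_hat ((a n - 0) / R j)) summable_on UNIV"
      using S1[rule_format, of 0] by (rule has_sum_imp_summable)
    then have "(\<lambda>n. norm (bump_hat (a n / R j))) summable_on UNIV"
      by (simp add: summable_on_iff_abs_summable_on_complex)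
    then have sum_f: "(\<lambda>n. \<integral>\<eta>. norm (?f n \<eta>) \<partial>lborel) summable_on UNIV"
      unfolding norm_f by (rule summable_on_cmult_left)
    have hs_f: "((\<lambda>n. ?f n \<eta>) has_sum h \<eta> * S \<eta>) UNIV" for \<eta>
      by (rule has_sum_cmult_right[OF S1[rule_format]])
    have F: "((\<lambda>n. bump_hat (a n / R j) * (- 1 / (4 * of_real pi ^ 2 * (z - of_real (a n))\<^sup>2))) has_sum
        (\<integral>\<eta>. h \<eta> * S \<eta> \<partial>lborel)) UNIV"
      using has_sum_integral(1)[of "UNIV :: int set", OF countableI_type int_f sum_f hs_f]
      unfolding val_f .
    let ?g = "\<lambda>g \<eta>. h \<eta> * (b g * (of_real (R j) * bump_atom (R j) \<eta> 0 g))"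
    have g_aff: "?g g (g + (- 1 / R j) * u) = of_real (R j) * (b g * (h (g - u / R j) * of_real (bump u)))" for g u
      using R1(2)[of j] by (simp add: bump_atom_def mult_ac)
    have cn0: "- 1 / R j \<noteq> 0" using R1(2)[of j] by simp
    have int_g: "integrable lborel (?g g)" for g
    proof -
      have "integrable lborel (\<lambda>u. ?g g (g + (- 1 / R j) * u))"
        unfolding g_aff by (intro integrable_mult_right int_h)
      then show ?thesis
        using lborel_integrable_real_affine_iff[OF cn0, of "?g g" g] by blast
    qed
    have val_g: "(\<integral>\<eta>. ?g g \<eta> \<partial>lborel) = b g * H j g" for g
    proof -
      have "(\<integral>\<eta>. ?g g \<eta> \<partial>lborel) = \<bar>- 1 / R j\<bar> *\<^sub>R (\<integral>u. ?g g (g + (- 1 / R j) * u) \<partial>lborel)"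
        by (rule lborel_integral_real_affine[OF cn0])
      also have "\<dots> = b g * H j g"
        unfolding g_aff integral_mult_right_zero H_def
        using R1(2)[of j] by (simp add: scaleR_conv_of_real)
      finally show ?thesis .
    qed
    have norm_g: "(\<integral>\<eta>. norm (?g g \<eta>) \<partial>lborel) \<le> norm (b g) * (E g * K)" for g
    proof -
      have "(\<integral>\<eta>. norm (?g g \<eta>) \<partial>lborel) = \<bar>- 1 / R j\<bar> *\<^sub>R (\<integral>u. norm (?g g (g + (- 1 / R j) * u)) \<partial>lborel)"
        by (rule lborel_integral_real_affine[OF cn0])
      also have "(\<lambda>u. norm (?g g (g + (- 1 / R j) * u)))
          = (\<lambda>u. R j * (norm (b g) * norm (h (g - u / R j) * of_real (bump u))))"
        unfolding g_aff using R1(2)[of j] by (simp add: norm_mult)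
      also have "\<bar>- 1 / R j\<bar> *\<^sub>R (\<integral>u. R j * (norm (b g) * norm (h (g - u / R j) * of_real (bump u))) \<partial>lborel)
          = norm (b g) * (\<integral>u. norm (h (g - u / R j) * of_real (bump u)) \<partial>lborel)"
        unfolding integral_mult_right_zero using R1(2)[of j] by simp
      also have "\<dots> \<le> norm (b g) * (E g * K)"
        by (intro mult_left_mono norm_int) auto
      finally show ?thesis .
    qed
    have sum_g: "(\<lambda>g. \<integral>\<eta>. norm (?g g \<eta>) \<partial>lborel) summable_on \<Gamma>"
      by (rule summable_on_comparison_test[OF sum_E norm_g]) simp
    have hs_g: "((\<lambda>g. ?g g \<eta>) has_sum h \<eta> * S \<eta>) \<Gamma>" for \<eta>
      by (rule has_sum_cmult_right[OF S2[rule_format]])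
    have "((\<lambda>g. b g * H j g) has_sum (\<integral>\<eta>. h \<eta> * S \<eta> \<partial>lborel)) \<Gamma>"
      using has_sum_integral(1)[OF countable_spectrum int_g sum_g hs_g] unfolding val_g .
    with F show ?thesis by blast
  qed
  from choice[OF allI[OF ex]] obtain I where
    I: "\<forall>j. ((\<lambda>n. bump_hat (a n / R j) * (- 1 / (4 * of_real pi ^ 2 * (z - of_real (a n))\<^sup>2))) has_sum I j) UNIV
      \<and> ((\<lambda>g. b g * H j g) has_sum I j) \<Gamma>" ..
  note I1 = conjunct1[OF I[rule_format]] and I2 = conjunct2[OF I[rule_format]]
  have lim2: "I \<longlonglongrightarrow> infsum (\<lambda>g. b g * (h g * of_real K)) \<Gamma>"
    "(\<lambda>g. b g * (h g * of_real K)) summable_on \<Gamma>"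
  proof -
    have "norm (b g * H j g) \<le> norm (b g) * (E g * K)" for j g
    proof -
      have "norm (H j g) \<le> E g * K"
        unfolding H_def by (rule order.trans[OF integral_norm_bound norm_int])
      then show ?thesis by (simp add: norm_mult mult_left_mono)
    qed
    note dom = has_sum_dominated_convergence[where f = "\<lambda>j g. b g * H j g" and g = "\<lambda>g. b g * (h g * of_real K)",
        OF I2 tendsto_mult[OF tendsto_const H_lim] this sum_E sequentially_bot]
    show "I \<longlonglongrightarrow> infsum (\<lambda>g. b g * (h g * of_real K)) \<Gamma>"
      "(\<lambda>g. b g * (h g * of_real K)) summable_on \<Gamma>" by (fact dom)+
  qed
  let ?T = "\<lambda>n. - 1 / (4 * of_real pi ^ 2 * (z - of_real (a n))\<^sup>2) :: complex"
  let ?M = "\<lambda>n. K * ((1 + 1 / y\<^sup>2) * (1 / (1 + (Re z - a n)\<^sup>2)))"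
  have Tle: "norm (1 / (z - of_real (a n))\<^sup>2) \<le> (1 + 1 / y\<^sup>2) * (1 / (1 + (Re z - a n)\<^sup>2))" for n
  proof -
    have n2: "norm ((z - of_real (a n))\<^sup>2) = (Re z - a n)\<^sup>2 + y\<^sup>2"
      by (simp add: norm_power cmod_power2 y_def)
    have pos: "0 < (Re z - a n)\<^sup>2 + y\<^sup>2" "0 < 1 + (Re z - a n)\<^sup>2"
      using y by (auto intro: add_nonneg_pos add_pos_nonneg)
    have "1 + (Re z - a n)\<^sup>2 \<le> (1 + 1 / y\<^sup>2) * ((Re z - a n)\<^sup>2 + y\<^sup>2)"
      using y by (simp add: field_simps)
    then show ?thesis
      using pos unfolding norm_divide n2 by (simp add: field_simps)
  qed
  have Msum: "(\<lambda>n. (1 + 1 / y\<^sup>2) * (1 / (1 + (Re z - a n)\<^sup>2))) summable_on UNIV"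
    by (intro summable_on_cmult_right cauchy_kernel_summable)
  have lim1: "I \<longlonglongrightarrow> infsum (\<lambda>n. bump_hat 0 * ?T n) UNIV"
  proof (rule has_sum_dominated_convergence(1)[where f = "\<lambda>j n. bump_hat (a n / R j) * ?T n", OF I1])
    show "(\<lambda>j. bump_hat (a n / R j) * ?T n) \<longlonglongrightarrow> bump_hat 0 * ?T n" for n
    proof -
      have "(\<lambda>j. a n * (1 / R j)) \<longlonglongrightarrow> a n * 0"
        by (intro tendsto_intros invR)
      then have "(\<lambda>j. a n / R j) \<longlonglongrightarrow> 0" by simp
      then have "(\<lambda>j. bump_hat (a n / R j)) \<longlonglongrightarrow> bump_hat 0"
        using bump_hat_continuous[of UNIV]
        by (auto simp: continuous_on_eq_continuous_at intro: isCont_tendsto_compose)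
      then show ?thesis by (intro tendsto_intros)
    qed
    show "norm (bump_hat (a n / R j) * ?T n) \<le> ?M n" for j n
    proof -
      have "1 \<le> 4 * pi\<^sup>2"
        using mult_mono[of 1 pi 1 pi] pi_gt3 by (simp add: power2_eq_square)
      then have "1 / (4 * pi\<^sup>2) * norm (1 / (z - of_real (a n))\<^sup>2) \<le> 1 * norm (1 / (z - of_real (a n))\<^sup>2)"
        by (intro mult_right_mono) auto
      then have "norm (?T n) \<le> norm (1 / (z - of_real (a n))\<^sup>2)"
        by (simp add: norm_divide norm_mult norm_power)
      then show ?thesis
        unfolding norm_mult using Tle[of n] norm_bump_hat_le[of "a n / R j"] K
        by (intro mult_mono) (auto simp: K_def)
    qed
    show "?M summable_on UNIV"
      by (rule summable_on_cmult_right[OF Msum])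
  qed simp_all
  have "infsum (\<lambda>g. b g * (h g * of_real K)) \<Gamma> = infsum (\<lambda>n. bump_hat 0 * ?T n) UNIV"
    using lim1 lim2(1) by (rule LIMSEQ_unique[rotated])
  also have "(\<lambda>n. bump_hat 0 * ?T n) = (\<lambda>n. (of_real K * (- 1 / (4 * of_real pi ^ 2))) * (1 / (z - of_real (a n))\<^sup>2))"
    by (simp add: bump_hat_0 K_def)
  finally have "infsum (\<lambda>g. b g * (h g * of_real K)) \<Gamma>
      = (of_real K * (- 1 / (4 * of_real pi ^ 2))) * (\<Sum>\<^sub>\<infinity>n. 1 / (z - of_real (a n))\<^sup>2)"
    by (simp only: infsum_cmult_right'[symmetric])
  then have "((\<lambda>g. b g * (h g * of_real K)) has_sum
      (of_real K * (- 1 / (4 * of_real pi ^ 2))) * (\<Sum>\<^sub>\<infinity>n. 1 / (z - of_real (a n))\<^sup>2)) \<Gamma>"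
    using lim2(2) by (metis has_sum_infsum)
  from has_sum_cmult_right[OF this, of "1 / of_real K"]
  show "((\<lambda>g. b g * (of_real (max 0 g) * wave g z)) has_sum
      (- 1 / (4 * of_real pi ^ 2)) * (\<Sum>\<^sub>\<infinity>n. 1 / (z - of_real (a n))\<^sup>2)) \<Gamma>"
    using K by (simp add: h_def mult_ac)
qed

end

section \<open>Termwise differentiation\<close>

lemma has_sum_has_field_derivative:
  fixes f :: "'i \<Rightarrow> complex \<Rightarrow> complex"
  assumes r: "r > 0"
    and der: "\<And>i w. i \<in> I \<Longrightarrow> w \<in> cball z r \<Longrightarrow> (f i has_field_derivative f' i w) (at w)"
    and le: "\<And>i w. i \<in> I \<Longrightarrow> w \<in> cball z r \<Longrightarrow> norm (f i w) \<le> M i"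
    and M: "M summable_on I"
  obtains D where "((\<lambda>w. \<Sum>\<^sub>\<infinity>i\<in>I. f i w) has_field_derivative D) (at z)"
    and "((\<lambda>i. f' i z) has_sum D) I"
proof -
  have ul: "uniform_limit (cball z r) (\<lambda>X w. \<Sum>i\<in>X. f i w) (\<lambda>w. \<Sum>\<^sub>\<infinity>i\<in>I. f i w) (finite_subsets_at_top I)"
    by (rule Weierstrass_m_test_general[OF le M])
  have ev: "\<forall>\<^sub>F X in finite_subsets_at_top I. continuous_on (cball z r) (\<lambda>w. \<Sum>i\<in>X. f i w) \<and>
      (\<forall>w\<in>ball z r. ((\<lambda>w. \<Sum>i\<in>X. f i w) has_field_derivative (\<Sum>i\<in>X. f' i w)) (at w))"
  proof (rule eventually_finite_subsets_at_top_weakI)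
    fix X assume X: "finite X" "X \<subseteq> I"
    have d: "((\<lambda>w. \<Sum>i\<in>X. f i w) has_field_derivative (\<Sum>i\<in>X. f' i w)) (at w)" if "w \<in> cball z r" for w
      using X der that by (intro DERIV_sum) auto
    show "continuous_on (cball z r) (\<lambda>w. \<Sum>i\<in>X. f i w) \<and>
      (\<forall>w\<in>ball z r. ((\<lambda>w. \<Sum>i\<in>X. f i w) has_field_derivative (\<Sum>i\<in>X. f' i w)) (at w))"
      using d DERIV_isCont[OF d] by (auto intro!: continuous_at_imp_continuous_on)
  qed
  from has_complex_derivative_uniform_limit[OF ev ul _ r]
  obtain g' where "\<And>w. w \<in> ball z r \<Longrightarrow> ((\<lambda>w. \<Sum>\<^sub>\<infinity>i\<in>I. f i w) has_field_derivative g' w) (at w) \<and>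
      ((\<lambda>X. \<Sum>i\<in>X. f' i w) \<longlongrightarrow> g' w) (finite_subsets_at_top I)"
    by auto
  from this[of z] r show ?thesis
    by (intro that[of "g' z"]) (auto simp: has_sum_def)
qed

section \<open>An elementary odd kernel\<close>

text \<open>
  This combination of arctangents approaches \<open>\<plusminus>\<pi>/2\<close> at a quadratic rate, a single arctangent
  only at a linear rate; sums of the error over a set of bounded density therefore stay bounded.
\<close>

definition step_kernel :: "real \<Rightarrow> real" where
  "step_kernel u = 2 * arctan u - arctan (u / 2)"

lemma step_kernel_deriv:
  "(step_kernel has_real_derivative (2 / (1 + u\<^sup>2) - 2 / (4 + u\<^sup>2))) (at u)"
proof -
  have "1 + (u / 2)\<^sup>2 = (4 + u\<^sup>2) / 4" by (simp add: power2_eq_square)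
  then show ?thesis
    unfolding step_kernel_def [abs_def]
    by (auto intro!: derivative_eq_intros simp: field_simps add_nonneg_eq_0_iff)
qed

lemma arctan_ge: "0 \<le> x \<Longrightarrow> x / (1 + x\<^sup>2) \<le> arctan x"
proof -
  assume x: "0 \<le> x"
  let ?f = "\<lambda>x. arctan x - x / (1 + x\<^sup>2)"
  have pos: "1 + t\<^sup>2 \<noteq> 0" for t :: real
    by (metis add_pos_nonneg less_irrefl zero_le_power2 zero_less_one)
  have "(?f has_real_derivative 2 * t\<^sup>2 / (1 + t\<^sup>2)\<^sup>2) (at t)" for t
  proof -
    define q where "q = 1 + t\<^sup>2"
    have q: "q \<noteq> 0" using pos by (simp add: q_def)
    have "(?f has_real_derivative 1 / q - (1 * q - t * (2 * t)) / (q * q)) (at t)"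
      unfolding q_def using pos[of t]
      by (auto intro!: derivative_eq_intros simp: inverse_eq_divide)
    moreover have "1 / q - (1 * q - t * (2 * t)) / (q * q) = 2 * t\<^sup>2 / q\<^sup>2"
      using q by (simp add: divide_simps power2_eq_square)
    ultimately show ?thesis by (simp add: q_def)
  qed
  then have "?f 0 \<le> ?f x"
    by (intro DERIV_nonneg_imp_nondecreasing[OF x]) (auto intro!: exI divide_nonneg_nonneg)
  then show ?thesis by simp
qed

lemma step_kernel_pos_limit:
  assumes u: "0 \<le> u"
  shows "\<bar>step_kernel u - pi / 2\<bar> \<le> 16 / (1 + u\<^sup>2)"
proof (cases "u \<le> 1")
  case True
  have "0 \<le> arctan u" "arctan u < pi / 2" "0 \<le> arctan (u / 2)" "arctan (u / 2) < pi / 2"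
    using u arctan_ubound[of u] arctan_ubound[of "u / 2"] by (simp_all add: zero_le_arctan_iff)
  then have "\<bar>step_kernel u - pi / 2\<bar> \<le> 8"
    using pi_less_4 unfolding step_kernel_def abs_le_iff by linarith
  also have "u\<^sup>2 \<le> 1" using True u by (simp add: power_le_one)
  then have "8 \<le> 16 / (1 + u\<^sup>2)"
    by (simp add: field_simps add_pos_nonneg)
  finally show ?thesis .
next
  case False
  \<comment> \<open>At \<open>v = 1/u\<close> near \<open>0\<close> the linear terms of \<open>arctan (2v)\<close> and \<open>2 arctan v\<close> cancel.\<close>
  define v where "v = 1 / u"
  have v: "0 < v" "v \<le> 1" using False by (auto simp: v_def)
  have a1: "arctan u = pi / 2 - arctan v"
    using arctan_inverse[of v] v by (simp add: v_def)
  have a2: "arctan (u / 2) = pi / 2 - arctan (2 * v)"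
    using arctan_inverse[of "2 * v"] v by (simp add: v_def)
  have s: "step_kernel u - pi / 2 = arctan (2 * v) - 2 * arctan v"
    unfolding step_kernel_def a1 a2 by simp
  have cubic: "t - t / (1 + t\<^sup>2) \<le> t ^ 3" if "0 \<le> t" for t :: real
  proof -
    have pos: "0 < 1 + t\<^sup>2" by (simp add: add_pos_nonneg)
    then have "t - t / (1 + t\<^sup>2) = t ^ 3 / (1 + t\<^sup>2)"
      by (simp add: divide_simps) (simp add: power2_eq_square power3_eq_cube algebra_simps)
    also have "\<dots> \<le> t ^ 3 / 1"
      using that pos by (intro divide_left_mono) auto
    finally show ?thesis by simp
  qed
  have "arctan (2 * v) \<le> 2 * v" "arctan v \<le> v"
    using v by (auto intro: arctan_le_self)
  moreover have "v / (1 + v\<^sup>2) \<le> arctan v" "2 * v / (1 + (2 * v)\<^sup>2) \<le> arctan (2 * v)"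
    using v arctan_ge[of v] arctan_ge[of "2 * v"] by auto
  moreover have "v - v / (1 + v\<^sup>2) \<le> v ^ 3" "2 * v - 2 * v / (1 + (2 * v)\<^sup>2) \<le> 8 * v ^ 3"
    using cubic[of v] cubic[of "2 * v"] v by (auto simp: power_mult_distrib)
  moreover have "v ^ 3 \<le> v\<^sup>2" using v by (intro power_decreasing) auto
  ultimately have "\<bar>step_kernel u - pi / 2\<bar> \<le> 8 * v\<^sup>2"
    unfolding s abs_le_iff using zero_le_power2[of v] by linarith
  also have "8 * v\<^sup>2 \<le> 16 / (1 + u\<^sup>2)"
  proof -
    have "1 \<le> u\<^sup>2" using False by (simp add: one_le_power)
    then show ?thesis using False by (simp add: v_def field_simps add_pos_nonneg)
  qed
  finally show ?thesis .
qed

lemma step_kernel_neg_limit: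
  assumes "u \<le> 0"
  shows "\<bar>step_kernel u + pi / 2\<bar> \<le> 16 / (1 + u\<^sup>2)"
proof -
  have "step_kernel u = - step_kernel (- u)"
    by (simp add: step_kernel_def arctan_minus)
  then show ?thesis
    using step_kernel_pos_limit[of "- u"] assms by (simp add: abs_minus_commute)
qed

section \<open>Real sequences with a one-sided spectrum\<close>

text \<open>
  The properties of the measure on which the rest of the argument rests: its points have bounded density and
  the sums of \<open>(z - a\<^sub>n)\<^sup>-\<^sup>2\<close> over the upper half plane are given by a Dirichlet series with positive
  frequencies, which may be integrated twice.
\<close>

locale spectral_zeros =
  fixes a :: "int \<Rightarrow> real" and P :: "real set" and b :: "real \<Rightarrow> complex"
  assumes mono_Suc: "\<And>n. a n \<le> a (n + 1)"
    and nonzero: "\<And>n. a n \<noteq> 0"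
    and P_pos: "\<And>g. g \<in> P \<Longrightarrow> 0 < g"
    and density: "\<exists>B. \<forall>x F. finite F \<longrightarrow> (\<Sum>n\<in>F. 1 / (1 + (x - a n)\<^sup>2)) \<le> B"
    and weight: "\<And>y. y > 0 \<Longrightarrow> (\<lambda>g. norm (b g) / g * exp (- y * g)) summable_on P"
    and formula: "\<And>z. Im z > 0 \<Longrightarrow>
      ((\<lambda>g. b g * (of_real g * wave g z)) has_sum
        (- 1 / (4 * of_real pi ^ 2)) * (\<Sum>\<^sub>\<infinity>n. 1 / (z - of_real (a n))\<^sup>2)) P"
begin

lemma mono_a: "m \<le> n \<Longrightarrow> a m \<le> a n"
proof (induction n rule: int_ge_induct)
  case (step i)
  then show ?case using mono_Suc[of i] by linarith
qed simp

lemma cauchy_summable: "(\<lambda>n. 1 / (1 + (x - a n)\<^sup>2)) summable_on UNIV"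
proof -
  obtain B where B: "\<forall>x F. finite F \<longrightarrow> (\<Sum>n\<in>F. 1 / (1 + (x - a n)\<^sup>2)) \<le> B"
    using density by (rule exE)
  show ?thesis
    by (rule nonneg_bdd_above_summable_on) (use B in \<open>auto simp: bdd_above_def add_nonneg_nonneg\<close>)
qed

lemma nonzero_bound: obtains d where "d > 0" "\<And>n. d \<le> \<bar>a n\<bar>"
proof -
  obtain B where B: "\<forall>x F. finite F \<longrightarrow> (\<Sum>n\<in>F. 1 / (1 + (x - a n)\<^sup>2)) \<le> B"
    using density by (rule exE)
  let ?S = "{n. \<bar>a n\<bar> < 1}"
  have "finite ?S"
  proof (rule ccontr)
    assume "infinite ?S"
    then obtain F where F: "finite F" "F \<subseteq> ?S" "card F = nat \<lceil>2 * B + 1\<rceil>"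
      using infinite_arbitrarily_large by blast
    have "real (card F) * (1 / 2) \<le> (\<Sum>n\<in>F. 1 / (1 + (0 - a n)\<^sup>2))"
    proof (rule sum_bounded_below)
      fix n assume "n \<in> F"
      then have "\<bar>a n\<bar> < 1" using F by auto
      then have "(a n)\<^sup>2 < 1" by (simp add: abs_square_less_1)
      then show "1 / 2 \<le> 1 / (1 + (0 - a n)\<^sup>2)" by (simp add: field_simps add_pos_nonneg)
    qed
    also have "\<dots> \<le> B" using B F(1) by blast
    finally show False using F(3) by linarith
  qed
  then show ?thesis
  proof (intro that)
    let ?d = "Min (insert 1 ((\<lambda>n. \<bar>a n\<bar>) ` ?S))"
    show "0 < ?d" using \<open>finite ?S\<close> nonzero by auto
    show "?d \<le> \<bar>a n\<bar>" for n
      using \<open>finite ?S\<close> by (cases "\<bar>a n\<bar> < 1") (auto intro: Min_le order.trans[OF Min_le[of _ 1]])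
  qed
qed

lemma inverse_square_summable: "(\<lambda>n. 1 / (a n)\<^sup>2) summable_on UNIV"
proof -
  obtain d where d: "d > 0" "\<And>n. d \<le> \<bar>a n\<bar>" by (rule nonzero_bound) auto
  show ?thesis
  proof (rule summable_on_comparison_test[OF summable_on_cmult_right[OF cauchy_summable[of 0], of "1 + 1 / d\<^sup>2"]])
    fix n
    have "d\<^sup>2 \<le> (a n)\<^sup>2" using power_mono[OF d(2)[of n], of 2] d(1) by simp
    then have "1 + (a n)\<^sup>2 \<le> (1 + 1 / d\<^sup>2) * (a n)\<^sup>2"
      using d(1) by (simp add: field_simps)
    then show "1 / (a n)\<^sup>2 \<le> (1 + 1 / d\<^sup>2) * (1 / (1 + (0 - a n)\<^sup>2))"
      using nonzero[of n] by (simp add: field_simps add_pos_nonneg)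
  qed auto
qed

definition upper :: "complex set" where "upper = {z. 0 < Im z}"

lemma upper_convex_open: "convex upper" "open upper"
  unfolding upper_def by (auto intro: convex_halfspace_Im_gt open_halfspace_Im_gt)

lemma upper_cball:
  assumes "z \<in> upper"
  shows "Im z / 2 > 0" "\<And>w. w \<in> cball z (Im z / 2) \<Longrightarrow> Im z / 2 \<le> Im w"
proof -
  show "Im z / 2 > 0" using assms by (simp add: upper_def)
  show "Im z / 2 \<le> Im w" if "w \<in> cball z (Im z / 2)" for w
    using that abs_Im_le_cmod[of "z - w"] by (auto simp: dist_norm)
qed

subsection \<open>The Dirichlet series and its antiderivatives\<close>

text \<open>The formula for \<open>\<Sum> 1 / (z - a\<^sub>n)\<^sup>2\<close> is integrated to \<open>dirichlet\<close>, and once more to \<open>dirichlet_log\<close>;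
  the second antiderivative exists because \<open>\<Sum> \<bar>b\<^sub>g\<bar> / g\<close> converges at small \<open>g\<close>.\<close>

definition dirichlet_log :: "complex \<Rightarrow> complex" where
  "dirichlet_log z = (\<Sum>\<^sub>\<infinity>g\<in>P. - (b g / of_real g) * wave g z)"

definition dirichlet :: "complex \<Rightarrow> complex" where
  "dirichlet z = (\<Sum>\<^sub>\<infinity>g\<in>P. - (2 * of_real pi * \<i> * b g) * wave g z)"

lemma norm_wave: "norm (wave g z) = exp (- (2 * pi * Im z) * g)"
  by (simp add: mult_ac)

lemma log_term_le:
  assumes "g \<in> P" "y \<le> Im z"
  shows "norm (- (b g / of_real g) * wave g z) \<le> norm (b g) / g * exp (- (2 * pi * y) * g)"
proof -
  have "exp (- (2 * pi * Im z) * g) \<le> exp (- (2 * pi * y) * g)"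
    using assms P_pos[of g] by simp
  then show ?thesis
    unfolding norm_mult norm_wave using P_pos[OF assms(1)]
    by (simp add: norm_divide divide_right_mono mult_left_mono)
qed

lemma dirichlet_log_has_sum:
  assumes "z \<in> upper"
  shows "((\<lambda>g. - (b g / of_real g) * wave g z) has_sum dirichlet_log z) P"
proof -
  have "2 * pi * Im z > 0" using assms by (simp add: upper_def)
  from Infinite_Sum.abs_summable_on_comparison_test'[OF weight[OF this] log_term_le[OF _ order_refl]]
  show ?thesis
    unfolding dirichlet_log_def by (rule has_sum_infsum[OF abs_summable_summable])
qed

lemma weight_mass: "y > 0 \<Longrightarrow> (\<lambda>g. norm (b g) * exp (- y * g)) summable_on P"
proof -
  assume y: "y > 0"
  then have y2: "y / 2 > 0" by simp
  show ?thesis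
  proof (rule summable_on_comparison_test[OF summable_on_cmult_right[OF weight[OF y2], of "2 / y"]])
    fix g assume g: "g \<in> P"
    have "y / 2 * g \<le> exp (y / 2 * g)"
      using exp_ge_add_one_self[of "y / 2 * g"] by linarith
    then have "g \<le> 2 / y * exp (y / 2 * g)" using y by (simp add: field_simps)
    then have "g * exp (- y * g) \<le> 2 / y * exp (y / 2 * g) * exp (- y * g)"
      by (rule mult_right_mono) simp
    also have "\<dots> = 2 / y * exp (- (y / 2) * g)"
      by (simp add: mult.assoc flip: exp_add)
    finally have "norm (b g) / g * (g * exp (- y * g)) \<le> norm (b g) / g * (2 / y * exp (- (y / 2) * g))"
      using P_pos[OF g] by (intro mult_left_mono) auto
    then show "norm (b g) * exp (- y * g) \<le> 2 / y * (norm (b g) / g * exp (- (y / 2) * g))"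
      using P_pos[OF g] y by (simp add: field_simps)
  qed auto
qed

lemma mass_term_le:
  assumes "g \<in> P" "y \<le> Im z"
  shows "norm (- (2 * of_real pi * \<i> * b g) * wave g z) \<le> 2 * pi * (norm (b g) * exp (- (2 * pi * y) * g))"
proof -
  have "exp (- (2 * pi * Im z) * g) \<le> exp (- (2 * pi * y) * g)"
    using assms P_pos[of g] by simp
  then show ?thesis
    unfolding norm_mult norm_wave by (simp add: norm_mult mult_left_mono)
qed

lemma wave_deriv: "((\<lambda>w. c * wave g w) has_field_derivative 2 * of_real pi * \<i> * of_real g * c * wave g w) (at w)"
  by (auto intro!: derivative_eq_intros)

lemma dirichlet_log_deriv:
  assumes z: "z \<in> upper"
  shows "(dirichlet_log has_field_derivative dirichlet z) (at z)"
proof -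
  note c = upper_cball[OF z]
  have "2 * pi * (Im z / 2) > 0" using c(1) by simp
  note M = weight[OF this]
  obtain D where D: "((\<lambda>w. \<Sum>\<^sub>\<infinity>g\<in>P. - (b g / of_real g) * wave g w) has_field_derivative D) (at z)"
    "((\<lambda>g. 2 * of_real pi * \<i> * of_real g * - (b g / of_real g) * wave g z) has_sum D) P"
    by (rule has_sum_has_field_derivative[OF c(1) wave_deriv log_term_le[OF _ c(2)] M])
  have "((\<lambda>g. - (2 * of_real pi * \<i> * b g) * wave g z) has_sum D) P"
    using D(2) by (rule has_sum_cong[THEN iffD1, rotated]) (use P_pos in \<open>force simp: mult_ac\<close>)
  then have "D = dirichlet z" unfolding dirichlet_def by (simp add: infsumI)
  with D(1) show ?thesis by (simp add: dirichlet_log_def [abs_def])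
qed

lemma dirichlet_deriv:
  assumes z: "z \<in> upper"
  shows "(dirichlet has_field_derivative - (\<Sum>\<^sub>\<infinity>n. 1 / (z - of_real (a n))\<^sup>2)) (at z)"
proof -
  note c = upper_cball[OF z]
  have "2 * pi * (Im z / 2) > 0" using c(1) by simp
  note M = summable_on_cmult_right[OF weight_mass[OF this], of "2 * pi"]
  obtain D where D: "((\<lambda>w. \<Sum>\<^sub>\<infinity>g\<in>P. - (2 * of_real pi * \<i> * b g) * wave g w) has_field_derivative D) (at z)"
    "((\<lambda>g. 2 * of_real pi * \<i> * of_real g * - (2 * of_real pi * \<i> * b g) * wave g z) has_sum D) P"
    by (rule has_sum_has_field_derivative[OF c(1) wave_deriv mass_term_le[OF _ c(2)] M])
  have "Im z > 0" using z by (simp add: upper_def)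
  from has_sum_cmult_right[OF formula[OF this], of "4 * of_real pi ^ 2"]
  have "((\<lambda>g. 2 * of_real pi * \<i> * of_real g * - (2 * of_real pi * \<i> * b g) * wave g z) has_sum
      - (\<Sum>\<^sub>\<infinity>n. 1 / (z - of_real (a n))\<^sup>2)) P"
    by (simp add: power2_eq_square mult_ac)
  with D(2) have "D = - (\<Sum>\<^sub>\<infinity>n. 1 / (z - of_real (a n))\<^sup>2)" by (rule has_sum_unique)
  with D(1) show ?thesis by (simp add: dirichlet_def [abs_def])
qed

subsection \<open>The Mittag-Leffler sum\<close>

text \<open>The terms \<open>1 / a\<^sub>n\<close> make the sum converge absolutely before anything is known about the
  symmetry of the points.\<close>

definition mittag_leffler :: "complex \<Rightarrow> complex" where
  "mittag_leffler z = (\<Sum>\<^sub>\<infinity>n. 1 / (z - of_real (a n)) + 1 / of_real (a n))"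

lemma mittag_leffler_bound:
  assumes "y > 0"
  obtains C where "\<forall>w n. y \<le> Im w \<longrightarrow> norm w \<le> W \<longrightarrow>
    norm (1 / (w - of_real (a n)) + 1 / of_real (a n)) \<le> C * (1 / (a n)\<^sup>2)"
proof (intro that allI impI)
  fix w n assume w: "y \<le> Im w" "norm w \<le> W"
  let ?A = "of_real (a n) :: complex"
  have "y \<le> norm (w - ?A)" using abs_Im_le_cmod[of "w - ?A"] w(1) by simp
  moreover have "\<bar>a n\<bar> - W \<le> norm (w - ?A)"
    using norm_triangle_ineq2[of ?A w] w(2) by (simp add: norm_minus_commute)
  ultimately have "\<bar>a n\<bar> \<le> norm (w - ?A) + W" "W * y \<le> W * norm (w - ?A)"
    using w(2) order.trans[OF norm_ge_zero w(2)] by (auto intro: mult_left_mono)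
  moreover from this(1) have "y * \<bar>a n\<bar> \<le> y * (norm (w - ?A) + W)"
    using assms by (intro mult_left_mono) auto
  ultimately have "\<bar>a n\<bar> \<le> (1 + W / y) * norm (w - ?A)"
    using assms by (simp add: field_simps)
  moreover have "w - ?A \<noteq> 0" using w(1) assms by (auto simp: complex_eq_iff)
  ultimately have *: "1 / norm (w - ?A) \<le> (1 + W / y) / \<bar>a n\<bar>"
    using nonzero[of n] by (simp add: field_simps)
  have "1 / (w - ?A) + 1 / ?A = w / ((w - ?A) * ?A)"
    using nonzero[of n] \<open>w - ?A \<noteq> 0\<close> by (simp add: field_simps)
  then have "norm (1 / (w - ?A) + 1 / ?A) = norm w * (1 / norm (w - ?A)) * (1 / \<bar>a n\<bar>)"
    by (simp add: norm_divide norm_mult)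
  also have "\<dots> \<le> W * ((1 + W / y) / \<bar>a n\<bar>) * (1 / \<bar>a n\<bar>)"
    using w(2) * order.trans[OF norm_ge_zero w(2)] assms by (intro mult_mono) auto
  also have "\<dots> = (W * (1 + W / y)) * (1 / (a n)\<^sup>2)"
    by (simp add: power2_eq_square flip: abs_mult)
  finally show "norm (1 / (w - ?A) + 1 / ?A) \<le> (W * (1 + W / y)) * (1 / (a n)\<^sup>2)" .
qed

lemma mittag_leffler_has_sum:
  assumes "z \<in> upper"
  shows "((\<lambda>n. 1 / (z - of_real (a n)) + 1 / of_real (a n)) has_sum mittag_leffler z) UNIV"
proof -
  have "Im z > 0" using assms by (simp add: upper_def)
  then obtain C where C: "\<forall>w n. Im z \<le> Im w \<longrightarrow> norm w \<le> norm z \<longrightarrow>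
    norm (1 / (w - of_real (a n)) + 1 / of_real (a n)) \<le> C * (1 / (a n)\<^sup>2)"
    by (rule mittag_leffler_bound)
  have "(\<lambda>n. norm (1 / (z - of_real (a n)) + 1 / of_real (a n))) summable_on UNIV"
    by (rule Infinite_Sum.abs_summable_on_comparison_test'[OF summable_on_cmult_right[OF inverse_square_summable, of C]])
      (rule C[rule_format, OF order_refl order_refl])
  then show ?thesis
    unfolding mittag_leffler_def by (rule has_sum_infsum[OF abs_summable_summable])
qed

lemma mittag_leffler_deriv:
  assumes z: "z \<in> upper"
  shows "(mittag_leffler has_field_derivative - (\<Sum>\<^sub>\<infinity>n. 1 / (z - of_real (a n))\<^sup>2)) (at z)"
proof -
  note c = upper_cball[OF z]
  obtain C where C: "\<forall>w n. Im z / 2 \<le> Im w \<longrightarrow> norm w \<le> norm z + Im z / 2 \<longrightarrow>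
    norm (1 / (w - of_real (a n)) + 1 / of_real (a n)) \<le> C * (1 / (a n)\<^sup>2)"
    by (rule mittag_leffler_bound[OF c(1)])
  have le: "norm (1 / (w - of_real (a n)) + 1 / of_real (a n)) \<le> C * (1 / (a n)\<^sup>2)"
    if "w \<in> cball z (Im z / 2)" for w n
  proof (rule C[rule_format, OF c(2)[OF that]])
    show "norm w \<le> norm z + Im z / 2"
      using that norm_triangle_ineq2[of w z] by (simp add: dist_norm norm_minus_commute)
  qed
  have der: "((\<lambda>w. 1 / (w - of_real (a n)) + 1 / of_real (a n)) has_field_derivative - (1 / (w - of_real (a n))\<^sup>2)) (at w)"
    if "w \<in> cball z (Im z / 2)" for w n
  proof -
    have "w - of_real (a n) \<noteq> 0" using c(1) c(2)[OF that] by (auto simp: complex_eq_iff)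
    then show ?thesis
      by (auto intro!: derivative_eq_intros simp: power2_eq_square)
  qed
  obtain D where D: "((\<lambda>w. \<Sum>\<^sub>\<infinity>n. 1 / (w - of_real (a n)) + 1 / of_real (a n)) has_field_derivative D) (at z)"
    "((\<lambda>n. - (1 / (z - of_real (a n))\<^sup>2)) has_sum D) UNIV"
    by (rule has_sum_has_field_derivative[OF c(1) der le
          summable_on_cmult_right[OF inverse_square_summable, of C]])
  have "D = - (\<Sum>\<^sub>\<infinity>n. 1 / (z - of_real (a n))\<^sup>2)"
    using infsumI[OF D(2)] by (simp add: infsum_uminus)
  with D(1) show ?thesis by (simp add: mittag_leffler_def [abs_def])
qed

text \<open>Both functions have the derivative \<open>-\<Sum> 1 / (z - a\<^sub>n)\<^sup>2\<close>.\<close>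

lemma mittag_leffler_eq:
  obtains C where "\<forall>z\<in>upper. mittag_leffler z = C + dirichlet z"
proof -
  have "((\<lambda>z. mittag_leffler z - dirichlet z) has_field_derivative 0) (at z within upper)"
    if "z \<in> upper" for z
    using DERIV_diff[OF mittag_leffler_deriv[OF that] dirichlet_deriv[OF that]]
    by (auto intro: has_field_derivative_at_within)
  from has_field_derivative_zero_constant[OF upper_convex_open(1) this]
  obtain C where "\<forall>z\<in>upper. mittag_leffler z - dirichlet z = C" by (rule exE)
  then have "\<forall>z\<in>upper. mittag_leffler z = C + dirichlet z"
    by (simp only: diff_eq_eq)
  then show ?thesis by (rule that)
qed

end

context spectral_zeros
begin

subsection \<open>Bounded discrepancy\<close>

lemma dirichlet_log_bounded:
  obtains e where "\<forall>z. 1 \<le> Im z \<longrightarrow> norm (dirichlet_log z) \<le> e"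
proof (intro that allI impI)
  fix z assume z: "1 \<le> Im z"
  have s: "(\<lambda>g. norm (b g) / g * exp (- (2 * pi * 1) * g)) summable_on P"
    by (rule weight) simp
  have le: "norm (- (b g / of_real g) * wave g z) \<le> norm (b g) / g * exp (- (2 * pi * 1) * g)" if "g \<in> P" for g
    by (rule log_term_le[OF that z])
  have "((\<lambda>g. - (b g / of_real g) * wave g z) has_sum dirichlet_log z) P"
    using z by (intro dirichlet_log_has_sum) (simp add: upper_def)
  then show "norm (dirichlet_log z) \<le> (\<Sum>\<^sub>\<infinity>g\<in>P. norm (b g) / g * exp (- (2 * pi * 1) * g))"
    by (rule norm_infsum_le[OF _ has_sum_infsum[OF s] le])
qed

text \<open>
  The sum of the step kernels grows like the imaginary part of an antiderivative of the
  Mittag-Leffler sum, i.e. linearly up to the bounded function \<open>dirichlet_log\<close>.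
\<close>

lemma step_kernel_sum:
  assumes C: "\<forall>z\<in>upper. mittag_leffler z = C + dirichlet z" and st: "s \<le> t"
    and summ: "(\<lambda>n. step_kernel (t - a n) - step_kernel (s - a n)) summable_on UNIV"
    and e: "\<forall>z. 1 \<le> Im z \<longrightarrow> norm (dirichlet_log z) \<le> e"
  shows "\<bar>(\<Sum>\<^sub>\<infinity>n. step_kernel (t - a n) - step_kernel (s - a n)) + Im C * (t - s)\<bar> \<le> 6 * e"
proof -
  define v :: "real \<Rightarrow> real" where "v u = 2 / (1 + u\<^sup>2) - 2 / (4 + u\<^sup>2)" for u
  define V where "V x = - 2 * Im (mittag_leffler (of_real x + \<i>)) + Im (mittag_leffler (of_real x + 2 * \<i>))" for x
  define G where "G x = - Im C * x - 2 * Im (dirichlet_log (of_real x + \<i>)) + Im (dirichlet_log (of_real x + 2 * \<i>))" for x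
  have pos: "0 < 1 + u\<^sup>2" "0 < 4 + u\<^sup>2" for u :: real
    by (simp_all add: add_pos_nonneg)
  have v_pos: "0 \<le> v u" for u
    using pos[of u] by (simp add: v_def field_simps)
  have v_cont: "continuous_on A (\<lambda>x. v (x - c))" for A c
    unfolding v_def using pos by (intro continuous_intros) (auto simp: less_imp_neq[symmetric])
  have up: "of_real x + \<i> \<in> upper" "of_real x + 2 * \<i> \<in> upper" for x
    by (auto simp: upper_def)
  have V_sum: "((\<lambda>n. v (x - a n)) has_sum V x) UNIV" for x
  proof -
    have "((\<lambda>n. - 2 * Im (1 / (of_real x + \<i> - of_real (a n)) + 1 / of_real (a n))
        + Im (1 / (of_real x + 2 * \<i> - of_real (a n)) + 1 / of_real (a n))) has_sum V x) UNIV"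
      unfolding V_def
      by (intro has_sum_add has_sum_cmult_right has_sum_Im mittag_leffler_has_sum up)
    moreover have "- 2 * Im (1 / (of_real x + \<i> - of_real (a n)) + 1 / of_real (a n))
        + Im (1 / (of_real x + 2 * \<i> - of_real (a n)) + 1 / of_real (a n)) = v (x - a n)" for n
    proof -
      have "Im (1 / (of_real (a n) :: complex)) = 0"
        by (simp add: Im_divide)
      then show ?thesis
        by (simp add: v_def Im_divide add.commute power2_eq_square)
    qed
    ultimately show ?thesis by simp
  qed
  have G_der: "(G has_real_derivative V x) (at x)" for x
  proof -
    have d: "((\<lambda>x. Im (dirichlet_log (of_real x + w))) has_real_derivative Im (dirichlet (of_real x + w))) (at x)"
      if "of_real x + w \<in> upper" for w
    proof -
      have "((\<lambda>z. dirichlet_log (z + w)) has_field_derivative dirichlet (of_real x + w)) (at (of_real x))"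
        using dirichlet_log_deriv[OF that] by (simp add: DERIV_shift)
      from bounded_linear.has_vector_derivative[OF bounded_linear_Im has_vector_derivative_real_field[OF this]]
      show ?thesis by (simp add: has_real_derivative_iff_has_vector_derivative)
    qed
    have "(G has_real_derivative - Im C - 2 * Im (dirichlet (of_real x + \<i>)) + Im (dirichlet (of_real x + 2 * \<i>))) (at x)"
    proof -
      have "((\<lambda>x. - Im C * x) has_real_derivative - Im C) (at x)"
        by (auto intro!: derivative_eq_intros)
      from DERIV_add[OF DERIV_diff[OF this DERIV_cmult[OF d[OF up(1)]]] d[OF up(2)]]
      show ?thesis unfolding G_def .
    qed
    moreover have "V x = - Im C - 2 * Im (dirichlet (of_real x + \<i>)) + Im (dirichlet (of_real x + 2 * \<i>))"
      using C up[of x] by (simp add: V_def)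
    ultimately show ?thesis by simp
  qed
  have V_cont: "continuous_on {s..t} V"
  proof -
    have "continuous_on upper mittag_leffler"
      by (intro continuous_at_imp_continuous_on ballI DERIV_isCont[OF mittag_leffler_deriv])
    then have "continuous_on {s..t} (\<lambda>x. mittag_leffler (of_real x + w))"
      if "\<And>x. of_real x + w \<in> upper" for w
      by (rule continuous_on_compose2) (use that in \<open>auto intro!: continuous_intros\<close>)
    then show ?thesis
      unfolding V_def using up by (intro continuous_intros) auto
  qed
  let ?D = "\<lambda>n. step_kernel (t - a n) - step_kernel (s - a n)"
  let ?f = "\<lambda>n x. complex_of_real (v (x - a n) * indicator {s..t} x)"
  have bi: "has_bochner_integral lborel (\<lambda>x. v (x - a n) * indicator {s..t} x) (?D n)" for n
  proof (rule has_bochner_integral_FTC_Icc_real[OF st])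
    show "((\<lambda>x. step_kernel (x - a n)) has_real_derivative v (x - a n)) (at x)" for x
      using DERIV_shift[of step_kernel "v (x - a n)" x "- a n"] step_kernel_deriv[of "x - a n"]
      by (simp add: v_def)
    show "isCont (\<lambda>x. v (x - a n)) x" for x
      using v_cont[of UNIV] by (simp add: continuous_on_eq_continuous_at)
  qed
  have int_f: "integrable lborel (?f n)" for n
    using bi[of n] by (intro integrable_of_real) (auto simp: has_bochner_integral_iff)
  have norm_f: "(\<integral>x. norm (?f n x) \<partial>lborel) = ?D n" for n
  proof -
    have "norm (?f n x) = v (x - a n) * indicator {s..t} x" for x
      by (simp only: norm_of_real abs_of_nonneg mult_nonneg_nonneg v_pos indicator_pos_le)
    then show ?thesis
      using bi[of n] by (simp only: has_bochner_integral_iff)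
  qed
  have val_f: "(\<integral>x. ?f n x \<partial>lborel) = of_real (?D n)" for n
    using bi[of n] by (simp only: integral_complex_of_real has_bochner_integral_iff)
  have hs_f: "((\<lambda>n. ?f n x) has_sum of_real (V x * indicator {s..t} x)) UNIV" for x
    by (intro has_sum_of_real has_sum_cmult_left V_sum)
  have sum_f: "(\<lambda>n. \<integral>x. norm (?f n x) \<partial>lborel) summable_on UNIV"
    unfolding norm_f by (rule summ)
  have "((\<lambda>n. of_real (?D n)) has_sum (\<integral>x. complex_of_real (V x * indicator {s..t} x) \<partial>lborel)) UNIV"
    using has_sum_integral(1)[of "UNIV :: int set", OF countableI_type int_f sum_f hs_f] unfolding val_f .
  moreover have "(\<integral>x. complex_of_real (V x * indicator {s..t} x) \<partial>lborel) = of_real (G t - G s)"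
  proof -
    have "has_bochner_integral lborel (\<lambda>x. indicator {s..t} x *\<^sub>R V x) (G t - G s)"
    proof (rule has_bochner_integral_FTC_Icc[OF st _ V_cont])
      show "(G has_vector_derivative V x) (at x within {s..t})" for x
        using G_der[of x] by (auto simp: has_real_derivative_iff_has_vector_derivative
            intro: has_vector_derivative_at_within)
    qed
    then show ?thesis
      by (simp only: integral_complex_of_real) (simp add: has_bochner_integral_iff mult.commute)
  qed
  ultimately have "((\<lambda>n. complex_of_real (?D n)) has_sum of_real (G t - G s)) UNIV" by simp
  then have "infsum ?D UNIV = G t - G s"
    by (simp only: has_sum_of_real_iff infsumI)
  moreover have "\<bar>Im (dirichlet_log (of_real x + \<i>))\<bar> \<le> e" "\<bar>Im (dirichlet_log (of_real x + 2 * \<i>))\<bar> \<le> e" for x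
    using e by (auto intro!: order.trans[OF abs_Im_le_cmod])
  from this[of s] this[of t] have "\<bar>G t - G s + Im C * (t - s)\<bar> \<le> 6 * e"
    unfolding G_def abs_le_iff by (simp add: algebra_simps)
  ultimately show ?thesis by simp
qed

text \<open>Differences of step kernels at \<open>a m\<close> and \<open>a k\<close> sum to \<open>\<pi>\<close> times the number of indices between
  \<open>k\<close> and \<open>m\<close>, up to errors that the bounded density controls; by the previous lemma
  they also sum to a multiple of \<open>a m - a k\<close>, up to a bounded error.\<close>

lemma discrepancy_bounded:
  assumes C: "\<forall>z\<in>upper. mittag_leffler z = C + dirichlet z"
  obtains K where "\<forall>k m. k \<le> m \<longrightarrow> \<bar>pi * of_int (m - k) + Im C * (a m - a k)\<bar> \<le> K"
proof -
  obtain e where e: "\<forall>z. 1 \<le> Im z \<longrightarrow> norm (dirichlet_log z) \<le> e"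
    by (rule dirichlet_log_bounded)
  obtain B where B: "\<forall>x F. finite F \<longrightarrow> (\<Sum>n\<in>F. 1 / (1 + (x - a n)\<^sup>2)) \<le> B"
    using density by (rule exE)
  have cB: "(\<Sum>\<^sub>\<infinity>n. 1 / (1 + (x - a n)\<^sup>2)) \<le> B" for x
    by (rule infsum_le_finite_sums[OF cauchy_summable]) (use B in auto)
  have "\<bar>pi * of_int (m - k) + Im C * (a m - a k)\<bar> \<le> 32 * B + 6 * e" if km: "k \<le> m" for k m
  proof -
    let ?D = "\<lambda>n. step_kernel (a m - a n) - step_kernel (a k - a n)"
    \<comment> \<open>Both one-sided estimates hold at \<open>0\<close>, so the indices may decide the sign of \<open>a j - a n\<close> even at ties.\<close>
    let ?\<sigma> = "\<lambda>j n. if n < j then pi / 2 else - (pi / 2)"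
    let ?c = "\<lambda>j n. 1 / (1 + (a j - a n)\<^sup>2)"
    let ?E = "\<lambda>j n. step_kernel (a j - a n) - ?\<sigma> j n"
    have E: "\<bar>?E j n\<bar> \<le> 16 * ?c j n" for j n
    proof (cases "n < j")
      case True
      then have "0 \<le> a j - a n" using mono_a[of n j] by simp
      from step_kernel_pos_limit[OF this] show ?thesis using True by simp
    next
      case False
      then have "a j - a n \<le> 0" using mono_a[of j n] by simp
      from step_kernel_neg_limit[OF this] show ?thesis using False by simp
    qed
    have c16: "(\<lambda>n. 16 * ?c j n) summable_on UNIV" for j
      by (rule summable_on_cmult_right[OF cauchy_summable])
    have Eabs: "(\<lambda>n. norm (?E j n)) summable_on UNIV" for j
      by (rule Infinite_Sum.abs_summable_on_comparison_test'[OF c16[of j]]) (use E[of j] in simp)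
    note Esum = abs_summable_summable[OF Eabs]
    have Ebound: "\<bar>\<Sum>\<^sub>\<infinity>n. ?E j n\<bar> \<le> 16 * B" for j
    proof -
      have "norm (\<Sum>\<^sub>\<infinity>n. ?E j n) \<le> (\<Sum>\<^sub>\<infinity>n. 16 * ?c j n)"
        by (rule norm_infsum_le[OF has_sum_infsum[OF Esum] has_sum_infsum[OF c16]]) (use E[of j] in simp)
      also have "\<dots> = 16 * (\<Sum>\<^sub>\<infinity>n. ?c j n)" by (rule infsum_cmult_right')
      also have "\<dots> \<le> 16 * B" using cB by simp
      finally show ?thesis by simp
    qed
    have "((\<lambda>n. if n \<in> {k..<m} then pi else 0) has_sum pi * of_int (m - k)) UNIV"
    proof -
      have "((\<lambda>n. pi) has_sum pi * of_int (m - k)) {k..<m}"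
        using km by (intro has_sum_finiteI) (auto simp: mult.commute)
      then show ?thesis
        by (rule has_sum_cong_neutral[THEN iffD1, rotated 3]) auto
    qed
    also have "(\<lambda>n. if n \<in> {k..<m} then pi else 0) = (\<lambda>n. ?\<sigma> m n - ?\<sigma> k n)"
      using km by (auto simp: fun_eq_iff)
    finally have \<sigma>sum: "((\<lambda>n. ?\<sigma> m n - ?\<sigma> k n) has_sum pi * of_int (m - k)) UNIV" .
    have "((\<lambda>n. (?E m n + - ?E k n) + (?\<sigma> m n - ?\<sigma> k n)) has_sum
        ((\<Sum>\<^sub>\<infinity>n. ?E m n) + - (\<Sum>\<^sub>\<infinity>n. ?E k n)) + pi * of_int (m - k)) UNIV"
      by (intro has_sum_add \<sigma>sum has_sum_infsum Esum) (simp only: has_sum_uminus minus_minus has_sum_infsum[OF Esum])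
    then have D: "(?D has_sum ((\<Sum>\<^sub>\<infinity>n. ?E m n) - (\<Sum>\<^sub>\<infinity>n. ?E k n)) + pi * of_int (m - k)) UNIV"
      by simp
    have "\<bar>(\<Sum>\<^sub>\<infinity>n. ?D n) + Im C * (a m - a k)\<bar> \<le> 6 * e"
      by (rule step_kernel_sum[OF C mono_a[OF km] has_sum_imp_summable[OF D] e])
    then show ?thesis
      unfolding infsumI[OF D] using Ebound[of m] Ebound[of k] by linarith
  qed
  then show ?thesis by (intro that allI impI)
qed

text \<open>If \<open>Im C\<close> vanished, the number of indices between \<open>0\<close> and \<open>m\<close> would be bounded. So the points
  follow an arithmetic progression with bounded error, in both directions from \<open>a 0\<close>.\<close>

lemma pair_sums_bounded:
  obtains K where "\<forall>n. \<bar>a n + a (- n)\<bar> \<le> K"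
proof -
  obtain C where C: "\<forall>z\<in>upper. mittag_leffler z = C + dirichlet z"
    by (rule mittag_leffler_eq)
  obtain K where K: "\<forall>k m. k \<le> m \<longrightarrow> \<bar>pi * of_int (m - k) + Im C * (a m - a k)\<bar> \<le> K"
    by (rule discrepancy_bounded[OF C])
  have C0: "Im C \<noteq> 0"
  proof
    assume "Im C = 0"
    then have piK: "pi * of_int m \<le> K" if "0 \<le> m" for m
      using K[rule_format, OF that] by simp
    define i where "i = max 0 \<lceil>K\<rceil> + 1"
    have i: "K < of_int i" "0 \<le> i" unfolding i_def by linarith+
    then have "1 * of_int i \<le> pi * real_of_int i"
      using pi_gt3 by (intro mult_right_mono) auto
    then show False using i(1) piK[OF i(2)] by simp
  qed
  have pos: "\<bar>a n + a (- n)\<bar> \<le> 2 * K / \<bar>Im C\<bar> + 2 * \<bar>a 0\<bar>" if "0 \<le> n" for n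
  proof -
    have "\<bar>pi * of_int n + Im C * (a n - a 0)\<bar> \<le> K" "\<bar>pi * of_int n + Im C * (a 0 - a (- n))\<bar> \<le> K"
      using K[rule_format, of 0 n] K[rule_format, of "- n" 0] that by auto
    then have "\<bar>Im C * (a n + a (- n) - 2 * a 0)\<bar> \<le> 2 * K"
      by (simp add: algebra_simps abs_le_iff)
    then have "\<bar>Im C\<bar> * \<bar>a n + a (- n) - 2 * a 0\<bar> \<le> 2 * K"
      by (simp only: abs_mult)
    then have "\<bar>a n + a (- n) - 2 * a 0\<bar> \<le> 2 * K / \<bar>Im C\<bar>"
      using C0 by (metis pos_le_divide_eq zero_less_abs_iff mult.commute)
    then show ?thesis by linarith
  qed
  have "\<bar>a n + a (- n)\<bar> \<le> 2 * K / \<bar>Im C\<bar> + 2 * \<bar>a 0\<bar>" for n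
    using pos[of n] pos[of "- n"] by (cases "0 \<le> n") (auto simp: add.commute)
  then show ?thesis by (intro that allI)
qed

end

lemma int_decode_odd: "int_decode (2 * N + 1) = - int (Suc N)"
  by (simp add: int_decode_def sum_decode_def)

lemma int_decode_even: "int_decode (2 * N) = int N"
  by (simp add: int_decode_def sum_decode_def)

lemma weierstrass_factor_1_alt: "weierstrass_factor (Suc 0) w = (1 - w) * exp w"
  by (simp add: weierstrass_factor_def)

context spectral_zeros
begin

subsection \<open>The symmetric product\<close>

definition pair_bound :: "nat \<Rightarrow> real" where
  "pair_bound k = 1 / (\<bar>a (int (Suc k))\<bar> * \<bar>a (- int (Suc k))\<bar>)"

definition pair_sum :: "nat \<Rightarrow> complex" where
  "pair_sum k = 1 / of_real (a (int (Suc k))) + 1 / of_real (a (- int (Suc k)))"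

definition inverse_sum :: complex where
  "inverse_sum = 1 / of_real (a 0) + (\<Sum>k. pair_sum k)"

lemma pair_bound_nonneg: "0 \<le> pair_bound k"
  by (simp add: pair_bound_def)

lemma pair_bound_summable: "pair_bound summable_on UNIV"
proof (rule summable_on_comparison_test)
  have "(\<lambda>k. 1 / (a (h k))\<^sup>2) summable_on UNIV" if "inj h" for h :: "nat \<Rightarrow> int"
  proof -
    have "(\<lambda>n. 1 / (a n)\<^sup>2) summable_on range h"
      by (rule summable_on_subset_banach[OF inverse_square_summable]) auto
    then show ?thesis
      using summable_on_reindex[OF that, of "\<lambda>n. 1 / (a n)\<^sup>2"] by (simp add: o_def)
  qed
  from this[of "\<lambda>k. int (Suc k)"] this[of "\<lambda>k. - int (Suc k)"]
  show "(\<lambda>k. 1 / (a (int (Suc k)))\<^sup>2 + 1 / (a (- int (Suc k)))\<^sup>2) summable_on UNIV"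
    by (intro summable_on_add) (auto simp: inj_def)
  fix k
  define x where "x = 1 / \<bar>a (int (Suc k))\<bar>"
  define y where "y = 1 / \<bar>a (- int (Suc k))\<bar>"
  have "0 \<le> (x - y)\<^sup>2" "0 \<le> x * y" by (simp_all add: x_def y_def)
  then have "x * y \<le> x\<^sup>2 + y\<^sup>2" by (simp add: power2_eq_square algebra_simps)
  then show "pair_bound k \<le> 1 / (a (int (Suc k)))\<^sup>2 + 1 / (a (- int (Suc k)))\<^sup>2"
    by (simp add: x_def y_def pair_bound_def power_divide)
qed (rule pair_bound_nonneg)

lemma pair_sum_le:
  assumes K: "\<forall>n. \<bar>a n + a (- n)\<bar> \<le> K"
  shows "norm (pair_sum k) \<le> K * pair_bound k"
proof -
  let ?p = "a (int (Suc k))" and ?q = "a (- int (Suc k))"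
  have "pair_sum k = of_real ((?p + ?q) / (?p * ?q))"
    using nonzero by (simp add: pair_sum_def field_simps)
  then have "norm (pair_sum k) = \<bar>?p + ?q\<bar> * pair_bound k"
    by (simp add: pair_bound_def abs_mult del: of_real_divide of_real_mult of_real_add)
  also have "\<dots> \<le> K * pair_bound k"
    using K[rule_format, of "int (Suc k)"] by (intro mult_right_mono pair_bound_nonneg) auto
  finally show ?thesis .
qed

lemma pair_sum_sums: "pair_sum sums (\<Sum>k. pair_sum k)"
proof -
  obtain K where K: "\<forall>n. \<bar>a n + a (- n)\<bar> \<le> K" by (rule pair_sums_bounded)
  have "summable (\<lambda>k. K * pair_bound k)"
    by (intro summable_mult summable_on_imp_summable pair_bound_summable)
  then have "summable pair_sum"
    by (rule summable_comparison_test_ev[rotated]) (use pair_sum_le[OF K] in simp)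
  then show ?thesis by (rule summable_sums)
qed

lemma symmetric_factor_convergent: "convergent_prod (\<lambda>k. symmetric_factor a z (Suc k))"
proof -
  obtain K where K: "\<forall>n. \<bar>a n + a (- n)\<bar> \<le> K" by (rule pair_sums_bounded)
  have le: "norm (symmetric_factor a z (Suc k) - 1) \<le> (norm z * K + norm z ^ 2) * pair_bound k" for k
  proof -
    let ?p = "of_real (a (int (Suc k))) :: complex" and ?q = "of_real (a (- int (Suc k))) :: complex"
    have "symmetric_factor a z (Suc k) - 1 = z\<^sup>2 / (?p * ?q) - z * pair_sum k"
      by (simp add: symmetric_factor_def pair_sum_def power2_eq_square algebra_simps)
    also have "norm \<dots> \<le> norm (z\<^sup>2 / (?p * ?q)) + norm (z * pair_sum k)"
      by (rule norm_triangle_ineq4)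
    also have "norm (z\<^sup>2 / (?p * ?q)) = norm z ^ 2 * pair_bound k"
      by (simp add: norm_divide norm_mult norm_power pair_bound_def)
    also have "norm (z * pair_sum k) \<le> norm z * (K * pair_bound k)"
      unfolding norm_mult by (rule mult_left_mono[OF pair_sum_le[OF K] norm_ge_zero])
    finally show ?thesis by (simp add: algebra_simps)
  qed
  have "summable (\<lambda>k. (norm z * K + norm z ^ 2) * pair_bound k)"
    by (rule summable_mult[OF summable_on_imp_summable[OF pair_bound_summable]])
  then have "summable (\<lambda>k. norm (symmetric_factor a z (Suc k) - 1))"
    by (rule summable_comparison_test'[where N = 0]) (use le in simp)
  then show ?thesis
    by (rule abs_convergent_prod_imp_convergent_prod[OF abs_convergent_prod_conv_summable[THEN iffD2]])
qed

text \<open>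
  Enumerating the integers as \<open>0, -1, 1, -2, 2, \<dots>\<close> makes every other partial product of the
  Weierstrass product of genus one a symmetric partial product times an exponential, and the
  exponents converge because \<open>a n + a (- n)\<close> is bounded.
\<close>

definition zero_seq :: "nat \<Rightarrow> complex" where
  "zero_seq n = of_real (a (int_decode n))"

lemma zero_seq_square_summable: "(\<lambda>n. 1 / (a (int_decode n))\<^sup>2) summable_on UNIV"
  using inverse_square_summable summable_on_reindex_bij_betw[OF bij_int_decode, of "\<lambda>n. 1 / (a n)\<^sup>2"]
  by simp

sublocale W: weierstrass_product zero_seq "\<lambda>_. Suc 0"
proof
  note sm = summable_on_imp_summable[OF zero_seq_square_summable]
  show "zero_seq n \<noteq> 0" for n using nonzero by (simp add: zero_seq_def)
  have "filterlim (\<lambda>n. inverse (1 / (a (int_decode n))\<^sup>2)) at_top sequentially"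
    using nonzero by (intro filterlim_inverse_at_top summable_LIMSEQ_zero[OF sm]) auto
  from filterlim_compose[OF sqrt_at_top this]
  have "filterlim (\<lambda>n. norm (zero_seq n)) at_top sequentially"
    by (simp add: zero_seq_def inverse_eq_divide)
  then show "filterlim zero_seq at_infinity sequentially"
    by (simp add: filterlim_at_infinity_conv_norm_at_top)
  show "summable (\<lambda>n. (r / norm (zero_seq n)) ^ Suc (Suc 0))" if "r > 0" for r
    using summable_mult[OF sm, of "r\<^sup>2"]
    by (simp add: zero_seq_def power_divide power2_eq_square)
qed

lemma weierstrass_partial_product:
  "(\<Prod>n<2 * N + 1. weierstrass_factor (Suc 0) (z / zero_seq n))
    = exp (z * (1 / of_real (a 0) + (\<Sum>k<N. pair_sum k))) *
      ((1 - z / of_real (a 0)) * (\<Prod>k<N. symmetric_factor a z (Suc k)))"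
proof (induction N)
  case 0
  show ?case
    using int_decode_even[of 0] by (simp add: weierstrass_factor_1_alt zero_seq_def)
next
  case (Suc N)
  have e: "2 * Suc N + 1 = Suc (Suc (2 * N + 1))" "Suc (2 * N + 1) = 2 * Suc N" by simp_all
  have "(\<Prod>n<2 * Suc N + 1. weierstrass_factor (Suc 0) (z / zero_seq n))
      = (\<Prod>n<2 * N + 1. weierstrass_factor (Suc 0) (z / zero_seq n))
        * weierstrass_factor (Suc 0) (z / zero_seq (2 * N + 1)) * weierstrass_factor (Suc 0) (z / zero_seq (2 * Suc N))"
    unfolding e(1) prod.lessThan_Suc unfolding e(2) ..
  also have "\<dots> = exp (z * (1 / of_real (a 0) + (\<Sum>k<Suc N. pair_sum k))) *
      ((1 - z / of_real (a 0)) * (\<Prod>k<Suc N. symmetric_factor a z (Suc k)))"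
  proof -
    have "exp (z * s) * (c * r) * ((1 - z / q) * exp (z / q)) * ((1 - z / p) * exp (z / p))
        = exp (z * (s + (1 / p + 1 / q))) * (c * (r * ((1 - z / p) * (1 - z / q))))" for s c r p q :: complex
      by (simp add: exp_add distrib_left mult_ac)
    note gen = this[of "1 / of_real (a 0) + (\<Sum>k<N. pair_sum k)"]
    show ?thesis
      unfolding Suc.IH
      unfolding zero_seq_def int_decode_odd int_decode_even weierstrass_factor_1_alt
        sum.lessThan_Suc prod.lessThan_Suc gen
      by (simp only: symmetric_factor_def pair_sum_def add.assoc)
  qed
  finally show ?case .
qed

lemma partial_product_tendsto:
  "(\<lambda>N. (1 - z / of_real (a 0)) * (\<Prod>k<N. symmetric_factor a z (Suc k))) \<longlonglongrightarrow> zero_product a z"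
proof -
  have "(\<lambda>n. \<Prod>k\<le>n. symmetric_factor a z (Suc k)) \<longlonglongrightarrow> (\<Prod>k. symmetric_factor a z (Suc k))"
    by (rule convergent_prod_LIMSEQ[OF symmetric_factor_convergent])
  then have "(\<lambda>N. \<Prod>k<N. symmetric_factor a z (Suc k)) \<longlonglongrightarrow> (\<Prod>k. symmetric_factor a z (Suc k))"
    by (simp add: LIMSEQ_lessThan_iff_atMost)
  then show ?thesis
    unfolding zero_product_def by (intro tendsto_intros)
qed

lemma weierstrass_eq: "W.f z = exp (z * inverse_sum) * zero_product a z"
proof (rule LIMSEQ_unique)
  have "(\<lambda>n. \<Prod>i\<le>n. weierstrass_factor (Suc 0) (z / zero_seq i)) \<longlonglongrightarrow> W.f z"
    unfolding W.f_def by (rule convergent_prod_LIMSEQ[OF W.convergent])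
  then have "(\<lambda>N. \<Prod>i\<le>2 * N. weierstrass_factor (Suc 0) (z / zero_seq i)) \<longlonglongrightarrow> W.f z"
    by (rule filterlim_compose) (rule filterlim_subseq, auto simp: strict_mono_def)
  then show "(\<lambda>N. \<Prod>n<2 * N + 1. weierstrass_factor (Suc 0) (z / zero_seq n)) \<longlonglongrightarrow> W.f z"
    by (simp add: lessThan_Suc_atMost)
  have "(\<lambda>N. \<Sum>k<N. pair_sum k) \<longlonglongrightarrow> (\<Sum>k. pair_sum k)"
    using pair_sum_sums by (simp add: sums_def)
  then show "(\<lambda>N. \<Prod>n<2 * N + 1. weierstrass_factor (Suc 0) (z / zero_seq n))
      \<longlonglongrightarrow> exp (z * inverse_sum) * zero_product a z"
    unfolding weierstrass_partial_product inverse_sum_def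
    by (intro tendsto_intros partial_product_tendsto)
qed

lemma zero_product_eq: "zero_product a = (\<lambda>z. exp (- (z * inverse_sum)) * W.f z)"
  by (simp add: fun_eq_iff weierstrass_eq exp_minus)

lemma zero_product_holomorphic: "zero_product a holomorphic_on UNIV"
  unfolding zero_product_eq by (intro holomorphic_intros W.holomorphic)

lemma zero_product_eq_0_iff: "zero_product a z = 0 \<longleftrightarrow> z \<in> of_real ` range a"
proof -
  have "range zero_seq = of_real ` range a"
    unfolding zero_seq_def using surj_int_decode by (auto simp: image_iff) (metis surjD)
  then show ?thesis
    by (simp add: zero_product_eq W.zero)
qed

lemma zero_product_zorder: "zorder (zero_product a) (of_real l) = int (card {n. a n = l})"
proof -
  have "zorder (zero_product a) (of_real l)
      = zorder (\<lambda>z. exp (- (z * inverse_sum))) (of_real l) + zorder W.f (of_real l)"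
    unfolding zero_product_eq
  proof (rule zorder_times_analytic)
    show "\<forall>\<^sub>F z in at (of_real l). exp (- (z * inverse_sum)) * W.f z \<noteq> 0"
      using W.not_islimpt_range_a[of "of_real l"]
      by (auto simp: islimpt_conv_frequently_at frequently_def W.zero)
  qed (auto intro!: analytic_intros W.analytic)
  also have "zorder (\<lambda>z. exp (- (z * inverse_sum))) (of_real l) = 0"
    by (intro zorder_eq_0I analytic_intros) auto
  also have "zorder W.f (of_real l) = int (card (zero_seq -` {of_real l}))"
    by (rule W.zorder)
  also have "zero_seq -` {of_real l} = int_decode -` {n. a n = l}"
    by (auto simp: zero_seq_def)
  also have "card (int_decode -` {n. a n = l}) = card {n. a n = l}"
    using surj_int_decode by (intro card_vimage_inj inj_int_decode) auto
  finally show ?thesis by simp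
qed

subsection \<open>The logarithmic derivative\<close>

lemma zero_seq_mittag_leffler:
  assumes "z \<in> upper"
  shows "(\<lambda>n. 1 / (z - zero_seq n) + 1 / zero_seq n) sums mittag_leffler z"
  unfolding zero_seq_def
  using mittag_leffler_has_sum[OF assms]
    has_sum_reindex_bij_betw[OF bij_int_decode, of "\<lambda>n. 1 / (z - of_real (a n)) + 1 / of_real (a n)"]
  by (intro has_sum_imp_sums) simp

lemma upper_nonzero: "z \<in> upper \<Longrightarrow> zero_product a z \<noteq> 0" "z \<in> upper \<Longrightarrow> z - of_real t \<noteq> 0"
  by (auto simp: zero_product_eq_0_iff upper_def)

lemma zero_product_deriv:
  assumes z: "z \<in> upper"
  shows "(zero_product a has_field_derivative zero_product a z * (mittag_leffler z - inverse_sum)) (at z)"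
proof -
  have Wz: "W.f z \<noteq> 0"
    using upper_nonzero(1)[OF z] by (simp add: zero_product_eq)
  define R where "R = norm z + 1"
  have R: "R > 0" "z \<in> ball 0 R" by (simp_all add: R_def add_nonneg_pos)
  have ul: "uniform_limit (ball 0 R) (\<lambda>N z. \<Prod>n<N. weierstrass_factor (Suc 0) (z / zero_seq n)) W.f sequentially"
    by (rule uniform_limit_on_subset[OF W.uniform_limit[OF R(1)]]) auto
  have holo: "(\<lambda>z. weierstrass_factor (Suc 0) (z / zero_seq k)) holomorphic_on ball 0 R" for k
    using W.a_nonzero by (intro holomorphic_intros) auto
  have log_term: "deriv (\<lambda>z. weierstrass_factor (Suc 0) (z / zero_seq k)) z / weierstrass_factor (Suc 0) (z / zero_seq k)
      = 1 / (z - zero_seq k) + 1 / zero_seq k" for k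
  proof -
    let ?w = "zero_seq k"
    have nz: "?w \<noteq> 0" "z - ?w \<noteq> 0"
      using W.a_nonzero upper_nonzero(2)[OF z] by (auto simp: zero_seq_def)
    have "((\<lambda>z. weierstrass_factor (Suc 0) (z / ?w)) has_field_derivative
        (- 1 / ?w) * exp (z / ?w) + (1 - z / ?w) * (exp (z / ?w) * (1 / ?w))) (at z)"
      unfolding weierstrass_factor_1_alt using nz by (auto intro!: derivative_eq_intros)
    then have "deriv (\<lambda>z. weierstrass_factor (Suc 0) (z / ?w)) z
        = (- 1 / ?w) * exp (z / ?w) + (1 - z / ?w) * (exp (z / ?w) * (1 / ?w))"
      by (rule DERIV_imp_deriv)
    also have "\<dots> = weierstrass_factor (Suc 0) (z / ?w) * (1 / (z - ?w) + 1 / ?w)"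
      using nz by (simp add: weierstrass_factor_1_alt field_simps)
    finally have "deriv (\<lambda>z. weierstrass_factor (Suc 0) (z / ?w)) z
        = weierstrass_factor (Suc 0) (z / ?w) * (1 / (z - ?w) + 1 / ?w)" .
    moreover have "weierstrass_factor (Suc 0) (z / ?w) \<noteq> 0"
      using nz by (simp add: field_simps)
    ultimately show ?thesis by simp
  qed
  have "(\<lambda>k. deriv (\<lambda>z. weierstrass_factor (Suc 0) (z / zero_seq k)) z / weierstrass_factor (Suc 0) (z / zero_seq k))
      sums (deriv W.f z / W.f z)"
    by (rule logderiv_prodinf_complex_uniform_limit[OF ul holo Wz open_ball R(2)])
  then have "(\<lambda>k. 1 / (z - zero_seq k) + 1 / zero_seq k) sums (deriv W.f z / W.f z)"
    unfolding log_term .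
  then have "deriv W.f z / W.f z = mittag_leffler z"
    using zero_seq_mittag_leffler[OF z] by (rule sums_unique2)
  then have "deriv W.f z = mittag_leffler z * W.f z"
    using Wz by (simp add: field_simps)
  then have "(W.f has_field_derivative mittag_leffler z * W.f z) (at z)"
    using holomorphic_derivI[OF W.holomorphic[of UNIV] open_UNIV, of z] by simp
  then show ?thesis
    unfolding zero_product_eq by (auto intro!: derivative_eq_intros simp: algebra_simps)
qed

lemma paired_mittag_leffler:
  assumes z: "z \<in> upper"
  shows "(\<lambda>k. 1 / (z - of_real (a (int (Suc k)))) + 1 / (z - of_real (a (- int (Suc k)))))
    sums (mittag_leffler z - inverse_sum - 1 / (z - of_real (a 0)))"
  (is "?\<tau> sums _")
proof -
  let ?h = "\<lambda>n. 1 / (z - zero_seq n) + 1 / zero_seq n"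
  have part: "(\<Sum>n<2 * N + 1. ?h n)
      = 1 / (z - of_real (a 0)) + (1 / of_real (a 0) + (\<Sum>k<N. pair_sum k)) + (\<Sum>k<N. ?\<tau> k)" for N
  proof (induction N)
    case 0
    show ?case using int_decode_even[of 0] by (simp add: zero_seq_def)
  next
    case (Suc N)
    have e: "2 * Suc N + 1 = Suc (Suc (2 * N + 1))" "Suc (2 * N + 1) = 2 * Suc N" by simp_all
    have "(\<Sum>n<2 * Suc N + 1. ?h n) = (\<Sum>n<2 * N + 1. ?h n) + ?h (2 * N + 1) + ?h (2 * Suc N)"
      unfolding e(1) sum.lessThan_Suc unfolding e(2) ..
    then show ?case
      unfolding Suc.IH
      unfolding zero_seq_def int_decode_odd int_decode_even sum.lessThan_Suc pair_sum_def
      by (simp only: add_ac)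
  qed
  have "(\<lambda>N. \<Sum>n<N. ?h n) \<longlonglongrightarrow> mittag_leffler z"
    using zero_seq_mittag_leffler[OF z] by (simp add: sums_def)
  then have "(\<lambda>N. \<Sum>n<2 * N + 1. ?h n) \<longlonglongrightarrow> mittag_leffler z"
    by (rule filterlim_compose) (rule filterlim_subseq, auto simp: strict_mono_def)
  moreover have "(\<lambda>N. \<Sum>k<N. pair_sum k) \<longlonglongrightarrow> (\<Sum>k. pair_sum k)"
    using pair_sum_sums by (simp add: sums_def)
  ultimately have "(\<lambda>N. (\<Sum>n<2 * N + 1. ?h n) - (1 / of_real (a 0) + (\<Sum>k<N. pair_sum k)) - 1 / (z - of_real (a 0)))
      \<longlonglongrightarrow> mittag_leffler z - (1 / of_real (a 0) + (\<Sum>k. pair_sum k)) - 1 / (z - of_real (a 0))"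
    by (intro tendsto_intros)
  then show ?thesis
    unfolding part sums_def inverse_sum_def by (simp add: algebra_simps)
qed

text \<open>
  High up on the imaginary axis the logarithmic derivative of the symmetric product has small
  real part: the odd function \<open>p / (y\<^sup>2 + p\<^sup>2)\<close> nearly cancels on the pairs \<open>a n, a (- n)\<close>.
\<close>

lemma Re_logarithmic_derivative_limit:
  "(\<lambda>j. Re (mittag_leffler (\<i> * of_nat (Suc j)) - inverse_sum)) \<longlonglongrightarrow> 0"
proof -
  obtain K where K: "\<forall>n. \<bar>a n + a (- n)\<bar> \<le> K" by (rule pair_sums_bounded)
  let ?z = "\<lambda>j. \<i> * of_nat (Suc j) :: complex"
  have up: "?z j \<in> upper" for j by (simp add: upper_def)
  define r where "r y p = - p / (y\<^sup>2 + p\<^sup>2)" for y p :: real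
  have Re_r: "Re (1 / (?z j - of_real p)) = r (real (Suc j)) p" for j p
    by (simp add: Re_divide r_def power2_eq_square add.commute)
  have r_lim: "(\<lambda>j. r (real (Suc j)) p) \<longlonglongrightarrow> 0" for p
  proof -
    have "filterlim (\<lambda>j. p\<^sup>2 + (real (Suc j))\<^sup>2) at_top sequentially"
      by (intro filterlim_tendsto_add_at_top[OF tendsto_const] filterlim_pow_at_top
          filterlim_compose[OF filterlim_real_sequentially filterlim_Suc]) auto
    from tendsto_divide_0[OF tendsto_const[of "- p"] filterlim_at_top_imp_at_infinity[OF this]]
    show ?thesis by (simp add: r_def add.commute)
  qed
  let ?f = "\<lambda>j k. r (real (Suc j)) (a (int (Suc k))) + r (real (Suc j)) (a (- int (Suc k)))"
  have le: "norm (?f j k) \<le> K * pair_bound k" for j k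
  proof -
    define y p q where "y = real (Suc j)" and "p = a (int (Suc k))" and "q = a (- int (Suc k))"
    have pq: "p \<noteq> 0" "q \<noteq> 0" "y > 0" "\<bar>p + q\<bar> \<le> K"
      using nonzero K[rule_format, of "int (Suc k)"] by (simp_all add: p_def q_def y_def)
    have den: "0 < y\<^sup>2 + p\<^sup>2" "0 < y\<^sup>2 + q\<^sup>2" using pq by (simp_all add: add_pos_nonneg)
    have "r y p + r y q = - ((p + q) * (y\<^sup>2 + p * q) / ((y\<^sup>2 + p\<^sup>2) * (y\<^sup>2 + q\<^sup>2)))"
    proof -
      have comb: "- p / A + - q / B = - ((p * B + q * A) / (A * B))" if "A > 0" "B > 0" for A B :: real
        using that by (simp add: field_simps)
      have "p * (y\<^sup>2 + q\<^sup>2) + q * (y\<^sup>2 + p\<^sup>2) = (p + q) * (y\<^sup>2 + p * q)"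
        by (simp add: algebra_simps power2_eq_square)
      then show ?thesis unfolding r_def comb[OF den] by simp
    qed
    then have "\<bar>r y p + r y q\<bar> = \<bar>p + q\<bar> * (\<bar>y\<^sup>2 + p * q\<bar> / ((y\<^sup>2 + p\<^sup>2) * (y\<^sup>2 + q\<^sup>2)))"
      using den by (simp add: abs_mult)
    also have "\<dots> \<le> K * (1 / (\<bar>p\<bar> * \<bar>q\<bar>))"
    proof (rule mult_mono)
      have "\<bar>y\<^sup>2 + p * q\<bar> * (\<bar>p\<bar> * \<bar>q\<bar>) \<le> (y\<^sup>2 + \<bar>p\<bar> * \<bar>q\<bar>) * (\<bar>p\<bar> * \<bar>q\<bar>)"
        using abs_triangle_ineq[of "y\<^sup>2" "p * q"] by (intro mult_right_mono) (auto simp: abs_mult)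
      also have "\<dots> \<le> (y\<^sup>2 + p\<^sup>2) * (y\<^sup>2 + q\<^sup>2)"
      proof -
        have "\<bar>p\<bar> * \<bar>q\<bar> \<le> p\<^sup>2 + q\<^sup>2"
        proof -
          have "2 * (\<bar>p\<bar> * \<bar>q\<bar>) \<le> p\<^sup>2 + q\<^sup>2"
            using zero_le_power2[of "\<bar>p\<bar> - \<bar>q\<bar>"] by (simp add: power2_eq_square algebra_simps)
          moreover have "0 \<le> \<bar>p\<bar> * \<bar>q\<bar>" by simp
          ultimately show ?thesis by linarith
        qed
        then have "y\<^sup>2 * (\<bar>p\<bar> * \<bar>q\<bar>) \<le> y\<^sup>2 * (p\<^sup>2 + q\<^sup>2)" by (rule mult_left_mono) simp
        moreover have "(\<bar>p\<bar> * \<bar>q\<bar>) * (\<bar>p\<bar> * \<bar>q\<bar>) = p\<^sup>2 * q\<^sup>2"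
          by (simp add: power2_eq_square mult_ac flip: abs_mult)
        moreover have "0 \<le> y\<^sup>2 * y\<^sup>2" by simp
        ultimately show ?thesis
          using mult.commute[of "p\<^sup>2" "y\<^sup>2"] unfolding distrib_right distrib_left by linarith
      qed
      finally show "\<bar>y\<^sup>2 + p * q\<bar> / ((y\<^sup>2 + p\<^sup>2) * (y\<^sup>2 + q\<^sup>2)) \<le> 1 / (\<bar>p\<bar> * \<bar>q\<bar>)"
        using den pq by (simp add: divide_simps mult.commute)
    qed (use pq den in auto)
    finally show ?thesis by (simp add: y_def p_def q_def pair_bound_def)
  qed
  have hs: "(?f j has_sum Re (mittag_leffler (?z j) - inverse_sum - 1 / (?z j - of_real (a 0)))) UNIV" for j
  proof (rule norm_summable_imp_has_sum)
    have "summable (\<lambda>k. K * pair_bound k)"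
      by (intro summable_mult summable_on_imp_summable pair_bound_summable)
    then show "summable (\<lambda>k. norm (?f j k))"
      by (rule summable_comparison_test_ev[rotated]) (use le in simp)
    show "?f j sums Re (mittag_leffler (?z j) - inverse_sum - 1 / (?z j - of_real (a 0)))"
      using sums_Re[OF paired_mittag_leffler[OF up[of j]]] by (simp only: plus_complex.sel Re_r)
  qed
  have f_lim: "(\<lambda>j. ?f j k) \<longlonglongrightarrow> 0" for k
    using tendsto_add[OF r_lim r_lim] by simp
  have "(\<lambda>j. Re (mittag_leffler (?z j) - inverse_sum - 1 / (?z j - of_real (a 0)))) \<longlonglongrightarrow> infsum (\<lambda>k. 0) (UNIV :: nat set)"
    by (rule has_sum_dominated_convergence(1)[OF hs f_lim le summable_on_cmult_right[OF pair_bound_summable] sequentially_bot])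
  from tendsto_add[OF this r_lim[of "a 0"]] show ?thesis
    by (simp only: minus_complex.sel Re_r) simp
qed

lemma dirichlet_limit: "(\<lambda>j. dirichlet (\<i> * of_nat (Suc j))) \<longlonglongrightarrow> 0"
proof -
  let ?z = "\<lambda>j. \<i> * of_nat (Suc j) :: complex"
  let ?f = "\<lambda>j g. - (2 * of_real pi * \<i> * b g) * wave g (?z j)"
  have "(\<lambda>g. norm (b g) * exp (- (2 * pi * 1) * g)) summable_on P"
    by (rule weight_mass) simp
  note M = summable_on_cmult_right[OF this, of "2 * pi"]
  have le: "norm (?f j g) \<le> 2 * pi * (norm (b g) * exp (- (2 * pi * 1) * g))" if "g \<in> P" for j g
    by (rule mass_term_le[OF that]) simp
  have hs: "(?f j has_sum dirichlet (?z j)) P" for j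
    unfolding dirichlet_def
    by (rule has_sum_infsum[OF abs_summable_summable[OF Infinite_Sum.abs_summable_on_comparison_test'[OF M le]]])
  have lim: "(\<lambda>j. ?f j g) \<longlonglongrightarrow> 0" if "g \<in> P" for g
  proof (rule tendsto_norm_zero_cancel)
    have "filterlim (\<lambda>j. (2 * pi * g) * real (Suc j)) at_top sequentially"
      using P_pos[OF that]
      by (intro filterlim_tendsto_pos_mult_at_top[OF tendsto_const]
          filterlim_compose[OF filterlim_real_sequentially filterlim_Suc]) simp
    then have "(\<lambda>j. exp (- ((2 * pi * g) * real (Suc j)))) \<longlonglongrightarrow> 0"
      by (intro filterlim_compose[OF exp_at_bot]) (simp add: filterlim_uminus_at_bot)
    then have "(\<lambda>j. norm (2 * of_real pi * \<i> * b g) * exp (- ((2 * pi * g) * real (Suc j)))) \<longlonglongrightarrow> norm (2 * of_real pi * \<i> * b g) * 0"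
      by (intro tendsto_intros)
    then show "(\<lambda>j. norm (?f j g)) \<longlonglongrightarrow> 0"
      by (simp add: norm_mult mult_ac)
  qed
  have "(\<lambda>j. dirichlet (?z j)) \<longlonglongrightarrow> infsum (\<lambda>g. 0) P"
    by (rule has_sum_dominated_convergence(1)[OF hs lim le M sequentially_bot])
  then show ?thesis by simp
qed

text \<open>The logarithmic derivative is \<open>c + dirichlet z\<close> with a constant \<open>c\<close>. Both \<open>dirichlet\<close> and the real
  part of the logarithmic derivative tend to \<open>0\<close> along the imaginary axis, so \<open>c\<close> is purely imaginary
  and \<open>exp (c * z)\<close> is a wave.\<close>

theorem zero_product_upper:
  obtains \<alpha> :: real and \<kappa> :: complex where "\<kappa> \<noteq> 0"
    "\<forall>z\<in>upper. zero_product a z = \<kappa> * exp (2 * of_real pi * \<i> * of_real \<alpha> * z + dirichlet_log z)"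
proof -
  obtain C where C: "\<forall>z\<in>upper. mittag_leffler z = C + dirichlet z"
    by (rule mittag_leffler_eq)
  define c where "c = C - inverse_sum"
  have "Re c = 0"
  proof (rule LIMSEQ_unique[OF tendsto_const])
    have "(\<lambda>j. Re (mittag_leffler (\<i> * of_nat (Suc j)) - inverse_sum) - Re (dirichlet (\<i> * of_nat (Suc j)))) \<longlonglongrightarrow> 0 - Re 0"
      by (intro tendsto_diff tendsto_Re Re_logarithmic_derivative_limit dirichlet_limit)
    moreover have "\<i> * of_nat (Suc j) \<in> upper" for j
      by (simp add: upper_def)
    ultimately show "(\<lambda>j :: nat. Re c) \<longlonglongrightarrow> 0"
      using C by (simp add: c_def)
  qed
  define \<alpha> where "\<alpha> = Im c / (2 * pi)"
  have c: "c = 2 * of_real pi * \<i> * of_real \<alpha>"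
    using \<open>Re c = 0\<close> by (simp add: \<alpha>_def complex_eq_iff)
  let ?e = "\<lambda>z. exp (- (c * z + dirichlet_log z))"
  have "((\<lambda>z. zero_product a z * ?e z) has_field_derivative 0) (at z within upper)" if z: "z \<in> upper" for z
  proof -
    have d: "(zero_product a has_field_derivative zero_product a z * (c + dirichlet z)) (at z)"
      using zero_product_deriv[OF z] C z by (simp add: c_def algebra_simps)
    have "((\<lambda>z. zero_product a z * ?e z) has_field_derivative 0) (at z)"
      by (auto intro!: derivative_eq_intros d dirichlet_log_deriv z simp: algebra_simps)
    then show ?thesis by (rule has_field_derivative_at_within)
  qed
  from has_field_derivative_zero_constant[OF upper_convex_open(1) this]
  obtain \<kappa> where k: "\<forall>z\<in>upper. zero_product a z * ?e z = \<kappa>" by (rule exE)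
  have i: "\<i> \<in> upper" by (simp add: upper_def)
  have k0: "\<kappa> \<noteq> 0" using k[rule_format, OF i] upper_nonzero(1)[OF i] by auto
  have cancel: "w * exp (- x) = k \<Longrightarrow> w = k * exp x" for w x k :: complex
    by (auto simp: exp_minus field_simps)
  have eq: "\<forall>z\<in>upper. zero_product a z = \<kappa> * exp (c * z + dirichlet_log z)"
  proof
    fix z assume "z \<in> upper"
    from k[rule_format, OF this] show "zero_product a z = \<kappa> * exp (c * z + dirichlet_log z)"
      by (rule cancel)
  qed
  from k0 eq[unfolded c] show ?thesis by (rule that)
qed

end

section \<open>Absolutely convergent exponential sums\<close>

subsection \<open>The exponential of a sum\<close>

definition lists_of_length :: "'i set \<Rightarrow> nat \<Rightarrow> 'i list set" where
  "lists_of_length I k = {l \<in> lists I. length l = k}"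

lemma lists_of_length_0: "lists_of_length I 0 = {[]}"
  by (auto simp: lists_of_length_def)

lemma bij_betw_lists_Suc:
  "bij_betw (\<lambda>p. fst p # snd p) (I \<times> lists_of_length I k) (lists_of_length I (Suc k))"
  by (rule bij_betw_byWitness[where f' = "\<lambda>l. (hd l, tl l)"])
    (auto simp: lists_of_length_def length_Suc_conv)

lemma bij_betw_lists: "bij_betw (\<lambda>l. (length l, l)) (lists I) (Sigma UNIV (lists_of_length I))"
  by (rule bij_betw_byWitness[where f' = snd]) (auto simp: lists_of_length_def)

lemma prod_list_nonneg:
  fixes x :: "'i \<Rightarrow> real"
  assumes "\<And>i. i \<in> I \<Longrightarrow> 0 \<le> x i" "l \<in> lists I"
  shows "0 \<le> prod_list (map x l)"
  using assms(2) by (induction l) (auto simp: assms(1))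

lemma norm_prod_list_map:
  fixes x :: "'i \<Rightarrow> complex"
  shows "norm (prod_list (map x l)) = prod_list (map (\<lambda>i. norm (x i)) l)"
  by (induction l) (auto simp: norm_mult)

lemma has_sum_power_lists_real:
  fixes x :: "'i \<Rightarrow> real"
  assumes nn: "\<And>i. i \<in> I \<Longrightarrow> 0 \<le> x i" and x: "(x has_sum S) I"
  shows "((\<lambda>l. prod_list (map x l)) has_sum S ^ k) (lists_of_length I k)"
proof (induction k)
  case 0
  show ?case by (simp add: lists_of_length_0 has_sum_finiteI)
next
  case (Suc k)
  let ?f = "\<lambda>p. x (fst p) * prod_list (map x (snd p))"
  have in1: "((\<lambda>l. ?f (i, l)) has_sum x i * S ^ k) (lists_of_length I k)" for i
    using has_sum_cmult_right[OF Suc] by simp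
  have out: "((\<lambda>i. x i * S ^ k) has_sum S * S ^ k) I"
    by (rule has_sum_cmult_left[OF x])
  have "?f summable_on (Sigma I (\<lambda>_. lists_of_length I k))"
  proof (rule summable_on_SigmaI[OF in1 has_sum_imp_summable[OF out]])
    show "0 \<le> ?f (i, l)" if "i \<in> I" "l \<in> lists_of_length I k" for i l
      using that nn by (auto simp: lists_of_length_def intro!: mult_nonneg_nonneg prod_list_nonneg[of I])
  qed
  from has_sum_SigmaI[OF in1 out this]
  have "((\<lambda>p. prod_list (map x (fst p # snd p))) has_sum S ^ Suc k) (I \<times> lists_of_length I k)"
    by simp
  then show ?case
    using has_sum_reindex_bij_betw[OF bij_betw_lists_Suc, of "\<lambda>l. prod_list (map x l)"] by blast
qed

lemma has_sum_power_lists: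
  fixes x :: "'i \<Rightarrow> complex"
  assumes x: "(x has_sum S) I"
  shows "((\<lambda>l. prod_list (map x l)) has_sum S ^ k) (lists_of_length I k)"
proof (induction k)
  case 0
  show ?case by (simp add: lists_of_length_0 has_sum_finiteI)
next
  case (Suc k)
  have "(\<lambda>i. norm (x i)) summable_on I"
    using has_sum_imp_summable[OF x] by (simp only: summable_on_iff_abs_summable_on_complex)
  from has_sum_power_lists_real[OF norm_ge_zero has_sum_infsum[OF this], of "Suc k"]
  have "(\<lambda>l. norm (prod_list (map x l))) summable_on lists_of_length I (Suc k)"
    unfolding norm_prod_list_map by (rule has_sum_imp_summable)
  then have "(\<lambda>l. prod_list (map x l)) summable_on lists_of_length I (Suc k)"
    by (rule abs_summable_summable)
  then have s: "(\<lambda>p. prod_list (map x (fst p # snd p))) summable_on (I \<times> lists_of_length I k)"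
    using summable_on_reindex_bij_betw[OF bij_betw_lists_Suc, of "\<lambda>l. prod_list (map x l)"] by blast
  let ?f = "\<lambda>p. x (fst p) * prod_list (map x (snd p))"
  have in1: "((\<lambda>l. ?f (i, l)) has_sum x i * S ^ k) (lists_of_length I k)" for i
    using has_sum_cmult_right[OF Suc] by simp
  have out: "((\<lambda>i. x i * S ^ k) has_sum S * S ^ k) I"
    by (rule has_sum_cmult_left[OF x])
  have "?f summable_on (Sigma I (\<lambda>_. lists_of_length I k))" using s by simp
  from has_sum_SigmaI[OF in1 out this]
  have "((\<lambda>p. prod_list (map x (fst p # snd p))) has_sum S ^ Suc k) (I \<times> lists_of_length I k)"
    by simp
  then show ?case
    using has_sum_reindex_bij_betw[OF bij_betw_lists_Suc, of "\<lambda>l. prod_list (map x l)"] by blast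
qed

text \<open>Expanding each power in the exponential series multinomially indexes the sum by finite lists.\<close>

lemma has_sum_exp_lists:
  fixes x :: "'i \<Rightarrow> complex"
  assumes x: "(x has_sum S) I"
  shows "((\<lambda>l. prod_list (map x l) / fact (length l)) has_sum exp S) (lists I)"
proof -
  have nx: "(\<lambda>i. norm (x i)) summable_on I"
    using has_sum_imp_summable[OF x] by (simp only: summable_on_iff_abs_summable_on_complex)
  define N where "N = (\<Sum>\<^sub>\<infinity>i\<in>I. norm (x i))"
  let ?f = "\<lambda>p. prod_list (map x (snd p)) / fact (fst p)"
  let ?g = "\<lambda>p. prod_list (map (\<lambda>i. norm (x i)) (snd p)) / fact (fst p)"
  have g_in: "((\<lambda>l. ?g (k, l)) has_sum N ^ k / fact k) (lists_of_length I k)" for k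
    using has_sum_divide_const[OF has_sum_power_lists_real[OF norm_ge_zero has_sum_infsum[OF nx], of k], of "fact k"]
    by (simp add: N_def)
  have "((\<lambda>k. N ^ k / fact k) has_sum exp N) UNIV"
  proof (rule norm_summable_imp_has_sum)
    show "summable (\<lambda>k. norm (N ^ k / fact k))"
      using summable_norm_exp[of N] by (simp add: field_simps)
    show "(\<lambda>k. N ^ k / fact k) sums exp N"
      using exp_converges[of N] by (simp add: field_simps)
  qed
  then have "?g summable_on Sigma UNIV (lists_of_length I)"
    by (intro summable_on_SigmaI[OF g_in has_sum_imp_summable])
      (auto intro!: divide_nonneg_nonneg prod_list_nonneg[of UNIV])
  then have "(\<lambda>p. norm (?f p)) summable_on Sigma UNIV (lists_of_length I)"
    by (simp add: norm_divide norm_prod_list_map)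
  then have f_sum: "?f summable_on Sigma UNIV (lists_of_length I)"
    by (rule abs_summable_summable)
  have f_in: "((\<lambda>l. ?f (k, l)) has_sum S ^ k / fact k) (lists_of_length I k)" for k
    using has_sum_divide_const[OF has_sum_power_lists[OF x, of k], of "fact k"] by simp
  have "((\<lambda>k. S ^ k / fact k) has_sum exp S) UNIV"
  proof (rule norm_summable_imp_has_sum)
    show "summable (\<lambda>k. norm (S ^ k / fact k))"
      using summable_norm_exp[of S] by (simp add: field_simps scaleR_conv_of_real)
    show "(\<lambda>k. S ^ k / fact k) sums exp S"
      using exp_converges[of S] by (simp add: field_simps scaleR_conv_of_real)
  qed
  from has_sum_SigmaI[OF f_in this f_sum]
  have "(?f has_sum exp S) (Sigma UNIV (lists_of_length I))" .
  then show ?thesis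
    using has_sum_reindex_bij_betw[OF bij_betw_lists, of ?f] by simp
qed

subsection \<open>Fourier--Bohr coefficients\<close>

lemma wave_mult: "wave u z * wave v z = wave (u + v) z"
  by (simp add: algebra_simps flip: exp_add)

lemma wave_add: "wave u (z + w) = wave u z * wave u w"
  by (simp add: algebra_simps flip: exp_add)

lemma wave_mean:
  assumes "T > 0"
  shows "integrable lborel (\<lambda>x. indicator {-T..T} x *\<^sub>R wave \<delta> (of_real x))"
    and "\<delta> = 0 \<Longrightarrow> (\<integral>x. indicator {-T..T} x *\<^sub>R wave \<delta> (of_real x) \<partial>lborel) = of_real (2 * T)"
    and "\<delta> \<noteq> 0 \<Longrightarrow> norm (\<integral>x. indicator {-T..T} x *\<^sub>R wave \<delta> (of_real x) \<partial>lborel) \<le> 1 / (pi * \<bar>\<delta>\<bar>)"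
proof -
  show "integrable lborel (\<lambda>x. indicator {-T..T} x *\<^sub>R wave \<delta> (of_real x))"
    by (rule borel_integrable_compact) (auto intro!: continuous_intros)
next
  assume "\<delta> = 0"
  then show "(\<integral>x. indicator {-T..T} x *\<^sub>R wave \<delta> (of_real x) \<partial>lborel) = of_real (2 * T)"
    using assms by (simp add: scaleR_conv_of_real)
next
  assume \<delta>: "\<delta> \<noteq> 0"
  let ?c = "2 * of_real pi * \<i> * of_real \<delta> :: complex"
  have c: "?c \<noteq> 0" using \<delta> by simp
  let ?W = "wave \<delta> (of_real T) / ?c - wave \<delta> (of_real (- T)) / ?c"
  have "(\<integral>x. indicator {-T..T} x *\<^sub>R wave \<delta> (of_real x) \<partial>lborel) = ?W"
  proof (rule integral_FTC_Icc)
    fix x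
    have "((\<lambda>z. wave \<delta> z / ?c) has_field_derivative wave \<delta> (of_real x)) (at (of_real x))"
      using c by (auto intro!: derivative_eq_intros)
    from has_vector_derivative_real_field[OF this]
    show "((\<lambda>x. wave \<delta> (of_real x) / ?c) has_vector_derivative wave \<delta> (of_real x)) (at x within {-T..T})"
      by (rule has_vector_derivative_at_within)
  qed (use assms in \<open>auto intro!: continuous_intros\<close>)
  moreover have n: "norm (wave \<delta> (of_real t) / ?c) = 1 / (2 * pi * \<bar>\<delta>\<bar>)" for t
    by (simp add: norm_divide norm_mult)
  have "norm ?W \<le> 1 / (2 * pi * \<bar>\<delta>\<bar>) + 1 / (2 * pi * \<bar>\<delta>\<bar>)"
    using norm_triangle_ineq4[of "wave \<delta> (of_real T) / ?c" "wave \<delta> (of_real (- T)) / ?c"]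
    unfolding n .
  moreover have "1 / (2 * pi * \<bar>\<delta>\<bar>) + 1 / (2 * pi * \<bar>\<delta>\<bar>) = 1 / (pi * \<bar>\<delta>\<bar>)"
    by simp
  ultimately show "norm (\<integral>x. indicator {-T..T} x *\<^sub>R wave \<delta> (of_real x) \<partial>lborel) \<le> 1 / (pi * \<bar>\<delta>\<bar>)"
    by (simp only:)
qed

text \<open>Every wave other than \<open>wave \<theta>\<close> has mean value \<open>0\<close> after division by \<open>wave \<theta>\<close>; the means are bounded
  by \<open>1\<close>, so they may be summed.\<close>

lemma fourier_bohr_coefficient:
  fixes c :: "real \<Rightarrow> complex"
  assumes F: "\<And>x. ((\<lambda>w. c w * wave w (of_real x)) has_sum F x) UNIV"
  shows "(\<lambda>j. (\<integral>x. indicator {- real (Suc j)..real (Suc j)} x *\<^sub>R (F x * wave (- \<theta>) (of_real x)) \<partial>lborel)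
    / of_real (2 * real (Suc j))) \<longlonglongrightarrow> c \<theta>"
proof -
  have "((\<lambda>w. c w) has_sum F 0) UNIV" using F[of 0] by simp
  then have c: "(\<lambda>w. norm (c w)) summable_on UNIV"
    using has_sum_imp_summable by (simp flip: summable_on_iff_abs_summable_on_complex) blast
  define I where "I = {w. c w \<noteq> 0}"
  have I: "countable I" using abs_summable_countable[OF c] by (simp add: I_def)
  define T where "T j = real (Suc j)" for j
  have T: "T j > 0" for j by (simp add: T_def)
  define W where "W j w = (\<integral>x. indicator {-T j..T j} x *\<^sub>R wave (w - \<theta>) (of_real x) \<partial>lborel)" for j w
  have W1: "integrable lborel (\<lambda>x. indicator {-T j..T j} x *\<^sub>R wave (w - \<theta>) (of_real x))" for j w
    by (rule wave_mean(1)[OF T])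
  have W2: "W j \<theta> = of_real (2 * T j)" for j
    unfolding W_def by (rule wave_mean(2)[OF T]) simp
  have W3: "norm (W j w) \<le> 1 / (pi * \<bar>w - \<theta>\<bar>)" if "w \<noteq> \<theta>" for j w
    unfolding W_def by (rule wave_mean(3)[OF T]) (use that in simp)
  have norm_int: "(\<integral>x. norm (indicator {-T j..T j} x *\<^sub>R wave (w - \<theta>) (of_real x)) \<partial>lborel) = 2 * T j" for j w
  proof -
    have "norm (indicator {-T j..T j} x *\<^sub>R wave (w - \<theta>) (of_real x)) = indicator {-T j..T j} x" for x
      by (simp add: indicator_def)
    then show ?thesis using T[of j] by simp
  qed
  let ?f = "\<lambda>j w x. c w * (indicator {-T j..T j} x *\<^sub>R wave (w - \<theta>) (of_real x))"
  let ?S = "\<lambda>j x. indicator {-T j..T j} x *\<^sub>R (F x * wave (- \<theta>) (of_real x))"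
  have int: "integrable lborel (?f j w)" for j w
    by (rule integrable_mult_right[OF W1])
  have val: "(\<integral>x. ?f j w x \<partial>lborel) = c w * W j w" for j w
    by (simp only: integral_mult_right_zero W_def)
  have nval: "(\<integral>x. norm (?f j w x) \<partial>lborel) = norm (c w) * (2 * T j)" for j w
    by (simp only: norm_mult[of "c w"] integral_mult_right_zero norm_int)
  have Wle: "norm (W j w) \<le> 2 * T j" for j w
    using integral_norm_bound[of lborel "\<lambda>x. indicator {-T j..T j} x *\<^sub>R wave (w - \<theta>) (of_real x)"]
    by (simp only: norm_int W_def)
  have hs: "((\<lambda>w. ?f j w x) has_sum ?S j x) I" for j x
  proof -
    have "((\<lambda>w. (c w * wave w (of_real x)) * (of_real (indicator {-T j..T j} x) * wave (- \<theta>) (of_real x))) has_sum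
        F x * (of_real (indicator {-T j..T j} x) * wave (- \<theta>) (of_real x))) UNIV"
      by (rule has_sum_cmult_left[OF F])
    moreover have "(c w * wave w (of_real x)) * (of_real (indicator {-T j..T j} x) * wave (- \<theta>) (of_real x)) = ?f j w x" for w
      using wave_mult[of w "of_real x" "- \<theta>"] by (simp add: scaleR_conv_of_real mult_ac)
    moreover have "F x * (of_real (indicator {-T j..T j} x) * wave (- \<theta>) (of_real x)) = ?S j x"
      by (simp add: scaleR_conv_of_real mult_ac)
    ultimately have "((\<lambda>w. ?f j w x) has_sum ?S j x) UNIV" by simp
    then show ?thesis
      by (rule has_sum_cong_neutral[THEN iffD1, rotated 3]) (auto simp: I_def)
  qed
  have cI: "(\<lambda>w. norm (c w)) summable_on I"
    by (rule summable_on_subset_banach[OF c]) simp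
  have sum: "(\<lambda>w. \<integral>x. norm (?f j w x) \<partial>lborel) summable_on I" for j
    unfolding nval by (rule summable_on_cmult_left[OF cI])
  have "((\<lambda>w. c w * W j w) has_sum (\<integral>x. ?S j x \<partial>lborel)) I" for j
    using has_sum_integral(1)[OF I int sum hs, of j] unfolding val .
  from has_sum_divide_const[OF this]
  have means: "((\<lambda>w. c w * W j w / of_real (2 * T j)) has_sum (\<integral>x. ?S j x \<partial>lborel) / of_real (2 * T j)) I" for j .
  have lim: "(\<lambda>j. c w * W j w / of_real (2 * T j)) \<longlonglongrightarrow> (if w = \<theta> then c w else 0)" for w
  proof (cases "w = \<theta>")
    case True
    then have "c w * W j w / of_real (2 * T j) = c w" for j
      using T[of j] by (simp add: W2)
    then show ?thesis using True by simp
  next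
    case False
    have "(\<lambda>j. norm (c w) * (1 / (pi * \<bar>w - \<theta>\<bar>)) / 2 * (1 / T j)) \<longlonglongrightarrow> norm (c w) * (1 / (pi * \<bar>w - \<theta>\<bar>)) / 2 * 0"
      unfolding T_def by (intro tendsto_intros lim_1_over_n[THEN LIMSEQ_Suc])
    then have null: "(\<lambda>j. norm (c w) * (1 / (pi * \<bar>w - \<theta>\<bar>)) / 2 * (1 / T j)) \<longlonglongrightarrow> 0"
      by (simp only: mult_zero_right)
    have "norm (c w * W j w / of_real (2 * T j)) \<le> norm (c w) * (1 / (pi * \<bar>w - \<theta>\<bar>)) / 2 * (1 / T j)" for j
    proof -
      have "norm (c w * W j w / of_real (2 * T j)) = norm (c w) * norm (W j w) / 2 * (1 / T j)"
        using T[of j] by (simp add: norm_mult norm_divide)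
      also have "\<dots> \<le> norm (c w) * (1 / (pi * \<bar>w - \<theta>\<bar>)) / 2 * (1 / T j)"
        using T[of j] W3[OF False, of j] by (intro mult_right_mono divide_right_mono mult_left_mono) auto
      finally show ?thesis .
    qed
    from Lim_null_comparison[OF always_eventually[OF allI[OF this]] null]
    show ?thesis using False by simp
  qed
  have le: "norm (c w * W j w / of_real (2 * T j)) \<le> norm (c w)" for j w
  proof -
    have "norm (c w * W j w / of_real (2 * T j)) = norm (c w) * (norm (W j w) / (2 * T j))"
      using T[of j] by (simp add: norm_mult norm_divide)
    also have "\<dots> \<le> norm (c w) * 1"
      using T[of j] Wle[of j w] by (intro mult_left_mono) auto
    finally show ?thesis by simp
  qed
  have "(\<lambda>j. (\<integral>x. ?S j x \<partial>lborel) / of_real (2 * T j)) \<longlonglongrightarrow> infsum (\<lambda>w. if w = \<theta> then c w else 0) I"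
    by (rule has_sum_dominated_convergence(1)[OF means lim le cI sequentially_bot])
  also have "infsum (\<lambda>w. if w = \<theta> then c w else 0) I = infsum c {\<theta>}"
    by (rule infsum_cong_neutral) (auto simp: I_def)
  finally show ?thesis by (simp only: T_def infsum_finite[OF finite.insertI[OF finite.emptyI]]) simp
qed

section \<open>The exponential sum\<close>

context spectral_zeros
begin

subsection \<open>Expansion in the upper half plane\<close>

lemma prod_list_wave:
  "prod_list (map (\<lambda>g. c g * wave g z) l) = prod_list (map c l) * wave (sum_list l) z"
proof (induction l)
  case (Cons g l)
  have "prod_list (map (\<lambda>g. c g * wave g z) (g # l))
      = (c g * wave g z) * (prod_list (map c l) * wave (sum_list l) z)"
    by (simp only: list.simps prod_list.Cons Cons.IH)
  also have "\<dots> = c g * prod_list (map c l) * (wave g z * wave (sum_list l) z)"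
    by (simp only: mult_ac)
  finally show ?case
    unfolding wave_mult by simp
qed simp

lemma sum_list_pos:
  assumes "l \<in> lists P"
  shows "0 \<le> sum_list l" "sum_list l = 0 \<longleftrightarrow> l = []"
proof -
  have nn: "0 \<le> sum_list l" if "l \<in> lists P" for l
    using that by (intro sum_list_nonneg) (auto dest: P_pos less_imp_le)
  then show "0 \<le> sum_list l" using assms by blast
  show "sum_list l = 0 \<longleftrightarrow> l = []"
  proof (cases l)
    case (Cons g k)
    then have "0 < g" "0 \<le> sum_list k" using assms P_pos nn by auto
    then show ?thesis using Cons by simp
  qed simp
qed

text \<open>The terms of the expanded exponential are indexed by lists of frequencies and collected by the sum
  of the list. Only the empty list has sum \<open>0\<close>, so the lowest coefficient is \<open>\<kappa>\<close> and cannot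
  cancel.\<close>

lemma upper_expansion:
  obtains q :: "real \<Rightarrow> complex" and \<alpha> :: real where
    "q \<alpha> \<noteq> 0" "\<forall>w<\<alpha>. q w = 0"
    "\<forall>z\<in>upper. ((\<lambda>w. q w * wave w z) has_sum zero_product a z) UNIV"
proof -
  obtain \<alpha> \<kappa> where k: "\<kappa> \<noteq> 0"
    and f: "\<forall>z\<in>upper. zero_product a z = \<kappa> * exp (2 * of_real pi * \<i> * of_real \<alpha> * z + dirichlet_log z)"
    by (rule zero_product_upper)
  define coef where "coef l = \<kappa> * (prod_list (map (\<lambda>g. - (b g / of_real g)) l) / fact (length l))" for l
  let ?L = "\<lambda>w. {l \<in> lists P. \<alpha> + sum_list l = w}"
  define q where "q w = (\<Sum>\<^sub>\<infinity>l\<in>?L w. coef l)" for w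
  have lists: "((\<lambda>l. coef l * wave (\<alpha> + sum_list l) z) has_sum zero_product a z) (lists P)"
    if z: "z \<in> upper" for z
  proof -
    from has_sum_cmult_right[OF has_sum_exp_lists[OF dirichlet_log_has_sum[OF z]], of "\<kappa> * wave \<alpha> z"]
    have "((\<lambda>l. \<kappa> * wave \<alpha> z * (prod_list (map (\<lambda>g. - (b g / of_real g) * wave g z) l) / fact (length l))) has_sum
        \<kappa> * wave \<alpha> z * exp (dirichlet_log z)) (lists P)" .
    moreover have "\<kappa> * wave \<alpha> z * (prod_list (map (\<lambda>g. - (b g / of_real g) * wave g z) l) / fact (length l))
        = coef l * wave (\<alpha> + sum_list l) z" for l
      unfolding prod_list_wave wave_mult[symmetric] coef_def by simp
    moreover have "\<kappa> * wave \<alpha> z * exp (dirichlet_log z) = zero_product a z"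
      using f z by (simp add: exp_add)
    ultimately show ?thesis by (simp only:)
  qed
  have i: "\<i> \<in> upper" by (simp add: upper_def)
  have coef_sum: "coef summable_on ?L w" for w
  proof -
    have "(\<lambda>l. coef l * wave (\<alpha> + sum_list l) \<i>) summable_on ?L w"
      by (rule summable_on_subset_banach[OF has_sum_imp_summable[OF lists[OF i]]]) auto
    then have "(\<lambda>l. coef l * wave w \<i>) summable_on ?L w"
      by (rule summable_on_cong[THEN iffD1, rotated]) auto
    from summable_on_cmult_left[OF this, of "inverse (wave w \<i>)"]
    show ?thesis by (simp add: mult.assoc)
  qed
  have inner: "((\<lambda>l. coef (snd (w, l)) * wave (fst (w, l)) z) has_sum q w * wave w z) (?L w)" for w z
    using has_sum_cmult_left[OF has_sum_infsum[OF coef_sum]] by (simp add: q_def)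
  have bij: "bij_betw (\<lambda>l. (\<alpha> + sum_list l, l)) (lists P) (Sigma UNIV ?L)"
    by (rule bij_betw_byWitness[where f' = snd]) auto
  have exp: "((\<lambda>w. q w * wave w z) has_sum zero_product a z) UNIV" if z: "z \<in> upper" for z
  proof (rule has_sum_SigmaD[OF _ inner])
    show "((\<lambda>p. coef (snd p) * wave (fst p) z) has_sum zero_product a z) (Sigma UNIV ?L)"
      using lists[OF z] has_sum_reindex_bij_betw[OF bij, of "\<lambda>p. coef (snd p) * wave (fst p) z"]
      by simp
  qed
  have empty: "?L w = {}" if "w < \<alpha>" for w
    using that sum_list_pos(1) by force
  have below: "q w = 0" if "w < \<alpha>" for w
    unfolding q_def empty[OF that] by simp
  have "?L \<alpha> = {[]}"
    using sum_list_pos(2) by auto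
  then have "q \<alpha> = \<kappa>" by (simp add: q_def coef_def)
  then show ?thesis
    using k below exp by (intro that[of q \<alpha>]) auto
qed

subsection \<open>Reality of the zeros\<close>

lemma zero_product_cnj: "zero_product a (cnj z) = cnj (zero_product a z)"
proof (rule LIMSEQ_unique[OF partial_product_tendsto])
  have "(\<lambda>N. cnj ((1 - z / of_real (a 0)) * (\<Prod>k<N. symmetric_factor a z (Suc k)))) \<longlonglongrightarrow> cnj (zero_product a z)"
    by (intro tendsto_cnj partial_product_tendsto)
  then show "(\<lambda>N. (1 - cnj z / of_real (a 0)) * (\<Prod>k<N. symmetric_factor a (cnj z) (Suc k)))
      \<longlonglongrightarrow> cnj (zero_product a z)"
    by (simp add: symmetric_factor_def)
qed

text \<open>For a real zero \<open>t\<close> the factor \<open>\<bar>1 - (x + iy) / t\<bar>\<close> increases with \<open>\<bar>y\<bar>\<close>.\<close>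

lemma zero_product_mono:
  assumes "\<bar>Im z\<bar> \<le> 1"
  shows "norm (zero_product a z) \<le> norm (zero_product a (of_real (Re z) + \<i>))"
proof -
  let ?w = "of_real (Re z) + \<i>"
  have fac: "norm (1 - z / of_real t) \<le> norm (1 - ?w / of_real t)" for t :: real
  proof -
    have "(Im z / t)\<^sup>2 \<le> (1 / t)\<^sup>2"
      using assms abs_square_le_1[of "Im z"] by (simp add: power_divide divide_right_mono)
    then have "(1 - Re z / t)\<^sup>2 + (Im z / t)\<^sup>2 \<le> (1 - Re z / t)\<^sup>2 + (1 / t)\<^sup>2" by simp
    then show ?thesis by (simp add: cmod_def)
  qed
  have "norm ((1 - z / of_real (a 0)) * (\<Prod>k<N. symmetric_factor a z (Suc k)))
      \<le> norm ((1 - ?w / of_real (a 0)) * (\<Prod>k<N. symmetric_factor a ?w (Suc k)))" for N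
    unfolding norm_mult prod_norm[symmetric] symmetric_factor_def
    by (intro mult_mono prod_mono conjI fac prod_nonneg) (auto simp: norm_mult intro!: mult_mono fac)
  then show ?thesis
    by (intro LIMSEQ_le[OF tendsto_norm[OF partial_product_tendsto] tendsto_norm[OF partial_product_tendsto]]) auto
qed

subsection \<open>Both half planes have the same spectrum\<close>

lemma lower_expansion:
  assumes up: "\<forall>z\<in>upper. ((\<lambda>w. q w * wave w z) has_sum zero_product a z) UNIV"
    and z: "Im z < 0"
  shows "((\<lambda>w. cnj (q (- w)) * wave w z) has_sum zero_product a z) UNIV"
proof -
  have "cnj z \<in> upper" using z by (simp add: upper_def)
  with up have "((\<lambda>w. q w * wave w (cnj z)) has_sum cnj (zero_product a z)) UNIV"
    by (simp flip: zero_product_cnj)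
  then have "((\<lambda>w. cnj (q w * wave w (cnj z))) has_sum cnj (cnj (zero_product a z))) UNIV"
    by (simp only: has_sum_cnj_iff)
  moreover have "cnj (q w * wave w (cnj z)) = cnj (q w) * wave (- w) z" for w
    by (simp add: exp_cnj)
  ultimately have "((\<lambda>w. cnj (q w) * wave (- w) z) has_sum zero_product a z) UNIV"
    by (simp only: complex_cnj_cnj)
  moreover have "bij_betw uminus (UNIV :: real set) UNIV"
    by (rule bij_betw_byWitness[where f' = uminus]) auto
  ultimately show ?thesis
    using has_sum_reindex_bij_betw[of uminus "UNIV :: real set" UNIV "\<lambda>w. cnj (q w) * wave (- w) z"] by simp
qed

text \<open>
  The Fourier--Bohr coefficients of \<open>f\<close> on the lines \<open>Im z = \<plusminus>1\<close> agree: the difference of the two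
  integrals over \<open>[-T, T]\<close> is, by an antiderivative, a contribution of two vertical segments,
  and stays bounded because \<open>f\<close> is bounded on the strip between the lines.
\<close>

lemma coefficients_symmetric:
  assumes up: "\<forall>z\<in>upper. ((\<lambda>w. q w * wave w z) has_sum zero_product a z) UNIV"
  shows "q \<theta> = cnj (q (- \<theta>))"
proof -
  define h where "h z = zero_product a z * wave (- \<theta>) z" for z
  let ?M = "\<lambda>w j. (\<integral>x. indicator {- real (Suc j)..real (Suc j)} x *\<^sub>R h (of_real x + w) \<partial>lborel)
    / of_real (2 * real (Suc j))"
  have mean: "?M w \<longlonglongrightarrow> p \<theta>"
    if p: "\<And>x. ((\<lambda>v. p v * wave v (of_real x + w)) has_sum zero_product a (of_real x + w)) UNIV" for p w
  proof -
    have "((\<lambda>v. (p v * wave v w) * wave v (of_real x)) has_sum zero_product a (of_real x + w)) UNIV" for x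
      using p[of x] unfolding wave_add by (simp only: mult_ac)
    from fourier_bohr_coefficient[OF this, of \<theta>]
    have "(\<lambda>j. wave (- \<theta>) w * ((\<integral>x. indicator {- real (Suc j)..real (Suc j)} x *\<^sub>R
        (zero_product a (of_real x + w) * wave (- \<theta>) (of_real x)) \<partial>lborel) / of_real (2 * real (Suc j))))
        \<longlonglongrightarrow> wave (- \<theta>) w * (p \<theta> * wave \<theta> w)"
      by (rule tendsto_mult[OF tendsto_const])
    moreover have "wave (- \<theta>) w * (p \<theta> * wave \<theta> w) = p \<theta>"
      using wave_mult[of "- \<theta>" w \<theta>] by (simp add: mult_ac)
    moreover have "wave (- \<theta>) w * ((\<integral>x. indicator {- real (Suc j)..real (Suc j)} x *\<^sub>R
        (zero_product a (of_real x + w) * wave (- \<theta>) (of_real x)) \<partial>lborel) / of_real (2 * real (Suc j))) = ?M w j" for j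
      unfolding h_def wave_add times_divide_eq_right integral_mult_right_zero[symmetric]
      by (simp only: mult_scaleR_right mult_ac)
    ultimately show ?thesis by (simp only:)
  qed
  have "?M \<i> \<longlonglongrightarrow> q \<theta>"
    by (rule mean) (use up in \<open>simp add: upper_def\<close>)
  moreover have "?M (- \<i>) \<longlonglongrightarrow> cnj (q (- \<theta>))"
    by (rule mean) (rule lower_expansion[OF up], simp)
  ultimately have diff: "(\<lambda>j. ?M \<i> j - ?M (- \<i>) j) \<longlonglongrightarrow> q \<theta> - cnj (q (- \<theta>))"
    by (rule tendsto_diff)
  have holo: "h holomorphic_on UNIV"
    unfolding h_def by (intro holomorphic_intros zero_product_holomorphic)
  obtain \<Phi> where \<Phi>: "\<And>z. z \<in> UNIV \<Longrightarrow> (\<Phi> has_field_derivative h z) (at z within UNIV)"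
    using holomorphic_convex_primitive'[OF convex_UNIV open_UNIV holo] by blast
  have int: "(\<integral>x. indicator {-T..T} x *\<^sub>R h (of_real x + w) \<partial>lborel) = \<Phi> (of_real T + w) - \<Phi> (of_real (- T) + w)"
    if "0 \<le> T" for T w
  proof (rule integral_FTC_Icc)
    fix x
    have "((\<lambda>z. \<Phi> (z + w)) has_field_derivative h (of_real x + w)) (at (of_real x))"
      using \<Phi>[of "of_real x + w"] by (simp add: DERIV_shift)
    from has_vector_derivative_real_field[OF this]
    show "((\<lambda>x. \<Phi> (of_real x + w)) has_vector_derivative h (of_real x + w)) (at x within {-T..T})"
      by (rule has_vector_derivative_at_within)
  next
    show "continuous_on {-T..T} (\<lambda>x. h (of_real x + w))"
      by (rule continuous_on_compose2[OF holomorphic_on_imp_continuous_on[OF holo]])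
        (auto intro!: continuous_intros)
  qed (use that in simp)
  define S where "S = {z. \<bar>Im z\<bar> \<le> 1}"
  have S: "convex S"
  proof -
    have "S = {z. Im z \<le> 1} \<inter> {z. Im z \<ge> -1}" by (auto simp: S_def abs_le_iff)
    then show ?thesis by (simp add: convex_Int convex_halfspace_Im_le convex_halfspace_Im_ge)
  qed
  have i: "\<i> \<in> upper" by (simp add: upper_def)
  have qs: "(\<lambda>w. norm (q w * wave w \<i>)) summable_on UNIV"
    using has_sum_imp_summable[OF up[rule_format, OF i]]
    by (simp only: summable_on_iff_abs_summable_on_complex)
  define A where "A = (\<Sum>\<^sub>\<infinity>w. norm (q w * wave w \<i>))"
  have fA: "norm (zero_product a z) \<le> A" if "z \<in> S" for z
  proof -
    have "norm (zero_product a (of_real (Re z) + \<i>)) \<le> A"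
    proof (rule norm_infsum_le)
      show "((\<lambda>w. q w * wave w (of_real (Re z) + \<i>)) has_sum zero_product a (of_real (Re z) + \<i>)) UNIV"
        using up by (simp add: upper_def)
      show "((\<lambda>w. norm (q w * wave w \<i>)) has_sum A) UNIV"
        unfolding A_def by (rule has_sum_infsum[OF qs])
    qed (simp add: norm_mult)
    moreover have "norm (zero_product a z) \<le> norm (zero_product a (of_real (Re z) + \<i>))"
      using that by (intro zero_product_mono) (simp add: S_def)
    ultimately show ?thesis by simp
  qed
  have A0: "0 \<le> A" unfolding A_def by (rule infsum_nonneg) simp
  define B where "B = A * exp (2 * pi * \<bar>\<theta>\<bar>)"
  have hB: "norm (h z) \<le> B" if "z \<in> S" for z
  proof -
    have "\<theta> * Im z \<le> \<bar>\<theta>\<bar> * \<bar>Im z\<bar>"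
      unfolding abs_mult[symmetric] by (rule abs_ge_self)
    also have "\<dots> \<le> \<bar>\<theta>\<bar> * 1"
      using that by (intro mult_left_mono) (simp_all add: S_def)
    finally have "\<theta> * Im z \<le> \<bar>\<theta>\<bar> * 1" .
    then have "norm (wave (- \<theta>) z) \<le> exp (2 * pi * \<bar>\<theta>\<bar>)"
      by (simp add: mult_ac)
    then show ?thesis
      unfolding h_def norm_mult B_def by (intro mult_mono fA[OF that] A0) auto
  qed
  have vert: "norm (\<Phi> (of_real t + \<i>) - \<Phi> (of_real t + - \<i>)) \<le> 2 * B" for t
  proof -
    have "norm (\<Phi> (of_real t + \<i>) - \<Phi> (of_real t + - \<i>)) \<le> B * norm ((of_real t + \<i>) - (of_real t + - \<i>))"
      by (rule field_differentiable_bound[OF S _ hB])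
        (use \<Phi> in \<open>auto simp: S_def intro: has_field_derivative_at_within\<close>)
    then show ?thesis by (simp add: norm_mult)
  qed
  have "(\<lambda>j. ?M \<i> j - ?M (- \<i>) j) \<longlonglongrightarrow> 0"
  proof (rule Lim_null_comparison)
    show "\<forall>\<^sub>F j in sequentially. norm (?M \<i> j - ?M (- \<i>) j) \<le> 2 * B * (1 / real (Suc j))"
    proof (intro always_eventually allI)
      fix j
      define T where "T = real (Suc j)"
      have T: "0 \<le> T" "0 < T" by (simp_all add: T_def)
      have "?M \<i> j - ?M (- \<i>) j = ((\<Phi> (of_real T + \<i>) - \<Phi> (of_real T + - \<i>))
          - (\<Phi> (of_real (- T) + \<i>) - \<Phi> (of_real (- T) + - \<i>))) / of_real (2 * T)"
        unfolding T_def[symmetric] int[OF T(1)] diff_divide_distrib[symmetric] by (simp only: algebra_simps)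
      also have "norm \<dots> \<le> (2 * B + 2 * B) / (2 * T)"
      proof -
        have "norm (of_real (2 * T) :: complex) = 2 * T" using T by simp
        then show ?thesis
          unfolding norm_divide using T
          by (simp only:) (rule divide_right_mono[OF order.trans[OF norm_triangle_ineq4 add_mono[OF vert vert]]], simp)
      qed
      also have "\<dots> = 2 * B * (1 / T)" using T by (simp add: field_simps)
      finally show "norm (?M \<i> j - ?M (- \<i>) j) \<le> 2 * B * (1 / real (Suc j))"
        unfolding T_def .
    qed
    have "(\<lambda>j. 2 * B * (1 / real (Suc j))) \<longlonglongrightarrow> 2 * B * 0"
      by (intro tendsto_intros lim_1_over_n[THEN LIMSEQ_Suc])
    then show "(\<lambda>j. 2 * B * (1 / real (Suc j))) \<longlonglongrightarrow> 0" by simp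
  qed
  with diff have "q \<theta> - cnj (q (- \<theta>)) = 0" by (rule LIMSEQ_unique)
  then show ?thesis by simp
qed

text \<open>The coefficients vanish below \<open>\<alpha>\<close>, hence by symmetry above \<open>-\<alpha>\<close>. Bounded frequencies let absolute
  convergence at one height pass to all of them, and the real line is reached as a limit from above.\<close>

theorem zero_product_exponential_sum:
  obtains \<Omega> :: "real set" and q :: "real \<Rightarrow> complex" where
    "countable \<Omega>" "bounded \<Omega>" "\<Omega> \<noteq> {}" "Sup \<Omega> \<in> \<Omega>" "Inf \<Omega> \<in> \<Omega>" "\<forall>w\<in>\<Omega>. q w \<noteq> 0"
    "(\<lambda>w. norm (q w)) summable_on \<Omega>"
    "\<forall>z. ((\<lambda>w. q w * wave w z) has_sum zero_product a z) \<Omega>"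
proof -
  obtain q \<alpha> where q\<alpha>: "q \<alpha> \<noteq> 0" and below: "\<forall>w<\<alpha>. q w = 0"
    and up: "\<forall>z\<in>upper. ((\<lambda>w. q w * wave w z) has_sum zero_product a z) UNIV"
    by (rule upper_expansion)
  have sym: "q w = cnj (q (- w))" for w
    by (rule coefficients_symmetric[OF up])
  define \<Omega> where "\<Omega> = {w. q w \<noteq> 0}"
  have range: "\<alpha> \<le> w" "w \<le> - \<alpha>" if "w \<in> \<Omega>" for w
  proof -
    have "q w \<noteq> 0" "q (- w) \<noteq> 0" using that sym[of w] by (auto simp: \<Omega>_def)
    then show "\<alpha> \<le> w" "w \<le> - \<alpha>"
      using below[rule_format, of w] below[rule_format, of "- w"] by (auto simp: not_less[symmetric])
  qed
  have ends: "\<alpha> \<in> \<Omega>" "- \<alpha> \<in> \<Omega>"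
    using q\<alpha> sym[of "- \<alpha>"] by (auto simp: \<Omega>_def)
  have i: "\<i> \<in> upper" by (simp add: upper_def)
  have qi: "(\<lambda>w. norm (q w * wave w \<i>)) summable_on UNIV"
    using has_sum_imp_summable[OF up[rule_format, OF i]]
    by (simp only: summable_on_iff_abs_summable_on_complex)
  have qs: "(\<lambda>w. norm (q w)) summable_on \<Omega>"
  proof (rule summable_on_comparison_test)
    show "(\<lambda>w. exp (2 * pi * \<bar>\<alpha>\<bar>) * norm (q w * wave w \<i>)) summable_on \<Omega>"
      by (intro summable_on_cmult_right summable_on_subset_banach[OF qi]) auto
    fix w assume "w \<in> \<Omega>"
    then have "2 * pi * w \<le> 2 * pi * \<bar>\<alpha>\<bar>"
      using range[of w] by (intro mult_left_mono) auto
    then have "1 \<le> exp (2 * pi * \<bar>\<alpha>\<bar>) * norm (wave w \<i>)"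
      by (simp flip: exp_add)
    from mult_left_mono[OF this norm_ge_zero[of "q w"]]
    show "norm (q w) \<le> exp (2 * pi * \<bar>\<alpha>\<bar>) * norm (q w * wave w \<i>)"
      by (simp only: norm_mult mult_ac mult_1_right)
  qed simp
  have restrict: "((\<lambda>w. q w * wave w z) has_sum f) \<Omega>" if "((\<lambda>w. q w * wave w z) has_sum f) UNIV" for z f
    using that by (rule has_sum_cong_neutral[THEN iffD1, rotated 3]) (auto simp: \<Omega>_def)
  have off: "((\<lambda>w. q w * wave w z) has_sum zero_product a z) \<Omega>" if "Im z \<noteq> 0" for z
  proof (cases "0 < Im z")
    case True
    then show ?thesis using up by (intro restrict) (simp add: upper_def)
  next
    case False
    with that have "Im z < 0" by simp
    from lower_expansion[OF up this] show ?thesis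
      unfolding sym[symmetric] by (rule restrict)
  qed
  have real: "((\<lambda>w. q w * wave w z) has_sum zero_product a z) \<Omega>" if z: "Im z = 0" for z
  proof -
    let ?z = "\<lambda>j. z + \<i> * of_real (1 / real (Suc j))"
    have "(\<lambda>j. z + \<i> * of_real (1 / real (Suc j))) \<longlonglongrightarrow> z + \<i> * of_real 0"
      by (intro tendsto_intros lim_1_over_n[THEN LIMSEQ_Suc])
    then have zl: "?z \<longlonglongrightarrow> z" by simp
    have hs: "((\<lambda>w. q w * wave w (?z j)) has_sum zero_product a (?z j)) \<Omega>" for j
      by (rule off) (simp add: z)
    have lim: "(\<lambda>j. q w * wave w (?z j)) \<longlonglongrightarrow> q w * wave w z" for w
      by (intro tendsto_intros zl)
    have le: "norm (q w * wave w (?z j)) \<le> exp (2 * pi * \<bar>\<alpha>\<bar>) * norm (q w)" if "w \<in> \<Omega>" for w j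
    proof -
      have "\<bar>w\<bar> * (1 / real (Suc j)) \<le> \<bar>\<alpha>\<bar> * 1"
        using range[OF that] by (intro mult_mono) auto
      then have "2 * pi * (\<bar>w\<bar> * (1 / real (Suc j))) \<le> 2 * pi * \<bar>\<alpha>\<bar>"
        by (intro mult_left_mono) auto
      moreover have "- (w * (1 / real (Suc j))) \<le> \<bar>w\<bar> * (1 / real (Suc j))"
        using mult_right_mono[of "- w" "\<bar>w\<bar>" "1 / real (Suc j)"] by simp
      then have "2 * pi * - (w * (1 / real (Suc j))) \<le> 2 * pi * (\<bar>w\<bar> * (1 / real (Suc j)))"
        by (intro mult_left_mono) auto
      ultimately have "norm (wave w (?z j)) \<le> exp (2 * pi * \<bar>\<alpha>\<bar>)"
        by (simp add: z)
      then show ?thesis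
        unfolding norm_mult by (subst mult.commute) (rule mult_right_mono, simp_all)
    qed
    note dom = has_sum_dominated_convergence[OF hs lim le summable_on_cmult_right[OF qs] sequentially_bot]
    have "isCont (zero_product a) z"
      using zero_product_holomorphic holomorphic_on_imp_continuous_on
      by (metis UNIV_I continuous_on_eq_continuous_at open_UNIV)
    from LIMSEQ_unique[OF dom(1) isCont_tendsto_compose[OF this zl]]
    show ?thesis using has_sum_infsum[OF dom(2)] by simp
  qed
  show ?thesis
  proof (rule that[of \<Omega> q])
    show "countable \<Omega>"
      using abs_summable_countable[OF qs] by (simp add: \<Omega>_def)
    show "bounded \<Omega>"
      using range by (intro bounded_subset[OF bounded_closed_interval[of \<alpha> "- \<alpha>"]]) auto
    show "Sup \<Omega> \<in> \<Omega>" using cSup_eq_maximum[OF ends(2) range(2)] ends by simp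
    show "Inf \<Omega> \<in> \<Omega>" using cInf_eq_minimum[OF ends(1) range(1)] ends by simp
    show "\<forall>z. ((\<lambda>w. q w * wave w z) has_sum zero_product a z) \<Omega>"
      using off real by blast
  qed (use ends qs in \<open>auto simp: \<Omega>_def\<close>)
qed

end

theorem theorem3:
  fixes \<Lambda> \<Gamma> :: "real set"
    and c :: "real \<Rightarrow> nat"
    and b :: "real \<Rightarrow> complex"
    and \<mu> abs_mu_hat :: "(real \<Rightarrow> complex) \<Rightarrow> complex"
    and a :: "int \<Rightarrow> real"
  assumes "\<Lambda> \<noteq> {}"
    and "discrete \<Lambda>"
    and "\<And>r. finite (\<Lambda> \<inter> {-r..r})"
    and "\<And>l. l \<in> \<Lambda> \<Longrightarrow> c l > 0"
    and "temperate_distribution \<mu>"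
    and "is_point_measure \<mu> \<Lambda> (\<lambda>l. of_nat (c l))"
    and "countable \<Gamma>"
    and "is_point_measure (fourier_distribution \<mu>) \<Gamma> b"
    and "temperate_distribution abs_mu_hat"
    and "is_point_measure abs_mu_hat \<Gamma> (\<lambda>g. of_real (norm (b g)))"
    and "\<And>n. a n \<le> a (n + 1)"
    and "range a = \<Lambda>"
    and "\<And>l. l \<in> \<Lambda> \<Longrightarrow> card {n. a n = l} = c l"
    and "0 \<notin> \<Lambda>"
    and "(\<integral>\<^sup>+s\<in>{0<..<1}. ennreal ((\<Sum>\<^sub>\<infinity>g\<in>\<Gamma> \<inter> {0<..<s}. norm (b g)) / s\<^sup>2) \<partial>lborel) < \<infinity>"
  shows "(\<forall>z. convergent_prod (\<lambda>n. symmetric_factor a z (Suc n))) \<and>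
    zero_product a holomorphic_on UNIV \<and>
    {z. zero_product a z = 0} = of_real ` \<Lambda> \<and>
    (\<forall>l\<in>\<Lambda>. zorder (zero_product a) (of_real l) = int (c l)) \<and>
    (\<exists>(\<Omega> :: real set) (q :: real \<Rightarrow> complex).
       countable \<Omega> \<and> bounded \<Omega> \<and> \<Omega> \<noteq> {} \<and> Sup \<Omega> \<in> \<Omega> \<and> Inf \<Omega> \<in> \<Omega> \<and>
       (\<forall>\<omega>\<in>\<Omega>. q \<omega> \<noteq> 0) \<and>
       (\<lambda>\<omega>. norm (q \<omega>)) summable_on \<Omega> \<and>
       (\<forall>z. ((\<lambda>\<omega>. q \<omega> * exp (2 * of_real pi * \<i> * of_real \<omega> * z)) has_sum zero_product a z) \<Omega>))"
proof -
  interpret pure_point_transform \<Lambda> \<Gamma> c b \<mu> abs_mu_hat a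
    by unfold_locales (use assms(4-10,12,13) in auto)
  have small: "(\<lambda>g. norm (b g) / g) summable_on (\<Gamma> \<inter> {0<..<1})"
  proof (rule summable_small_frequencies[OF norm_ge_zero _ assms(15)])
    have "(\<lambda>g. norm (b g)) summable_on (\<Gamma> \<inter> {-1..1})"
      using assms(8) by (simp add: is_point_measure_def)
    then show "(\<lambda>g. norm (b g)) summable_on (\<Gamma> \<inter> {0<..<1})"
      by (rule summable_on_subset_banach) auto
  qed
  interpret spectral_zeros a "\<Gamma> \<inter> {0<..}" b
  proof
    show "a n \<le> a (n + 1)" for n by (rule assms(11))
    show "a n \<noteq> 0" for n using assms(12,14) by (metis rangeI)
    show "\<exists>B. \<forall>x F. finite F \<longrightarrow> (\<Sum>n\<in>F. 1 / (1 + (x - a n)\<^sup>2)) \<le> B"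
      by (rule cauchy_kernel_sum_bounded) (rule exI)
    show "(\<lambda>g. norm (b g) / g * exp (- y * g)) summable_on (\<Gamma> \<inter> {0<..})" if "y > 0" for y
      by (rule spectral_positive_summable[OF small that])
    show "((\<lambda>g. b g * (of_real g * exp (2 * of_real pi * \<i> * of_real g * z))) has_sum
        (- 1 / (4 * of_real pi ^ 2)) * (\<Sum>\<^sub>\<infinity>n. 1 / (z - of_real (a n))\<^sup>2)) (\<Gamma> \<inter> {0<..})"
      if "Im z > 0" for z
      using cauchy_kernel_formula[OF that]
      by (rule has_sum_cong_neutral[THEN iffD1, rotated 3]) (auto simp: max_def)
  qed auto
  obtain \<Omega> q where "countable \<Omega>" "bounded \<Omega>" "\<Omega> \<noteq> {}" "Sup \<Omega> \<in> \<Omega>" "Inf \<Omega> \<in> \<Omega>" "\<forall>w\<in>\<Omega>. q w \<noteq> 0"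
    "(\<lambda>w. norm (q w)) summable_on \<Omega>"
    "\<forall>z. ((\<lambda>w. q w * exp (2 * of_real pi * \<i> * of_real w * z)) has_sum zero_product a z) \<Omega>"
    by (rule zero_product_exponential_sum)
  then have "\<exists>(\<Omega> :: real set) (q :: real \<Rightarrow> complex).
      countable \<Omega> \<and> bounded \<Omega> \<and> \<Omega> \<noteq> {} \<and> Sup \<Omega> \<in> \<Omega> \<and> Inf \<Omega> \<in> \<Omega> \<and>
      (\<forall>\<omega>\<in>\<Omega>. q \<omega> \<noteq> 0) \<and> (\<lambda>\<omega>. norm (q \<omega>)) summable_on \<Omega> \<and>
      (\<forall>z. ((\<lambda>\<omega>. q \<omega> * exp (2 * of_real pi * \<i> * of_real \<omega> * z)) has_sum zero_product a z) \<Omega>)"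
    by (intro exI[of _ \<Omega>] exI[of _ q] conjI)
  moreover have "{z. zero_product a z = 0} = of_real ` \<Lambda>"
    by (simp add: zero_product_eq_0_iff assms(12))
  moreover have "\<forall>l\<in>\<Lambda>. zorder (zero_product a) (of_real l) = int (c l)"
    using zero_product_zorder assms(13) by simp
  ultimately show ?thesis
    using symmetric_factor_convergent zero_product_holomorphic by blast
qed

end
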